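(* Let $G$ be a connected Lie group whose Lie algebra $\mathfrak g$ is a noncompact noncomplex real simple Lie algebra, let $\theta$ be a Cartan involution with Cartan decomposition $\mathfrak g=\mathfrak k\oplus\mathfrak p$, and let $\mathfrak h_0=\mathfrak t\oplus\mathfrak a$ be a maximally noncompact $\theta$-stable Cartan subalgebra with $\mathfrak a=\mathfrak h_0\cap\mathfrak p$. Let $\{\alpha_1,\dots,\alpha_j\}\subset\Delta(\mathfrak g^{\mathbb C},\mathfrak h_0^{\mathbb C})$ be a real admissible root system and let $\beta_n=\alpha_n|_{\mathfrak a}\in\Sigma^+$ for $n=1,\dots,j$. Let $\Sigma_0=\Sigma^+$. For each $n=1,\dots,j$, let $\Sigma_n$ be the largest subset of $\Sigma_{n-1}$ such that (1) for each $m=1,\dots,n$, if $\mu\in\Sigma_n$ and $\mu\pm\beta_m\in\Sigma$, then $\mu\pm\beta_m\in\Sigma_n$; (2) for each $m=1,\dots,n$, we have $\pm\beta_m\notin(\Sigma_n+\Sigma_n)\cap\Sigma$; and (3) $(\Sigma_n+\Sigma_n)\cap\Sigma\subset\Sigma_n$. Then $\mathfrak n_n:=\bigoplus_{\mu\in\Sigma_n}\mathfrak g_\mu$ is an $\mathfrak h_{\{\alpha_1,\dots,\alpha_n\}}$-stable subalgebra of $\mathfrak g$. Moreover, if $X\in\mathfrak g$ is a regular element whose stabilizer algebra is $\mathfrak g_X=\mathfrak h_{\{\alpha_1,\dots,\alpha_n\}}$, then $\mathfrak n_n$ is an $\omega_X$-isotropic subspace of $T_X(Ad_GX)$ and hence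 induces a left-invariant isotropic foliation $\mathcal N_n$ of $Ad_GX$ with $(\mathcal N_n)_X=\mathfrak n_n$.
   Context: $B$ is the Killing form. $X\in\mathfrak g$ is regular if the coefficient of $\lambda^r$ in $\det(\lambda\mathbf 1-ad_X)$ is nonzero, $r$ being the rank of $\mathfrak g$; the stabilizer algebra is $\mathfrak g_X=\{Y\in\mathfrak g:[X,Y]=0\}$. A $\theta$-stable Cartan subalgebra $\mathfrak h$ is maximally noncompact if $\dim(\mathfrak h\cap\mathfrak p)$ is as large as possible; $\mathfrak t=\mathfrak h_0\cap\mathfrak k$. $\Delta=\Delta(\mathfrak g^{\mathbb C},\mathfrak h_0^{\mathbb C})$ is the root system, $\Sigma=\Sigma(\mathfrak g,\mathfrak a)$ is the restricted root system, and $\mathfrak g_\mu$ ($\mu\in\Sigma$) are the restricted root spaces; positive systems $\Delta^+$ and $\Sigma^+$ are chosen compatibly, so that positive roots with nonzero restriction to $\mathfrak a$ restrict to positive restricted roots. A root is real if it takes real values on $\mathfrak h_0$, equivalently if it vanishes on $\mathfrak t$. A real admissible root system is a set $\{\alpha_1,\dots,\alpha_j\}$ of distinct positive real roots with $\alpha_i\pm\alpha_k\notin\Delta$ for all $i,k$. For a real root $\alpha$, $E_\alpha$ is a vector in the intersection of the $\alpha$-root space with $\mathfrak g$, normalized by $B(E_\alpha,\theta E_\alpha)=-2/|\alpha|^2$. The $\theta$-stable Cartan subalgebra associated to $\{\alpha_1,\dots,\alpha_n\}$ is $$\mathfrak h_{\{\alpha_1,\dots,\alpha_n\}}=\bigcap_{m=1}^n\ker(\alpha_m|_{\mathfrak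 h_0})\oplus\bigoplus_{m=1}^n\mathbb R(E_{\alpha_m}+\theta E_{\alpha_m}).$$ $T_X(Ad_GX)=\{[U,X]:U\in\mathfrak g\}$ is identified with $\mathfrak g/\mathfrak g_X$ via $U\mapsto[U,X]$, and subspaces of $\mathfrak g$ complementary to or meeting $\mathfrak g_X$ trivially are regarded as subspaces of $T_X(Ad_GX)$ in this way. The Kirillov form $\omega$ is the $G$-invariant symplectic form on $Ad_GX$ with $\omega_X(U,V)=B(X,[U,V])$ under this identification. A foliation of $Ad_GX$ is left-invariant if its tangent distribution is invariant under the action of $G$ by $Ad$, and isotropic if $\omega$ vanishes on its tangent spaces.
   Formalization: Condition (1) is read with Σ∪{0} in place of Σ, so β_m (m≤n) is excluded from Σ_n; as printed the claim fails: for sl(2,R), Σ_1={β} meets (1)–(3), but n_1 is not stable under the associated Cartan subalgebra. *)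

theory Defs
  imports
    "HOL-Analysis.Analysis"
    "HOL-Algebra.Group"
    "HOL-Computational_Algebra.Polynomial"
    "HOL-Library.Function_Algebras"
    "HOL-Library.Set_Algebras"
begin

section \<open>Lie algebras\<close>

text \<open>A finite-dimensional Lie algebra over a field is a bracket on a coordinate space
  \<^typ>\<open>'a^'n\<close>.  The definitions shared by a real Lie algebra and its complexification are
  polymorphic in the field.\<close>

definition lie_algebra :: "('a::field^'n \<Rightarrow> 'a^'n \<Rightarrow> 'a^'n) \<Rightarrow> bool" where
  "lie_algebra br \<longleftrightarrow>
     (\<forall>x y z. br (x + y) z = br x z + br y z) \<and>
     (\<forall>x y z. br x (y + z) = br x y + br x z) \<and>
     (\<forall>c x y. br (c *s x) y = c *s br x y) \<and>
     (\<forall>c x y. br x (c *s y) = c *s br x y) \<and>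
     (\<forall>x. br x x = 0) \<and>
     (\<forall>x y z. br x (br y z) + br y (br z x) + br z (br x y) = 0)"

definition killing :: "('a::field^'n \<Rightarrow> 'a^'n \<Rightarrow> 'a^'n) \<Rightarrow> 'a^'n \<Rightarrow> 'a^'n \<Rightarrow> 'a" where
  "killing br x y = trace (matrix (\<lambda>z. br x (br y z)))"

definition subalgebra :: "(real^'n \<Rightarrow> real^'n \<Rightarrow> real^'n) \<Rightarrow> (real^'n) set \<Rightarrow> bool" where
  "subalgebra br S \<longleftrightarrow> subspace S \<and> (\<forall>x\<in>S. \<forall>y\<in>S. br x y \<in> S)"

definition lie_ideal :: "(real^'n \<Rightarrow> real^'n \<Rightarrow> real^'n) \<Rightarrow> (real^'n) set \<Rightarrow> bool" where
  "lie_ideal br S \<longleftrightarrow> subspace S \<and> (\<forall>x. \<forall>y\<in>S. br x y \<in> S)"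

definition simple_lie_algebra :: "(real^'n \<Rightarrow> real^'n \<Rightarrow> real^'n) \<Rightarrow> bool" where
  "simple_lie_algebra br \<longleftrightarrow>
     lie_algebra br \<and> (\<exists>x y. br x y \<noteq> 0) \<and> (\<forall>S. lie_ideal br S \<longrightarrow> S = {0} \<or> S = UNIV)"

text \<open>A semisimple real Lie algebra is compact when its Killing form is negative definite.\<close>

definition compact_lie_algebra :: "(real^'n \<Rightarrow> real^'n \<Rightarrow> real^'n) \<Rightarrow> bool" where
  "compact_lie_algebra br \<longleftrightarrow> (\<forall>x. x \<noteq> 0 \<longrightarrow> killing br x x < 0)"

text \<open>A real Lie algebra is complex when it underlies a complex Lie algebra; \<open>J\<close> is
  multiplication by the imaginary unit.\<close>

definition complex_lie_algebra :: "(real^'n \<Rightarrow> real^'n \<Rightarrow> real^'n) \<Rightarrow> bool" where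
  "complex_lie_algebra br \<longleftrightarrow>
     (\<exists>J. linear J \<and> (\<forall>x. J (J x) = - x) \<and> (\<forall>x y. br (J x) y = J (br x y)))"

definition cartan_involution ::
  "(real^'n \<Rightarrow> real^'n \<Rightarrow> real^'n) \<Rightarrow> (real^'n \<Rightarrow> real^'n) \<Rightarrow> bool" where
  "cartan_involution br \<theta> \<longleftrightarrow>
     linear \<theta> \<and> (\<forall>x y. \<theta> (br x y) = br (\<theta> x) (\<theta> y)) \<and> (\<forall>x. \<theta> (\<theta> x) = x) \<and>
     (\<forall>x. x \<noteq> 0 \<longrightarrow> - killing br x (\<theta> x) > 0)"

definition cartan_p :: "(real^'n \<Rightarrow> real^'n) \<Rightarrow> (real^'n) set" where
  "cartan_p \<theta> = {x. \<theta> x = - x}"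

primrec lower_central ::
  "(real^'n \<Rightarrow> real^'n \<Rightarrow> real^'n) \<Rightarrow> (real^'n) set \<Rightarrow> nat \<Rightarrow> (real^'n) set" where
  "lower_central br S 0 = S"
| "lower_central br S (Suc k) = span {br x y | x y. x \<in> S \<and> y \<in> lower_central br S k}"

definition cartan_subalgebra ::
  "(real^'n \<Rightarrow> real^'n \<Rightarrow> real^'n) \<Rightarrow> (real^'n) set \<Rightarrow> bool" where
  "cartan_subalgebra br h \<longleftrightarrow>
     subalgebra br h \<and> (\<exists>k. lower_central br h k = {0}) \<and> {x. \<forall>y\<in>h. br x y \<in> h} = h"

definition max_noncompact_cartan ::
  "(real^'n \<Rightarrow> real^'n \<Rightarrow> real^'n) \<Rightarrow> (real^'n \<Rightarrow> real^'n) \<Rightarrow> (real^'n) set \<Rightarrow> bool" where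
  "max_noncompact_cartan br \<theta> h \<longleftrightarrow>
     cartan_subalgebra br h \<and> \<theta> ` h = h \<and>
     (\<forall>h'. cartan_subalgebra br h' \<and> \<theta> ` h' = h' \<longrightarrow>
        dim (h' \<inter> cartan_p \<theta>) \<le> dim (h \<inter> cartan_p \<theta>))"

text \<open>\<open>det (\<lambda> 1 - ad x)\<close> as a polynomial in \<open>\<lambda>\<close>.\<close>

definition ad_char_poly :: "(real^'n \<Rightarrow> real^'n \<Rightarrow> real^'n) \<Rightarrow> real^'n \<Rightarrow> real poly" where
  "ad_char_poly br x =
     det (\<chi> i j. (if i = j then [:0, 1:] else 0) - [:matrix (br x) $ i $ j:])"

definition lie_rank :: "(real^'n \<Rightarrow> real^'n \<Rightarrow> real^'n) \<Rightarrow> nat" where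
  "lie_rank br = (LEAST r. \<exists>x. coeff (ad_char_poly br x) r \<noteq> 0)"

definition regular_element :: "(real^'n \<Rightarrow> real^'n \<Rightarrow> real^'n) \<Rightarrow> real^'n \<Rightarrow> bool" where
  "regular_element br x \<longleftrightarrow> coeff (ad_char_poly br x) (lie_rank br) \<noteq> 0"

definition stabilizer_algebra ::
  "(real^'n \<Rightarrow> real^'n \<Rightarrow> real^'n) \<Rightarrow> real^'n \<Rightarrow> (real^'n) set" where
  "stabilizer_algebra br x = {y. br x y = 0}"


section \<open>Complexification, roots and restricted roots\<close>

definition cvec :: "real^'n \<Rightarrow> complex^'n" where
  "cvec x = (\<chi> i. complex_of_real (x $ i))"

definition re_vec :: "complex^'n \<Rightarrow> real^'n" where
  "re_vec z = (\<chi> i. Re (z $ i))"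

definition im_vec :: "complex^'n \<Rightarrow> real^'n" where
  "im_vec z = (\<chi> i. Im (z $ i))"

definition complexify_bracket ::
  "(real^'n \<Rightarrow> real^'n \<Rightarrow> real^'n) \<Rightarrow> complex^'n \<Rightarrow> complex^'n \<Rightarrow> complex^'n" where
  "complexify_bracket br z w =
     cvec (br (re_vec z) (re_vec w) - br (im_vec z) (im_vec w)) +
     \<i> *s cvec (br (re_vec z) (im_vec w) + br (im_vec z) (re_vec w))"

definition complexify_space :: "(real^'n) set \<Rightarrow> (complex^'n) set" where
  "complexify_space S = {z. re_vec z \<in> S \<and> im_vec z \<in> S}"

text \<open>A functional on a subspace \<open>h\<close> is represented by the function that extends it by zero
  outside \<open>h\<close>.  Equality, sums and negatives of functionals on \<open>h\<close> are then the pointwise ones.\<close>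

definition functional_on :: "('a::field^'n) set \<Rightarrow> ('a^'n \<Rightarrow> 'a) \<Rightarrow> bool" where
  "functional_on h f \<longleftrightarrow>
     (\<forall>x\<in>h. \<forall>y\<in>h. f (x + y) = f x + f y) \<and> (\<forall>c. \<forall>x\<in>h. f (c *s x) = c * f x) \<and>
     (\<forall>x. x \<notin> h \<longrightarrow> f x = 0)"

definition root_space ::
  "('a::field^'n \<Rightarrow> 'a^'n \<Rightarrow> 'a^'n) \<Rightarrow> ('a^'n) set \<Rightarrow> ('a^'n \<Rightarrow> 'a) \<Rightarrow> ('a^'n) set" where
  "root_space br h f = {x. \<forall>y\<in>h. br y x = f y *s x}"

text \<open>With \<open>h\<close> the complexified Cartan subalgebra this is \<open>\<Delta>\<close>, with \<open>h = \<aa>\<close> in the real Lie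
  algebra it is the restricted root system \<open>\<Sigma>\<close>.\<close>

definition roots ::
  "('a::field^'n \<Rightarrow> 'a^'n \<Rightarrow> 'a^'n) \<Rightarrow> ('a^'n) set \<Rightarrow> ('a^'n \<Rightarrow> 'a) set" where
  "roots br h = {f. functional_on h f \<and> f \<noteq> 0 \<and> root_space br h f \<noteq> {0}}"

definition complex_roots ::
  "(real^'n \<Rightarrow> real^'n \<Rightarrow> real^'n) \<Rightarrow> (real^'n) set \<Rightarrow> (complex^'n \<Rightarrow> complex) set" where
  "complex_roots br h = roots (complexify_bracket br) (complexify_space h)"

definition positive_system ::
  "('a::field^'n \<Rightarrow> 'a) set \<Rightarrow> ('a^'n \<Rightarrow> 'a) set \<Rightarrow> bool" where
  "positive_system R P \<longleftrightarrow>
     P \<subseteq> R \<and> (\<forall>f\<in>R. (f \<in> P) \<noteq> (- f \<in> P)) \<and> (P + P) \<inter> R \<subseteq> P"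

text \<open>Restriction to \<open>\<aa>\<close>; roots are real-valued on \<open>\<aa>\<close>, so taking the real part is only a
  change of type.\<close>

definition restrict_root ::
  "(real^'n) set \<Rightarrow> (complex^'n \<Rightarrow> complex) \<Rightarrow> real^'n \<Rightarrow> real" where
  "restrict_root a \<alpha> = (\<lambda>x. if x \<in> a then Re (\<alpha> (cvec x)) else 0)"

definition compatible_positive_systems ::
  "(real^'n) set \<Rightarrow> (complex^'n \<Rightarrow> complex) set \<Rightarrow> (real^'n \<Rightarrow> real) set \<Rightarrow> bool" where
  "compatible_positive_systems a \<Delta>p \<Sigma>p \<longleftrightarrow>
     (\<forall>\<alpha>\<in>\<Delta>p. restrict_root a \<alpha> \<noteq> 0 \<longrightarrow> restrict_root a \<alpha> \<in> \<Sigma>p)"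

definition real_root :: "(real^'n) set \<Rightarrow> (complex^'n \<Rightarrow> complex) \<Rightarrow> bool" where
  "real_root h \<alpha> \<longleftrightarrow> (\<forall>x\<in>h. \<alpha> (cvec x) \<in> \<real>)"

definition real_admissible ::
  "(real^'n \<Rightarrow> real^'n \<Rightarrow> real^'n) \<Rightarrow> (real^'n) set \<Rightarrow> (complex^'n \<Rightarrow> complex) set \<Rightarrow>
   (complex^'n \<Rightarrow> complex) set \<Rightarrow> bool" where
  "real_admissible br h \<Delta>p A \<longleftrightarrow>
     finite A \<and> A \<subseteq> \<Delta>p \<and> (\<forall>\<alpha>\<in>A. real_root h \<alpha>) \<and>
     (\<forall>\<alpha>\<in>A. \<forall>\<beta>\<in>A. \<alpha> + \<beta> \<notin> complex_roots br h \<and> \<alpha> - \<beta> \<notin> complex_roots br h)"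

text \<open>\<open>|\<alpha>|\<^sup>2 = B(H\<^sub>\<alpha>, H\<^sub>\<alpha>) = \<alpha>(H\<^sub>\<alpha>)\<close>, where \<open>H\<^sub>\<alpha>\<close> represents \<open>\<alpha>\<close> with respect to the
  Killing form on the complexified Cartan subalgebra; it is a positive real number.\<close>

definition root_dual ::
  "(real^'n \<Rightarrow> real^'n \<Rightarrow> real^'n) \<Rightarrow> (real^'n) set \<Rightarrow> (complex^'n \<Rightarrow> complex) \<Rightarrow> complex^'n" where
  "root_dual br h \<alpha> = (THE z. z \<in> complexify_space h \<and>
     (\<forall>w\<in>complexify_space h. killing (complexify_bracket br) z w = \<alpha> w))"

definition root_normsq ::
  "(real^'n \<Rightarrow> real^'n \<Rightarrow> real^'n) \<Rightarrow> (real^'n) set \<Rightarrow> (complex^'n \<Rightarrow> complex) \<Rightarrow> real" where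
  "root_normsq br h \<alpha> =
     Re (killing (complexify_bracket br) (root_dual br h \<alpha>) (root_dual br h \<alpha>))"

definition normalized_root_vector ::
  "(real^'n \<Rightarrow> real^'n \<Rightarrow> real^'n) \<Rightarrow> (real^'n \<Rightarrow> real^'n) \<Rightarrow> (real^'n) set \<Rightarrow>
   (complex^'n \<Rightarrow> complex) \<Rightarrow> real^'n \<Rightarrow> bool" where
  "normalized_root_vector br \<theta> h \<alpha> e \<longleftrightarrow>
     cvec e \<in> root_space (complexify_bracket br) (complexify_space h) \<alpha> \<and>
     killing br e (\<theta> e) = - 2 / root_normsq br h \<alpha>"

text \<open>The Cartan subalgebra associated to \<open>{\<alpha>\<^sub>1, \<dots>, \<alpha>\<^sub>n}\<close>, with \<open>E m\<close> a normalized root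
  vector for \<open>\<alpha> m\<close>.\<close>

definition cartan_transform ::
  "(real^'n \<Rightarrow> real^'n) \<Rightarrow> (real^'n) set \<Rightarrow> (nat \<Rightarrow> complex^'n \<Rightarrow> complex) \<Rightarrow>
   (nat \<Rightarrow> real^'n) \<Rightarrow> nat \<Rightarrow> (real^'n) set" where
  "cartan_transform \<theta> h \<alpha> E n =
     {x \<in> h. \<forall>m\<in>{1..n}. \<alpha> m (cvec x) = 0} + span ((\<lambda>m. E m + \<theta> (E m)) ` {1..n})"

text \<open>In the first condition the hypothesis \<open>\<mu> \<plusminus> \<beta>\<^sub>m \<in> \<Sigma>\<close> is read
  as ``\<open>\<mu> \<plusminus> \<beta>\<^sub>m\<close> is a weight of \<open>\<aa>\<close> on the Lie algebra'', so it includes the weight \<open>0\<close>.  Since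
  \<open>\<Sigma>\<^sub>n\<close> does not contain \<open>0\<close>, this excludes \<open>\<beta>\<^sub>m\<close> from \<open>\<Sigma>\<^sub>n\<close>.  This cannot be dropped: if
  \<open>\<beta>\<^sub>m \<in> \<Sigma>\<^sub>n\<close>, then \<open>E\<^sub>m\<close> lies in \<open>\<nn>\<^sub>n\<close> but \<open>[E\<^sub>m + \<theta> E\<^sub>m, E\<^sub>m]\<close> is a nonzero element of \<open>\<aa>\<close>, so
  that \<open>\<nn>\<^sub>n\<close> is not stable under the associated Cartan subalgebra; already for
  \<open>sl(2, \<real>)\<close> the set \<open>{\<beta>\<^sub>1}\<close> satisfies the conditions when \<open>0\<close> is left out.\<close>

definition sigma_conditions ::
  "(real^'n \<Rightarrow> real) set \<Rightarrow> (nat \<Rightarrow> real^'n \<Rightarrow> real) \<Rightarrow> nat \<Rightarrow> (real^'n \<Rightarrow> real) set \<Rightarrow> bool" where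
  "sigma_conditions \<Sigma> \<beta> n S \<longleftrightarrow>
     (\<forall>m\<in>{1..n}. \<forall>\<mu>\<in>S.
        (\<mu> + \<beta> m \<in> \<Sigma> \<union> {0} \<longrightarrow> \<mu> + \<beta> m \<in> S) \<and> (\<mu> - \<beta> m \<in> \<Sigma> \<union> {0} \<longrightarrow> \<mu> - \<beta> m \<in> S)) \<and>
     (\<forall>m\<in>{1..n}. \<beta> m \<notin> (S + S) \<inter> \<Sigma> \<and> - \<beta> m \<notin> (S + S) \<inter> \<Sigma>) \<and>
     (S + S) \<inter> \<Sigma> \<subseteq> S"

definition largest_with :: "('b set \<Rightarrow> bool) \<Rightarrow> 'b set \<Rightarrow> bool" where
  "largest_with P S \<longleftrightarrow> P S \<and> (\<forall>T. P T \<longrightarrow> T \<subseteq> S)"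

definition root_sum ::
  "(real^'n \<Rightarrow> real^'n \<Rightarrow> real^'n) \<Rightarrow> (real^'n) set \<Rightarrow> (real^'n \<Rightarrow> real) set \<Rightarrow> (real^'n) set" where
  "root_sum br a S = span (\<Union>\<mu>\<in>S. root_space br a \<mu>)"


section \<open>Lie groups and the adjoint representation\<close>

primrec Ck_on :: "nat \<Rightarrow> 'a::euclidean_space set \<Rightarrow> ('a \<Rightarrow> 'b::euclidean_space) \<Rightarrow> bool" where
  "Ck_on 0 S f \<longleftrightarrow> continuous_on S f"
| "Ck_on (Suc k) S f \<longleftrightarrow>
     (\<exists>f'. (\<forall>x\<in>S. (f has_derivative f' x) (at x)) \<and> (\<forall>v. Ck_on k S (\<lambda>x. f' x v)))"

text \<open>Infinitely often differentiable; used for open \<open>S\<close> only.\<close>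

definition smooth_on :: "'a::euclidean_space set \<Rightarrow> ('a \<Rightarrow> 'b::euclidean_space) \<Rightarrow> bool" where
  "smooth_on S f \<longleftrightarrow> (\<forall>k. Ck_on k S f)"

type_synonym ('p, 'e) chart = "'p set \<times> ('p \<Rightarrow> 'e)"

definition smooth_atlas ::
  "('p::topological_space, 'e::euclidean_space) chart set \<Rightarrow> bool" where
  "smooth_atlas C \<longleftrightarrow>
     (\<forall>(U, \<phi>)\<in>C. open U \<and> open (\<phi> ` U) \<and> homeomorphism U (\<phi> ` U) \<phi> (inv_into U \<phi>)) \<and>
     (\<Union>(U, \<phi>)\<in>C. U) = UNIV \<and>
     (\<forall>(U, \<phi>)\<in>C. \<forall>(V, \<psi>)\<in>C. smooth_on (\<phi> ` (U \<inter> V)) (\<psi> \<circ> inv_into U \<phi>))"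

text \<open>The group operations are smooth as maps of manifolds: they are continuous and smooth in
  all charts.\<close>

definition lie_group ::
  "('p::{t2_space, second_countable_topology}) monoid \<Rightarrow> ('p, 'e::euclidean_space) chart set \<Rightarrow> bool"
where
  "lie_group G C \<longleftrightarrow>
     group G \<and> carrier G = UNIV \<and> smooth_atlas C \<and>
     continuous_on UNIV (\<lambda>(x, y). x \<otimes>\<^bsub>G\<^esub> y) \<and>
     continuous_on UNIV (\<lambda>x. inv\<^bsub>G\<^esub> x) \<and>
     (\<forall>(U, \<phi>)\<in>C. \<forall>(V, \<psi>)\<in>C. \<forall>(W, \<xi>)\<in>C.
        smooth_on {(\<phi> x, \<psi> y) | x y. x \<in> U \<and> y \<in> V \<and> x \<otimes>\<^bsub>G\<^esub> y \<in> W}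
          (\<lambda>(s, t). \<xi> (inv_into U \<phi> s \<otimes>\<^bsub>G\<^esub> inv_into V \<psi> t))) \<and>
     (\<forall>(U, \<phi>)\<in>C. \<forall>(V, \<psi>)\<in>C.
        smooth_on {\<phi> x | x. x \<in> U \<and> inv\<^bsub>G\<^esub> x \<in> V} (\<lambda>s. \<psi> (inv\<^bsub>G\<^esub> (inv_into U \<phi> s))))"

text \<open>A chart \<open>c\<close> around the identity identifies the tangent space at the identity with the
  model space; \<open>Ad g\<close> is the differential of conjugation by \<open>g\<close> under this identification.\<close>

definition Ad :: "'p monoid \<Rightarrow> ('p, real^'n) chart \<Rightarrow> 'p \<Rightarrow> real^'n \<Rightarrow> real^'n" where
  "Ad G c g = (case c of (U, \<phi>) \<Rightarrow>
     frechet_derivative (\<lambda>s. \<phi> (g \<otimes>\<^bsub>G\<^esub> inv_into U \<phi> s \<otimes>\<^bsub>G\<^esub> inv\<^bsub>G\<^esub> g)) (at (\<phi> \<one>\<^bsub>G\<^esub>)))"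

text \<open>The bracket of the Lie algebra of \<open>G\<close> is \<open>[u, v] = d(Ad)(u) v\<close>, the differential being
  taken at the identity.  Every linear identification of the tangent space with \<^typ>\<open>real^'n\<close>
  arises from a chart \<open>c\<close>.\<close>

definition lie_algebra_of ::
  "('p::{t2_space, second_countable_topology}) monoid \<Rightarrow> ('p, real^'n) chart set \<Rightarrow>
   ('p, real^'n) chart \<Rightarrow> (real^'n \<Rightarrow> real^'n \<Rightarrow> real^'n) \<Rightarrow> bool" where
  "lie_algebra_of G C c br \<longleftrightarrow>
     c \<in> C \<and> \<one>\<^bsub>G\<^esub> \<in> fst c \<and>
     (\<forall>v. ((\<lambda>s. Ad G c (inv_into (fst c) (snd c) s) v) has_derivative (\<lambda>u. br u v))
            (at (snd c \<one>\<^bsub>G\<^esub>)))"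

definition Ad_orbit :: "'p monoid \<Rightarrow> ('p, real^'n) chart \<Rightarrow> real^'n \<Rightarrow> (real^'n) set" where
  "Ad_orbit G c x = range (\<lambda>g. Ad G c g x)"

text \<open>The topology of the orbit as a homogeneous space: the quotient topology of the orbit map.\<close>

definition orbit_topology ::
  "('p::topological_space) monoid \<Rightarrow> ('p, real^'n) chart \<Rightarrow> real^'n \<Rightarrow> (real^'n) topology" where
  "orbit_topology G c x =
     topology (\<lambda>W. W \<subseteq> Ad_orbit G c x \<and> open {g. Ad G c g x \<in> W})"


section \<open>Foliations of immersed submanifolds\<close>

text \<open>An immersed submanifold of \<^typ>\<open>'v\<close> is given by its own topology \<open>T\<close> on a subset of
  \<^typ>\<open>'v\<close>.  A foliated chart is described by its inverse: an immersion \<open>\<sigma>\<close> of a product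
  \<open>A \<times> B\<close> of open subsets of the leaf model space \<open>P\<close> and the transverse model space \<open>Q\<close>,
  which is a homeomorphism onto an open subset for the topology \<open>T\<close>.  Its plaques are the images
  of the slices \<open>A \<times> {b}\<close>.  As \<open>P\<close> and \<open>Q\<close> are subspaces, smoothness of \<open>\<sigma>\<close> on \<open>A \<times> B\<close> is
  expressed on an open subset of the ambient space.\<close>

type_synonym ('e, 'v) param = "'e set \<times> 'e set \<times> ('e \<times> 'e \<Rightarrow> 'v)"

definition foliated_chart ::
  "('v::euclidean_space) topology \<Rightarrow> ('e::euclidean_space) set \<Rightarrow> 'e set \<Rightarrow> ('e, 'v) param \<Rightarrow> bool"
where
  "foliated_chart T P Q = (\<lambda>(A, B, \<sigma>).
     openin (top_of_set P) A \<and> connected A \<and> openin (top_of_set Q) B \<and>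
     (\<exists>U. open U \<and> U \<inter> (P \<times> Q) = A \<times> B \<and> smooth_on U \<sigma>) \<and>
     (\<forall>z\<in>A \<times> B. inj_on (frechet_derivative \<sigma> (at z)) (P \<times> Q)) \<and>
     openin T (\<sigma> ` (A \<times> B)) \<and>
     homeomorphic_map (top_of_set (A \<times> B)) (subtopology T (\<sigma> ` (A \<times> B))) \<sigma>)"

definition plaques :: "('e, 'v) param \<Rightarrow> 'v set set" where
  "plaques = (\<lambda>(A, B, \<sigma>). {\<sigma> ` (A \<times> {b}) | b. b \<in> B})"

text \<open>A foliation is given by a foliated atlas: foliated charts covering the manifold, any two
  of which are coherent, i.e.\ plaques intersect in sets that are open in each of them.  The leaves
  are the classes of points connected by finite chains of intersecting plaques.\<close>

definition foliation ::
  "('v::euclidean_space) topology \<Rightarrow> ('e::euclidean_space) set \<Rightarrow> 'e set \<Rightarrow> ('e, 'v) param set \<Rightarrow> bool"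
where
  "foliation T P Q F \<longleftrightarrow>
     subspace P \<and> subspace Q \<and> (\<forall>c\<in>F. foliated_chart T P Q c) \<and>
     (\<Union>c\<in>F. \<Union>(plaques c)) = topspace T \<and>
     (\<forall>c\<in>F. \<forall>c'\<in>F. \<forall>p\<in>plaques c. \<forall>p'\<in>plaques c'.
        openin (subtopology T p) (p \<inter> p') \<and> openin (subtopology T p') (p \<inter> p'))"

text \<open>The tangent space at \<open>x\<close> of the leaf through \<open>x\<close>.  By coherence all charts around \<open>x\<close> give
  the same subspace.\<close>

definition leaf_tangent ::
  "('e::euclidean_space) set \<Rightarrow> ('e, 'v::euclidean_space) param set \<Rightarrow> 'v \<Rightarrow> 'v set" where
  "leaf_tangent P F x =
     {frechet_derivative \<sigma> (at (a, b)) (u, 0) | A B \<sigma> a b u.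
        (A, B, \<sigma>) \<in> F \<and> a \<in> A \<and> b \<in> B \<and> \<sigma> (a, b) = x \<and> u \<in> P}"

text \<open>The Kirillov form at \<open>x\<close>, on tangent vectors \<open>[u, x]\<close> and \<open>[v, x]\<close> represented by \<open>u\<close>
  and \<open>v\<close>.  The formula at one point of an orbit determines it at the others by invariance, since
  the Killing form and the bracket are invariant under \<open>Ad\<close>.\<close>

definition kirillov_form ::
  "(real^'n \<Rightarrow> real^'n \<Rightarrow> real^'n) \<Rightarrow> real^'n \<Rightarrow> real^'n \<Rightarrow> real^'n \<Rightarrow> real" where
  "kirillov_form br x u v = killing br x (br u v)"

definition isotropic_at ::
  "(real^'n \<Rightarrow> real^'n \<Rightarrow> real^'n) \<Rightarrow> real^'n \<Rightarrow> (real^'n) set \<Rightarrow> bool" where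
  "isotropic_at br x S \<longleftrightarrow> (\<forall>u\<in>S. \<forall>v\<in>S. kirillov_form br x u v = 0)"

definition left_invariant ::
  "'p monoid \<Rightarrow> ('p, real^'n) chart \<Rightarrow> (real^'n) set \<Rightarrow> (real^'n \<Rightarrow> (real^'n) set) \<Rightarrow> bool" where
  "left_invariant G c M D \<longleftrightarrow> (\<forall>g. \<forall>y\<in>M. Ad G c g ` D y = D (Ad G c g y))"

definition isotropic_distribution ::
  "(real^'n \<Rightarrow> real^'n \<Rightarrow> real^'n) \<Rightarrow> (real^'n) set \<Rightarrow> (real^'n \<Rightarrow> (real^'n) set) \<Rightarrow> bool" where
  "isotropic_distribution br M D \<longleftrightarrow> (\<forall>y\<in>M. isotropic_at br y {u. br u y \<in> D y})"

end

(* Weights of a show that n is a subalgebra, stable under h and Killing-orthogonal to h; as X lies in h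
   and [n, n] is contained in n, it is isotropic.  The tangent space A[n, X] at the point AX of the orbit
   is well defined only if every A in the adjoint group with AX = X preserves n, and such an A need not
   lie in the identity component of the stabilizer.  Such an A is the identity on h: every element of
   the connected adjoint group fixes a space of dimension at least dim h (true near exp(eX), then
   everywhere by analytic continuation), while A exp(tX) has no fixed vector outside h for suitable t.
   As the root spaces of h are lines, A acts on each of them by a scalar and hence preserves the
   h-stable space n.  The charts of the foliation are products of exponentials
   (p, q) |-> A exp(q_1 f_1) ... exp(q_l f_l) exp(p_1 e_1) ... exp(p_k e_k) X, where the e_i form a basis
   of n and the f_i a basis of a complement of n + h. *)
theory Submission
  imports Defs "HOL-Complex_Analysis.Conformal_Mappings"
begin

section \<open>The Banach algebra of endomorphisms\<close>

text \<open>The exponential map of \<open>G\<close> never appears. The group theory takes place in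
  \<open>Aut\<close>, the automorphisms of the bracket inside the Banach algebra \<open>endo\<close>
  of operators under composition. Its engine is \<open>Aut_open_mapping\<close>: a continuous family
  of automorphisms through 1 whose derivative there, projected to the inner derivations, is
  injective covers a neighbourhood of 1 in \<open>Aut\<close>. It is applied four times: to products
  of exponentials, so that connectedness puts \<open>Ad G\<close> into the group they generate; to a
  chart of \<open>G\<close>, so that \<open>Ad\<close> is open and the quotient topology of the
  orbit can be read in the operator norm; to the conjugates of exp(\<epsilon> ad X) exp(ad H); and
  to coordinates of the adjoint group, which makes the foliated charts open. Charts fit together
  because the subspace A b with b = n + h is constant along a plaque and determines the transverse
  coordinate. Complements and eigenvectors come from the inner product - B(x, \<theta> y), for which
  ad of a \<theta>-stable subspace is closed under adjoints; complex root vectors are handled as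
  pairs of real vectors.\<close>

typedef (overloaded) 'a endo = "UNIV :: ('a::euclidean_space \<Rightarrow>\<^sub>L 'a) set"
  morphisms blinfun_of_endo Endo ..

setup_lifting type_definition_endo

instantiation endo :: (euclidean_space) real_normed_algebra_1
begin

lift_definition zero_endo :: "'a endo" is 0 .
lift_definition one_endo :: "'a endo" is id_blinfun .
lift_definition plus_endo :: "'a endo \<Rightarrow> 'a endo \<Rightarrow> 'a endo" is plus .
lift_definition minus_endo :: "'a endo \<Rightarrow> 'a endo \<Rightarrow> 'a endo" is minus .
lift_definition uminus_endo :: "'a endo \<Rightarrow> 'a endo" is uminus .
lift_definition times_endo :: "'a endo \<Rightarrow> 'a endo \<Rightarrow> 'a endo" is blinfun_compose .
lift_definition scaleR_endo :: "real \<Rightarrow> 'a endo \<Rightarrow> 'a endo" is scaleR .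
lift_definition norm_endo :: "'a endo \<Rightarrow> real" is norm .
lift_definition dist_endo :: "'a endo \<Rightarrow> 'a endo \<Rightarrow> real" is dist .
lift_definition sgn_endo :: "'a endo \<Rightarrow> 'a endo" is sgn .
definition uniformity_endo :: "('a endo \<times> 'a endo) filter" where
  "uniformity_endo = (INF e\<in>{0 <..}. principal {(x, y). dist x y < e})"
definition open_endo :: "'a endo set \<Rightarrow> bool" where
  "open_endo S \<longleftrightarrow> (\<forall>x\<in>S. \<forall>\<^sub>F (x', y) in uniformity. x' = x \<longrightarrow> y \<in> S)"

instance
proof
  fix x y z :: "'a endo" and r s :: real and S :: "'a endo set"
  show "(uniformity :: ('a endo \<times> 'a endo) filter) = (INF e\<in>{0 <..}. principal {(x, y). dist x y < e})"
    by (rule uniformity_endo_def)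
  show "open S \<longleftrightarrow> (\<forall>x\<in>S. \<forall>\<^sub>F (x', y) in uniformity. x' = x \<longrightarrow> y \<in> S)"
    by (rule open_endo_def)
  show "norm (x * y) \<le> norm x * norm y"
    by transfer (rule norm_blinfun_compose)
  show "norm (1 :: 'a endo) = 1"
    by transfer (rule norm_blinfun_id)
  show "(0 :: 'a endo) \<noteq> 1"
  proof transfer
    show "(0 :: 'a \<Rightarrow>\<^sub>L 'a) \<noteq> id_blinfun"
      using norm_blinfun_id[where 'a='a] by (metis norm_zero zero_neq_one)
  qed
  show "norm (x + y) \<le> norm x + norm y"
    by transfer (rule norm_triangle_ineq)
  show "x * y * z = x * (y * z)"
    by (transfer, rule blinfun_eqI, simp)
  show "(x + y) * z = x * z + y * z" "x * (y + z) = x * y + x * z"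
    by (transfer, rule blinfun_eqI, simp add: blinfun.bilinear_simps)+
  show "r *\<^sub>R x * y = r *\<^sub>R (x * y)" "x * r *\<^sub>R y = r *\<^sub>R (x * y)" "1 * x = x" "x * 1 = x"
    by (transfer, rule blinfun_eqI, simp add: blinfun.bilinear_simps)+
  show "dist x y = norm (x - y)" by transfer (rule dist_norm)
  show "sgn x = scaleR (inverse (norm x)) x" by transfer (rule sgn_div_norm)
qed (transfer; simp add: algebra_simps)+

end

instance endo :: (euclidean_space) banach
proof
  fix X :: "nat \<Rightarrow> 'a endo"
  assume "Cauchy X"
  then have "Cauchy (\<lambda>n. blinfun_of_endo (X n))"
    unfolding Cauchy_def by transfer simp
  then obtain L where "(\<lambda>n. blinfun_of_endo (X n)) \<longlonglongrightarrow> L"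
    using Cauchy_convergent convergent_def by blast
  then have "X \<longlonglongrightarrow> Endo L"
    unfolding lim_sequentially by (simp add: dist_endo.rep_eq Endo_inverse)
  then show "convergent X" by (auto simp: convergent_def)
qed

lift_definition app :: "'a::euclidean_space endo \<Rightarrow> 'a \<Rightarrow> 'a" is blinfun_apply .

lemma app_bounded_bilinear: "bounded_bilinear app"
proof
  show "\<exists>K. \<forall>(a::'a endo) b. norm (app a b) \<le> norm a * norm b * K"
    by (rule exI[of _ 1]) (transfer, simp add: norm_blinfun)
qed (transfer, simp add: blinfun.bilinear_simps)+

interpretation app: bounded_bilinear app
  by (rule app_bounded_bilinear)

lemma norm_app: "norm (app a x) \<le> norm a * norm x"
  by transfer (rule norm_blinfun)

lemma app_mult [simp]: "app (a * b) x = app a (app b x)"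
  by transfer simp

lemma app_one [simp]: "app 1 x = x"
  by transfer simp

lemma endo_eqI: "(\<And>x. app a x = app b x) \<Longrightarrow> a = b"
  by transfer (rule blinfun_eqI)

lemma linear_app: "linear (app a)"
  using app.bounded_linear_right bounded_linear.linear by blast

definition endo :: "('a::euclidean_space \<Rightarrow> 'a) \<Rightarrow> 'a endo" where
  "endo f = Endo (Blinfun f)"

lemma app_endo: "linear f \<Longrightarrow> app (endo f) = f"
  unfolding endo_def
  by (simp add: app.rep_eq Endo_inverse bounded_linear_Blinfun_apply linear_conv_bounded_linear)

lemma norm_endo_le: "(\<And>x. norm (app a x) \<le> c * norm x) \<Longrightarrow> 0 \<le> c \<Longrightarrow> norm a \<le> c"
  by transfer (rule norm_blinfun_bound)

lemma endo_finite_norm: "norm a \<le> (\<Sum>b\<in>Basis. norm (app a b))"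
  for a :: "'a::euclidean_space endo"
proof (rule norm_endo_le)
  fix x :: 'a
  have "app a x = app a (\<Sum>b\<in>Basis. (x \<bullet> b) *\<^sub>R b)"
    by (simp add: euclidean_representation)
  also have "\<dots> = (\<Sum>b\<in>Basis. (x \<bullet> b) *\<^sub>R app a b)"
    by (simp add: app.sum_right app.scaleR_right)
  finally have "norm (app a x) \<le> (\<Sum>b\<in>Basis. norm ((x \<bullet> b) *\<^sub>R app a b))"
    by (metis norm_sum)
  also have "\<dots> \<le> (\<Sum>b\<in>Basis. norm (app a b) * norm x)"
    by (intro sum_mono) (simp add: Basis_le_norm mult.commute mult_right_mono)
  finally show "norm (app a x) \<le> (\<Sum>b\<in>Basis. norm (app a b)) * norm x"
    by (simp add: sum_distrib_right)
qed (simp add: sum_nonneg)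

lemma tendsto_endo:
  fixes f :: "'b \<Rightarrow> 'a::euclidean_space endo"
  assumes "\<And>x. ((\<lambda>t. app (f t) x) \<longlongrightarrow> app l x) F"
  shows "(f \<longlongrightarrow> l) F"
proof -
  have "((\<lambda>t. \<Sum>b\<in>Basis. norm (app (f t - l) b)) \<longlongrightarrow> (\<Sum>b\<in>Basis. norm (app l b - app l b))) F"
    unfolding app.diff_left by (intro tendsto_intros assms)
  then have "((\<lambda>t. \<Sum>b\<in>Basis. norm (app (f t - l) b)) \<longlongrightarrow> 0) F" by simp
  then have "((\<lambda>t. f t - l) \<longlongrightarrow> 0) F"
    by (rule Lim_null_comparison[rotated]) (simp add: endo_finite_norm)
  then show ?thesis by (simp add: LIM_zero_iff)
qed

text \<open>The Lie algebra of \<open>G\<close> is given through the derivatives of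
  \<open>Ad g v\<close> for single vectors \<open>v\<close>. In finite dimension these assemble to a
  derivative of the operator itself, which the open mapping argument needs.\<close>

lemma has_derivative_endo:
  fixes f :: "'b::real_normed_vector \<Rightarrow> 'a::euclidean_space endo"
  assumes "\<And>x. ((\<lambda>t. app (f t) x) has_derivative (\<lambda>v. app (f' v) x)) F"
  shows "(f has_derivative f') F"
proof -
  have lin: "linear f'"
  proof
    fix u v :: 'b and r :: real
    have "linear (\<lambda>v. app (f' v) x)" for x
      using assms has_derivative_linear by blast
    from linear_add[OF this] linear_cmul[OF this]
    show "f' (u + v) = f' u + f' v" "f' (r *\<^sub>R u) = r *\<^sub>R f' u"
      by (auto intro!: endo_eqI simp: app.add_left app.scaleR_left)
  qed
  have bl: "\<exists>K. \<forall>v. norm (app (f' v) x) \<le> norm v * K" for x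
    using has_derivative_bounded_linear[OF assms] bounded_linear.bounded by blast
  then obtain K where K: "\<And>x v. norm (app (f' v) x) \<le> norm v * K x" by metis
  have "norm (f' v) \<le> norm v * (\<Sum>b\<in>Basis. K b)" for v
    using endo_finite_norm[of "f' v"] K
    by (smt (verit, best) sum_distrib_left sum_mono)
  with lin have bl': "bounded_linear f'"
    by (meson bounded_linear_intro linear_add linear_scale)
  \<comment> \<open>\<open>Lim F (\<lambda>x. x)\<close> is the base point at which
    \<open>has_derivative\<close> expands along a general filter.\<close>
  have "((\<lambda>y. ((f y - f (Lim F (\<lambda>x. x))) - f' (y - Lim F (\<lambda>x. x))) /\<^sub>R norm (y - Lim F (\<lambda>x. x))) \<longlongrightarrow> 0) F"
  proof (rule tendsto_endo)
    fix x
    have "((\<lambda>y. ((app (f y) x - app (f (Lim F (\<lambda>x. x))) x) - app (f' (y - Lim F (\<lambda>x. x))) x) /\<^sub>R norm (y - Lim F (\<lambda>x. x))) \<longlongrightarrow> 0) F"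
      using assms[of x] unfolding has_derivative_def by simp
    then show "((\<lambda>t. app ((f t - f (Lim F (\<lambda>x. x)) - f' (t - Lim F (\<lambda>x. x))) /\<^sub>R norm (t - Lim F (\<lambda>x. x))) x) \<longlongrightarrow> app 0 x) F"
      by (simp add: app.diff_left app.scaleR_left app.zero_left)
  qed
  with bl' show ?thesis unfolding has_derivative_def by simp
qed

lemma app_exp_sums: "(\<lambda>k. (app (D ^ k) x) /\<^sub>R fact k) sums app (exp D) x"
proof -
  have "bounded_linear (\<lambda>a. app a x)" by (rule app.bounded_linear_left)
  from bounded_linear.sums[OF this exp_converges[of D]]
  show ?thesis by (simp add: app.scaleR_left)
qed

lemma exp_subspace:
  assumes S: "subspace S" and D: "\<And>x. x \<in> S \<Longrightarrow> app D x \<in> S" and x: "x \<in> S"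
  shows "app (exp D) x \<in> S"
proof -
  have *: "app (D ^ k) x \<in> S" for k
    by (induction k) (auto simp: D x)
  have "closed S" using S closed_subspace by blast
  then show ?thesis
  proof (rule closed_sequentially)
    show "(\<lambda>n. \<Sum>k<n. (app (D ^ k) x) /\<^sub>R fact k) \<longlonglongrightarrow> app (exp D) x"
      using app_exp_sums sums_def by blast
  qed (intro subspace_sum subspace_scale S *)
qed

lemma exp_fixes:
  assumes "app D x = 0" shows "app (exp D) x = x"
proof -
  have "app (D ^ k) x = (if k = 0 then x else 0)" for k
    by (cases k) (auto simp: power_Suc2 assms app.zero_right simp del: power_Suc)
  then have "(\<lambda>k. (app (D ^ k) x) /\<^sub>R fact k) = (\<lambda>k. if k = 0 then x else 0)"
    by auto
  then show ?thesis
    using app_exp_sums[of D x] sums_single[of 0 "\<lambda>_. x"] sums_unique2 by fastforce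
qed

lemma exp_inverse_left [simp]: "exp (- D) * exp D = (1 :: 'a::euclidean_space endo)"
  using exp_minus_inverse[of "- D"] by simp

lemma exp_commutes:
  fixes A :: "'a::euclidean_space endo"
  assumes "A * D = D * A"
  shows "A * exp D = exp D * A"
proof -
  have *: "A * D ^ k = D ^ k * A" for k
    by (induction k) (simp_all add: assms power_Suc2 mult.assoc[symmetric], metis mult.assoc power_Suc power_Suc2 assms)
  have "(\<lambda>k. A * (D ^ k /\<^sub>R fact k)) sums (A * exp D)" "(\<lambda>k. (D ^ k /\<^sub>R fact k) * A) sums (exp D * A)"
    by (intro sums_mult sums_mult2 exp_converges)+
  then show ?thesis by (simp add: * sums_unique2)
qed

lemma exp_has_derivative [derivative_intros]:
  fixes D :: "'a::euclidean_space endo" and l :: "'e::real_normed_vector \<Rightarrow> real"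
  assumes "bounded_linear l"
  shows "((\<lambda>z. exp (l z *\<^sub>R D)) has_derivative (\<lambda>v. l v *\<^sub>R (D * exp (l z *\<^sub>R D)))) (at z within S)"
proof -
  have 1: "((\<lambda>t. exp (t *\<^sub>R D)) has_derivative (\<lambda>h. h *\<^sub>R (D * exp (l z *\<^sub>R D)))) (at (l z) within l ` S)"
    using exp_scaleR_has_vector_derivative_left[of D "l z"]
    by (simp add: has_vector_derivative_def has_derivative_at_withinI)
  have 2: "(l has_derivative l) (at z within S)"
    using assms bounded_linear_imp_has_derivative by blast
  show ?thesis using diff_chain_within[OF 2 1] by (simp add: o_def)
qed

section \<open>Products of exponentials\<close>

text \<open>A class of maps that contains the foliated charts and is closed under directional
  derivatives. This is all that \<open>Ck_on\<close> asks for, so smoothness follows by induction on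
  the order.\<close>

inductive expfun :: "('e::euclidean_space \<Rightarrow> 'a::euclidean_space) \<Rightarrow> bool" where
  const: "expfun (\<lambda>z. x)"
| linear: "bounded_linear L \<Longrightarrow> expfun L"
| add: "expfun f \<Longrightarrow> expfun g \<Longrightarrow> expfun (\<lambda>z. f z + g z)"
| app: "expfun f \<Longrightarrow> expfun (\<lambda>z. app A (f z))"
| exp: "bounded_linear l \<Longrightarrow> expfun f \<Longrightarrow> expfun (\<lambda>z. app (exp (l z *\<^sub>R D)) (f z))"

lemma expfun_derivative:
  assumes "expfun f"
  shows "\<exists>f'. (\<forall>z. (f has_derivative f' z) (at z)) \<and> (\<forall>v. expfun (\<lambda>z. f' z v))"
  using assms
proof induction
  case (const x)
  show ?case
    by (rule exI[of _ "\<lambda>z v. 0"]) (auto intro: expfun.const)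
next
  case (linear L)
  then show ?case
    by (intro exI[of _ "\<lambda>z. L"]) (auto intro: expfun.const bounded_linear_imp_has_derivative)
next
  case (add f g)
  then obtain f' g' where
    "\<And>z. (f has_derivative f' z) (at z)" "\<And>v. expfun (\<lambda>z. f' z v)"
    "\<And>z. (g has_derivative g' z) (at z)" "\<And>v. expfun (\<lambda>z. g' z v)" by metis
  then show ?case
    by (intro exI[of _ "\<lambda>z v. f' z v + g' z v"]) (auto intro: expfun.add has_derivative_add)
next
  case (app f A)
  then obtain f' where
    "\<And>z. (f has_derivative f' z) (at z)" "\<And>v. expfun (\<lambda>z. f' z v)" by metis
  then show ?case
    by (intro exI[of _ "\<lambda>z v. app A (f' z v)"])
      (auto intro: expfun.app bounded_linear.has_derivative[OF app.bounded_linear_right])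
next
  case (exp l f D)
  then obtain f' where f':
    "\<And>z. (f has_derivative f' z) (at z)" "\<And>v. expfun (\<lambda>z. f' z v)" by metis
  \<comment> \<open>For fixed \<open>v\<close> the factor \<open>l v *\<^sub>R D\<close> is a
    constant endomorphism, so the derivative is again built by the rules of the class.\<close>
  let ?f' = "\<lambda>z v. app (exp (l z *\<^sub>R D)) (f' z v) + app (l v *\<^sub>R D) (app (exp (l z *\<^sub>R D)) (f z))"
  have "((\<lambda>z. app (exp (l z *\<^sub>R D)) (f z)) has_derivative ?f' z) (at z)" for z
    using app.FDERIV[OF exp_has_derivative[OF exp.hyps(1), of D] f'(1)] by (simp add: app.scaleR_left)
  moreover have "expfun (\<lambda>z. ?f' z v)" for v
    by (intro expfun.intros exp.hyps f')
  ultimately show ?case by (intro exI[of _ ?f']) auto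
qed

lemma expfun_smooth:
  assumes "expfun f" shows "smooth_on S f"
proof -
  have "Ck_on k S f" for k
    using assms
  proof (induction k arbitrary: f)
    case 0
    then obtain f' where "\<And>z. (f has_derivative f' z) (at z)"
      using expfun_derivative[OF 0] by blast
    then show ?case
      unfolding Ck_on.simps by (rule has_derivative_continuous_on[OF has_derivative_at_withinI])
  next
    case (Suc k)
    obtain f' where f': "\<And>z. (f has_derivative f' z) (at z)" "\<And>v. expfun (\<lambda>z. f' z v)"
      using expfun_derivative[OF Suc.prems] by blast
    show ?case
      unfolding Ck_on.simps by (intro exI[of _ f'] conjI ballI allI f'(1) Suc.IH f'(2))
  qed
  then show ?thesis by (simp add: smooth_on_def)
qed

lemma expfun_continuous: "expfun f \<Longrightarrow> continuous_on S f"
  using expfun_smooth[of f S] by (metis smooth_on_def Ck_on.simps(1))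

text \<open>The finitely many basis vectors control the operator norm, in which the local
  injectivity theorem wants the derivative to be continuous.\<close>

lemma C1_onorm_continuous:
  fixes f' :: "'e::euclidean_space \<Rightarrow> 'e \<Rightarrow> 'a::euclidean_space"
  assumes lin: "\<And>z. linear (f' z)" and cont: "\<And>v. isCont (\<lambda>z. f' z v) a" and "e > 0"
  shows "\<exists>d>0. \<forall>x. dist a x < d \<longrightarrow> onorm (\<lambda>v. f' x v - f' a v) < e"
proof -
  have bound: "onorm (\<lambda>v. f' x v - f' a v) \<le> (\<Sum>b\<in>Basis. norm (f' x b - f' a b))" for x
  proof (rule onorm_le)
    fix v :: 'e
    have "f' x v - f' a v = (\<Sum>b\<in>Basis. (v \<bullet> b) *\<^sub>R (f' x b - f' a b))"
      by (subst (1 2) euclidean_representation[of v, symmetric])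
        (simp add: linear_sum[OF lin] linear_cmul[OF lin] scaleR_diff_right sum_subtractf)
    also have "norm \<dots> \<le> (\<Sum>b\<in>Basis. norm (f' x b - f' a b) * norm v)"
      by (rule order_trans[OF norm_sum]) (auto intro!: sum_mono mult_right_mono simp: Basis_le_norm mult.commute[of _ "norm v"])
    finally show "norm (f' x v - f' a v) \<le> (\<Sum>b\<in>Basis. norm (f' x b - f' a b)) * norm v"
      by (simp add: sum_distrib_right)
  qed
  have "((\<lambda>x. \<Sum>b\<in>Basis. norm (f' x b - f' a b)) \<longlongrightarrow> (\<Sum>b\<in>Basis. norm (f' a b - f' a b))) (at a)"
    by (intro tendsto_intros isContD cont)
  then have "((\<lambda>x. \<Sum>b\<in>Basis. norm (f' x b - f' a b)) \<longlongrightarrow> 0) (at a)" by simp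
  then have "\<forall>\<^sub>F x in at a. (\<Sum>b\<in>Basis. norm (f' x b - f' a b)) < e"
    using \<open>e > 0\<close> order_tendstoD(2) by blast
  then obtain d where "d > 0"
    and d: "\<And>x. x \<noteq> a \<Longrightarrow> dist x a < d \<Longrightarrow> (\<Sum>b\<in>Basis. norm (f' x b - f' a b)) < e"
    unfolding eventually_at by blast
  have "onorm (\<lambda>v. f' x v - f' a v) < e" if "dist a x < d" for x
  proof (cases "x = a")
    case True then show ?thesis using \<open>e > 0\<close> by (simp add: onorm_zero)
  next
    case False then show ?thesis using d[OF False] that bound[of x] by (simp add: dist_commute)
  qed
  with \<open>d > 0\<close> show ?thesis by blast
qed

lemma C1_locally_injective:
  fixes f :: "'e::euclidean_space \<Rightarrow> 'e"
  assumes der: "\<And>z. (f has_derivative f' z) (at z)" and cont: "\<And>v. continuous_on UNIV (\<lambda>z. f' z v)"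
    and inj: "\<And>v. f' a v = 0 \<Longrightarrow> v = 0"
  obtains r where "r > 0" "inj_on f (ball a r)" "\<And>z. z \<in> ball a r \<Longrightarrow> inj (f' z)"
proof -
  have lin: "linear (f' z)" for z using der has_derivative_linear by blast
  have "inj (f' a)" using inj lin linear_injective_0 by blast
  then obtain g where g: "linear g" "g \<circ> f' a = id"
    using lin linear_injective_left_inverse by blast
  have near: "\<exists>d>0. \<forall>x. dist a x < d \<longrightarrow> onorm (\<lambda>v. f' x v - f' a v) < e" if "e > 0" for e
    using that lin cont by (intro C1_onorm_continuous) (auto simp: continuous_on_eq_continuous_at)
  obtain r where r: "r > 0" "inj_on f (ball a r)"
    using has_derivative_locally_injective[of a UNIV g f' f] g der near
    by (metis UNIV_I linear_conv_bounded_linear open_UNIV)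
  \<comment> \<open>A linear map whose distance from \<open>f' a\<close> is below this
    \<open>c\<close> is still injective; this gives the claim about the derivatives, on a possibly
    smaller ball.\<close>
  obtain c where c: "c > 0" "\<And>v. c * norm v \<le> norm (f' a v)"
    using linear_inj_bounded_below_pos[OF lin \<open>inj (f' a)\<close>] by (metis mult.commute)
  obtain d where d: "d > 0" "\<And>x. dist a x < d \<Longrightarrow> onorm (\<lambda>v. f' x v - f' a v) < c"
    using near[OF c(1)] by blast
  have "inj (f' z)" if "z \<in> ball a d" for z
  proof -
    have "v = 0" if "f' z v = 0" for v
    proof (rule ccontr)
      assume "v \<noteq> 0"
      have bl: "bounded_linear (\<lambda>v. f' z v - f' a v)"
        using lin by (intro bounded_linear_sub) (auto simp: linear_conv_bounded_linear)
      have "c * norm v \<le> norm (f' z v - f' a v)" using c(2)[of v] that by simp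
      also have "\<dots> \<le> onorm (\<lambda>v. f' z v - f' a v) * norm v" using onorm[OF bl] by blast
      also have "\<dots> < c * norm v" using d(2) \<open>z \<in> ball a d\<close> \<open>v \<noteq> 0\<close> by simp
      finally show False by simp
    qed
    then show ?thesis using lin linear_injective_0 by blast
  qed
  with r d(1) show ?thesis
    by (intro that[of "min r d"]) (auto intro: inj_on_subset)
qed

text \<open>Each pair couples a coordinate vector with an operator, so that \<open>z\<close>
  supplies the exponents. With \<open>D = ad e\<close> these are canonical coordinates of the second
  kind on the adjoint group.\<close>

fun expprod :: "('a \<times> 'a endo) list \<Rightarrow> 'a::euclidean_space \<Rightarrow> 'a endo" where
  "expprod [] z = 1"
| "expprod ((e, D) # ds) z = exp ((z \<bullet> e) *\<^sub>R D) * expprod ds z"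

fun expdiff :: "('a \<times> 'a endo) list \<Rightarrow> 'a::euclidean_space \<Rightarrow> 'a \<Rightarrow> 'a endo" where
  "expdiff [] z v = 0"
| "expdiff ((e, D) # ds) z v =
     (v \<bullet> e) *\<^sub>R (D * expprod ((e, D) # ds) z) + exp ((z \<bullet> e) *\<^sub>R D) * expdiff ds z v"

text \<open>The inverse is spelled out in reverse order, so that its continuity and
  differentiability follow by the same induction as for the product.\<close>

fun expinv :: "('a \<times> 'a endo) list \<Rightarrow> 'a::euclidean_space \<Rightarrow> 'a endo" where
  "expinv [] z = 1"
| "expinv ((e, D) # ds) z = expinv ds z * exp ((z \<bullet> e) *\<^sub>R (- D))"

lemma expprod_derivative:
  "(expprod ds has_derivative expdiff ds z) (at z within S)"
proof (induction ds)
  case Nil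
  show ?case by (simp add: fun_eq_iff)
next
  case (Cons d ds)
  obtain e D where d: "d = (e, D)" by force
  have "((\<lambda>z. exp ((z \<bullet> e) *\<^sub>R D) * expprod ds z) has_derivative
      (\<lambda>v. exp ((z \<bullet> e) *\<^sub>R D) * expdiff ds z v + ((v \<bullet> e) *\<^sub>R (D * exp ((z \<bullet> e) *\<^sub>R D))) * expprod ds z))
      (at z within S)"
    by (rule has_derivative_mult[OF exp_has_derivative[OF bounded_linear_inner_left] Cons])
  then show ?case
    unfolding d by (simp add: fun_eq_iff[symmetric] add.commute mult.assoc)
qed

lemma expprod_0 [simp]: "expprod ds 0 = 1" "expinv ds 0 = 1"
  by (induction ds) auto

lemma expprod_expinv: "expprod ds z * expinv ds z = 1" "expinv ds z * expprod ds z = 1"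
proof (induction ds)
  case (Cons d ds)
  obtain e D where d: "d = (e, D)" by force
  have 1: "exp ((z \<bullet> e) *\<^sub>R D) * (expprod ds z * expinv ds z) * exp (- ((z \<bullet> e) *\<^sub>R D)) = 1"
    "expinv ds z * (exp (- ((z \<bullet> e) *\<^sub>R D)) * exp ((z \<bullet> e) *\<^sub>R D)) * expprod ds z = 1"
    using Cons by (simp_all only: exp_minus_inverse exp_inverse_left mult_1_right)
  from 1(1) show "expprod (d # ds) z * expinv (d # ds) z = 1"
    unfolding d by (simp add: mult.assoc)
  from 1(2) show "expinv (d # ds) z * expprod (d # ds) z = 1"
    unfolding d by (simp only: expprod.simps expinv.simps scaleR_minus_right mult.assoc)
qed auto

lemma continuous_expprod [continuous_intros]:
  fixes f :: "'b::topological_space \<Rightarrow> 'a::euclidean_space"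
  shows
  "continuous_on S f \<Longrightarrow> continuous_on S (\<lambda>z. expprod ds (f z))"
  "continuous_on S f \<Longrightarrow> continuous_on S (\<lambda>z. expinv ds (f z))"
proof -
  have *: "continuous_on UNIV (\<lambda>z::'a. exp ((z \<bullet> e) *\<^sub>R D))" for e and D :: "'a endo"
    by (rule has_derivative_continuous_on[OF exp_has_derivative[OF bounded_linear_inner_left]])
  have 1: "continuous_on UNIV (expprod ds)"
    using expprod_derivative by (rule has_derivative_continuous_on)
  have 2: "continuous_on UNIV (expinv ds)"
  proof (induction ds)
    case Nil show ?case by (simp add: continuous_on_const cong: continuous_on_cong)
  next
    case (Cons d ds)
    obtain e D where d: "d = (e, D)" by force
    have "continuous_on UNIV (\<lambda>z. expinv ds z * exp ((z \<bullet> e) *\<^sub>R (- D)))"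
      by (intro continuous_on_mult Cons *)
    then show ?case unfolding d by simp
  qed
  show "continuous_on S f \<Longrightarrow> continuous_on S (\<lambda>z. expprod ds (f z))"
    "continuous_on S f \<Longrightarrow> continuous_on S (\<lambda>z. expinv ds (f z))"
    using continuous_on_compose2[OF 1, of S f] continuous_on_compose2[OF 2, of S f] by auto
qed

lemma continuous_expdiff [continuous_intros]:
  fixes f :: "'b::topological_space \<Rightarrow> 'a::euclidean_space"
  assumes "continuous_on S f"
  shows "continuous_on S (\<lambda>z. expdiff ds (f z) v)"
proof -
  have *: "continuous_on UNIV (\<lambda>z::'a. exp ((z \<bullet> e) *\<^sub>R D))" for e and D :: "'a endo"
    by (rule has_derivative_continuous_on[OF exp_has_derivative[OF bounded_linear_inner_left]])
  have "continuous_on UNIV (\<lambda>z. expdiff ds z v)"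
  proof (induction ds)
    case Nil show ?case by simp
  next
    case (Cons d ds)
    obtain e D where d: "d = (e, D)" by force
    show ?case unfolding d expdiff.simps
      by (intro continuous_intros Cons *)
  qed
  then show ?thesis
    using continuous_on_compose2[of UNIV _ S f] assms by auto
qed

lemma expfun_expprod:
  assumes L: "bounded_linear L" and f: "expfun f"
  shows "expfun (\<lambda>z. app (expprod ds (L z)) (f z))"
proof (induction ds)
  case Nil then show ?case using f by simp
next
  case (Cons d ds)
  obtain e D where d: "d = (e, D)" by force
  have "bounded_linear (\<lambda>z. L z \<bullet> e)"
    using L bounded_linear_inner_left_comp by blast
  from expfun.exp[OF this Cons] show ?case unfolding d by simp
qed

section \<open>Automorphisms of a Lie algebra with a Cartan involution\<close>

definition tr :: "'a::euclidean_space endo \<Rightarrow> real" where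
  "tr a = (\<Sum>b\<in>Basis. app a b \<bullet> b)"

lemma tr_linear: "tr (a + b) = tr a + tr b" "tr (a - b) = tr a - tr b" "tr (r *\<^sub>R a) = r * tr a"
  "tr (- a) = - tr a" "tr 0 = 0"
  by (auto simp: tr_def app.add_left app.diff_left app.scaleR_left app.minus_left app.zero_left inner_diff_left
      inner_add_left sum.distrib sum_subtractf sum_distrib_left sum_negf)

lemma tr_commute: "tr (a * b) = tr (b * a)"
proof -
  have expand: "tr (a * b) = (\<Sum>i\<in>Basis. \<Sum>j\<in>Basis. (app b i \<bullet> j) * (app a j \<bullet> i))" for a b :: "'a endo"
  proof -
    have "app a (app b i) \<bullet> i = (\<Sum>j\<in>Basis. (app b i \<bullet> j) * (app a j \<bullet> i))" for i
      by (subst euclidean_representation[of "app b i", symmetric])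
        (simp only: app.sum_right app.scaleR_right inner_sum_left inner_scaleR_left)
    then show ?thesis unfolding tr_def by simp
  qed
  show ?thesis
    unfolding expand by (subst sum.swap) (simp add: mult.commute)
qed

lemma abs_tr_le: "\<bar>tr (a :: 'a::euclidean_space endo)\<bar> \<le> DIM('a) * norm a"
proof -
  have "\<bar>tr a\<bar> \<le> (\<Sum>b\<in>(Basis::'a set). norm a)"
    unfolding tr_def
  proof (rule order_trans[OF sum_abs], rule sum_mono)
    fix b :: 'a assume "b \<in> Basis"
    then show "\<bar>app a b \<bullet> b\<bar> \<le> norm a"
      using Cauchy_Schwarz_ineq2[of "app a b" b] norm_app[of a b] by simp
  qed
  then show ?thesis by simp
qed

lemma trace_matrix: "linear f \<Longrightarrow> trace (matrix f) = tr (endo f)" for f :: "real^'n \<Rightarrow> real^'n"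
proof -
  assume f: "linear f"
  have basis: "(Basis :: (real^'n) set) = range (\<lambda>i. axis i 1)"
    by (auto simp: Basis_vec_def)
  have "inj (\<lambda>i::'n. axis i (1::real))"
    by (simp add: inj_on_def axis_eq_axis)
  then have "(\<Sum>b\<in>Basis. app (endo f) b \<bullet> b) = (\<Sum>i\<in>UNIV. f (axis i 1) $ i)"
    unfolding basis app_endo[OF f] by (simp add: sum.reindex inner_axis)
  then show ?thesis by (simp add: trace_def matrix_def tr_def)
qed

section \<open>The Killing form and its inner product\<close>

locale cartan_lie_algebra =
  fixes br :: "real^'n \<Rightarrow> real^'n \<Rightarrow> real^'n" and \<theta> :: "real^'n \<Rightarrow> real^'n"
  assumes lie: "lie_algebra br" and cartan: "cartan_involution br \<theta>"
begin

lemma bounded_bilinear_br: "bounded_bilinear br"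
proof -
  have "bilinear br"
    using lie unfolding bilinear_def lie_algebra_def
    by (auto intro!: linearI simp: scalar_mult_eq_scaleR)
  then show ?thesis by (simp add: bilinear_conv_bounded_bilinear)
qed

sublocale br: bounded_bilinear br
  by (rule bounded_bilinear_br)

lemma br_self [simp]: "br x x = 0"
  using lie by (simp add: lie_algebra_def)

lemma br_anti: "br x y = - br y x"
proof -
  have "br (x + y) (x + y) = 0" by (rule br_self)
  then have "br x x + br y x + (br x y + br y y) = 0"
    by (simp only: br.add_left br.add_right)
  then have "br y x + br x y = 0" by simp
  then show ?thesis by (simp add: eq_neg_iff_add_eq_0 add.commute)
qed

lemma jacobi: "br x (br y z) = br (br x y) z + br y (br x z)"
proof -
  have "br x (br y z) + br y (br z x) + br z (br x y) = 0"
    using lie by (simp add: lie_algebra_def)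
  moreover have "br y (br z x) = - br y (br x z)" by (metis br_anti br.minus_right)
  moreover have "br z (br x y) = - br (br x y) z" by (rule br_anti)
  ultimately show ?thesis by (simp add: algebra_simps)
qed

lemma linear_br: "linear (br x)" "linear (\<lambda>x. br x y)"
  using br.bounded_linear_right br.bounded_linear_left bounded_linear.linear by blast+

lemma linear_theta: "linear \<theta>"
  using cartan by (simp add: cartan_involution_def)

lemma theta_br: "\<theta> (br x y) = br (\<theta> x) (\<theta> y)"
  using cartan by (simp add: cartan_involution_def)

lemma theta_theta [simp]: "\<theta> (\<theta> x) = x"
  using cartan by (simp add: cartan_involution_def)

lemmas theta_linear = linear_add[OF linear_theta] linear_diff[OF linear_theta]
  linear_cmul[OF linear_theta] linear_neg[OF linear_theta] linear_0[OF linear_theta]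

definition ad :: "real^'n \<Rightarrow> (real^'n) endo" where
  "ad x = endo (br x)"

lemma app_ad [simp]: "app (ad x) y = br x y"
  by (simp add: ad_def app_endo linear_br)

lemma ad_linear: "ad (x + y) = ad x + ad y" "ad (x - y) = ad x - ad y" "ad (r *\<^sub>R x) = r *\<^sub>R ad x"
  "ad (- x) = - ad x" "ad 0 = 0"
  by (auto intro!: endo_eqI simp: app.add_left app.diff_left app.scaleR_left app.minus_left app.zero_left
      br.add_left br.diff_left br.scaleR_left br.minus_left br.zero_left)

lemma ad_br: "ad (br x y) = ad x * ad y - ad y * ad x"
  by (rule endo_eqI) (simp add: app.diff_left jacobi[of x])

definition B :: "real^'n \<Rightarrow> real^'n \<Rightarrow> real" where
  "B x y = tr (ad x * ad y)"

lemma killing_B: "killing br = B"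
proof (intro ext)
  fix x y
  have "linear (\<lambda>z. br x (br y z))"
    using linear_compose[OF linear_br(1) linear_br(1)] by (simp add: o_def)
  moreover from this have "endo (\<lambda>z. br x (br y z)) = ad x * ad y"
    by (intro endo_eqI) (simp add: app_endo)
  ultimately show "killing br x y = B x y"
    by (simp add: killing_def B_def trace_matrix)
qed

lemma B_linear: "B (x + x') y = B x y + B x' y" "B (x - x') y = B x y - B x' y" "B (r *\<^sub>R x) y = r * B x y"
  "B (- x) y = - B x y" "B 0 y = 0"
  "B y (x + x') = B y x + B y x'" "B y (x - x') = B y x - B y x'" "B y (r *\<^sub>R x) = r * B y x"
  "B y (- x) = - B y x" "B y 0 = 0"
  by (auto simp: B_def ad_linear algebra_simps tr_linear)

lemma B_sym: "B x y = B y x"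
  unfolding B_def by (rule tr_commute)

lemma B_invariant: "B (br x y) z = B x (br y z)"
  using tr_commute[of "ad y" "ad x * ad z"] by (simp add: B_def ad_br algebra_simps tr_linear)

lemma B_theta: "B (\<theta> x) (\<theta> y) = B x y"
proof -
  have th: "endo \<theta> * endo \<theta> = 1"
    by (rule endo_eqI) (simp add: app_endo linear_theta)
  have ad: "ad (\<theta> x) = endo \<theta> * ad x * endo \<theta>" for x
    by (rule endo_eqI) (simp add: app_endo linear_theta theta_br)
  have "ad (\<theta> x) * ad (\<theta> y) = endo \<theta> * ad x * (endo \<theta> * endo \<theta>) * ad y * endo \<theta>"
    unfolding ad by (simp only: mult.assoc)
  then have "ad (\<theta> x) * ad (\<theta> y) = endo \<theta> * (ad x * ad y * endo \<theta>)"
    by (simp only: th mult_1_right mult.assoc)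
  then have "B (\<theta> x) (\<theta> y) = tr (ad x * ad y * endo \<theta> * endo \<theta>)"
    unfolding B_def by (simp only: tr_commute[of "endo \<theta>"])
  also have "\<dots> = B x y"
    by (simp only: th mult.assoc B_def mult_1_right)
  finally show ?thesis .
qed

text \<open>Positive definite because \<theta> is a Cartan involution. The adjoint of
  \<open>br x\<close> for it is \<open>- br (\<theta> x)\<close>, so \<theta>-stable families of
  operators \<open>br x\<close> have invariant orthogonal complements.\<close>

definition ip :: "real^'n \<Rightarrow> real^'n \<Rightarrow> real" where
  "ip x y = - B x (\<theta> y)"

lemma ip_linear: "ip (x + x') y = ip x y + ip x' y" "ip (x - x') y = ip x y - ip x' y" "ip (r *\<^sub>R x) y = r * ip x y"
  "ip (- x) y = - ip x y" "ip 0 y = 0"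
  "ip y (x + x') = ip y x + ip y x'" "ip y (x - x') = ip y x - ip y x'" "ip y (r *\<^sub>R x) = r * ip y x"
  "ip y (- x) = - ip y x" "ip y 0 = 0"
  by (auto simp: ip_def B_linear theta_linear)

lemma ip_sym: "ip x y = ip y x"
  by (metis B_sym B_theta ip_def theta_theta)

lemma ip_pos: "x \<noteq> 0 \<Longrightarrow> ip x x > 0"
  using cartan by (auto simp: cartan_involution_def killing_B ip_def)

lemma ip_eq_0 [simp]: "ip x x = 0 \<longleftrightarrow> x = 0"
  using ip_pos[of x] ip_linear by force

lemma ip_ge_0 [simp]: "ip x x \<ge> 0"
  by (cases "x = 0") (auto simp: ip_linear dest: ip_pos intro: less_imp_le)

lemma ip_adjoint: "ip (br x y) z = - ip y (br (\<theta> x) z)"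
proof -
  have "B (br x y) (\<theta> z) = - B (br y x) (\<theta> z)" using br_anti[of x y] by (simp add: B_linear)
  also have "\<dots> = - B y (br x (\<theta> z))" by (simp add: B_invariant)
  finally show ?thesis by (simp add: ip_def theta_br)
qed

text \<open>\<open>B\<close> is nondegenerate because \<open>B d (\<theta> d) = - ip d d\<close>. So
  the map from \<open>d\<close> to the coordinates of \<open>B d\<close> is injective, hence
  surjective.\<close>

lemma B_functional:
  assumes "linear \<phi>" shows "\<exists>d. \<forall>x. B d x = \<phi> x"
proof -
  let ?L = "\<lambda>d. \<Sum>b\<in>Basis. B d b *\<^sub>R b"
  have lin: "linear ?L"
    by (rule linearI) (simp_all add: B_linear scaleR_add_left sum.distrib scaleR_sum_right)
  have comp: "?L d \<bullet> b = B d b" if "b \<in> Basis" for d b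
    using that by (simp add: inner_sum_left inner_Basis if_distrib cong: if_cong)
  have ext: "\<phi>' x = (\<Sum>b\<in>Basis. (x \<bullet> b) * \<phi>' b)" if "linear \<phi>'" for \<phi>' :: "real^'n \<Rightarrow> real" and x
    by (subst euclidean_representation[of x, symmetric])
      (simp only: linear_sum[OF that] linear_cmul[OF that] real_scaleR_def)
  have linB: "linear (B d)" for d by (rule linearI) (simp_all add: B_linear)
  have "d = 0" if "?L d = 0" for d
  proof -
    have "B d b = 0" if "b \<in> Basis" for b using comp[OF that, of d] \<open>?L d = 0\<close> by simp
    then have "B d (\<theta> d) = 0" using ext[OF linB, of d "\<theta> d"] by simp
    then show ?thesis using ip_eq_0[of d] by (simp add: ip_def)
  qed
  then have "inj ?L" unfolding linear_injective_0[OF lin] by simp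
  then have "surj ?L" by (rule linear_inj_imp_surj[OF lin])
  from surjD[OF this] obtain d where "(\<Sum>b\<in>Basis. \<phi> b *\<^sub>R b) = ?L d" ..
  then have d: "?L d = (\<Sum>b\<in>Basis. \<phi> b *\<^sub>R b)" by (rule sym)
  have "B d b = \<phi> b" if "b \<in> Basis" for b
    using comp[OF that, of d] that unfolding d by (simp add: inner_sum_left inner_Basis if_distrib cong: if_cong)
  then have "B d x = \<phi> x" for x
    using ext[OF linB, of d x] ext[OF assms, of x] by simp
  then show ?thesis by blast
qed

lemma B_nondegenerate: "(\<And>x. B d x = B d' x) \<Longrightarrow> d = d'"
  using ip_eq_0[of "d - d'"] by (simp add: ip_def B_linear)

text \<open>Nondegeneracy in quantitative form: small values of \<open>B v\<close> on a basis force
  \<open>v\<close> to be small. This turns estimates of traces into estimates of vectors.\<close>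

lemma B_bounded_below:
  obtains c where "c > 0" "\<And>v M. (\<And>b. b \<in> Basis \<Longrightarrow> \<bar>B v b\<bar> \<le> M) \<Longrightarrow> c * norm v \<le> M"
proof -
  let ?L = "\<lambda>d. \<Sum>b\<in>Basis. B d b *\<^sub>R b"
  have lin: "linear ?L"
    by (rule linearI) (simp_all add: B_linear scaleR_add_left sum.distrib scaleR_sum_right)
  have linB: "linear (B d)" for d by (rule linearI) (simp_all add: B_linear)
  have comp: "?L d \<bullet> b = B d b" if "b \<in> Basis" for d b
    using that by (simp add: inner_sum_left inner_Basis if_distrib cong: if_cong)
  have "d = 0" if "?L d = 0" for d
  proof (rule B_nondegenerate)
    fix x
    have "B d b = 0" if "b \<in> Basis" for b using comp[OF that, of d] \<open>?L d = 0\<close> by simp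
    then have "B d (\<Sum>b\<in>Basis. (x \<bullet> b) *\<^sub>R b) = 0"
      by (simp add: linear_sum[OF linB] linear_cmul[OF linB])
    then show "B d x = B 0 x" by (simp add: euclidean_representation B_linear)
  qed
  then have "inj ?L" unfolding linear_injective_0[OF lin] by simp
  from linear_inj_bounded_below_pos[OF lin this]
  obtain c where c: "c > 0" "\<And>v. c * norm v \<le> norm (?L v)" by blast
  show ?thesis
  proof (rule that[of "c / DIM(real^'n)"])
    show "c / DIM(real^'n) > 0" using c(1) by simp
    fix v M assume M: "\<And>b. b \<in> Basis \<Longrightarrow> \<bar>B v b\<bar> \<le> M"
    have "c * norm v \<le> (\<Sum>b\<in>(Basis::(real^'n) set). norm (B v b *\<^sub>R b))"
      using c(2)[of v] norm_sum order_trans by blast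
    also have "\<dots> \<le> (\<Sum>b\<in>(Basis::(real^'n) set). M)"
      by (intro sum_mono) (simp add: M)
    finally show "c / DIM(real^'n) * norm v \<le> M"
      by (simp add: field_simps)
  qed
qed

text \<open>The projection of all endomorphisms onto the inner derivations along their orthogonal
  complement for the trace form, read as a vector of the Lie algebra.\<close>

definition pr :: "(real^'n) endo \<Rightarrow> real^'n" where
  "pr w = (THE d. \<forall>x. B d x = tr (w * ad x))"

lemma B_pr: "B (pr w) x = tr (w * ad x)"
proof -
  have "linear (\<lambda>x. tr (w * ad x))"
    by (rule linearI) (simp_all add: ad_linear algebra_simps tr_linear)
  from B_functional[OF this] obtain d where d: "\<forall>x. B d x = tr (w * ad x)" ..
  have "\<forall>x. B (pr w) x = tr (w * ad x)"
    unfolding pr_def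
  proof (rule theI)
    fix d' assume "\<forall>x. B d' x = tr (w * ad x)"
    with d show "d' = d" by (intro B_nondegenerate) simp
  qed (fact d)
  then show ?thesis ..
qed

lemma pr_linear: "pr (a + b) = pr a + pr b" "pr (a - b) = pr a - pr b" "pr (r *\<^sub>R a) = r *\<^sub>R pr a"
  by (rule B_nondegenerate; simp add: B_pr B_linear algebra_simps tr_linear)+

lemma pr_ad [simp]: "pr (ad y) = y"
  by (rule B_nondegenerate) (unfold B_pr, simp add: B_def)

lemma norm_ad_le: obtains K where "K > 0" "\<And>x. norm (ad x) \<le> K * norm x"
proof -
  obtain K where K: "K > 0" "\<And>x y. norm (br x y) \<le> norm x * norm y * K"
    using br.pos_bounded by auto
  show ?thesis
  proof (rule that[of K])
    show "norm (ad x) \<le> K * norm x" for x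
    proof (rule norm_endo_le)
      show "norm (app (ad x) y) \<le> K * norm x * norm y" for y
        using K(2)[of x y] by (simp add: ac_simps)
    qed (use K in simp)
  qed (use K in simp)
qed

lemma bounded_linear_pr: "bounded_linear pr"
proof -
  obtain c where c: "c > 0" "\<And>v M. (\<And>b. b \<in> Basis \<Longrightarrow> \<bar>B v b\<bar> \<le> M) \<Longrightarrow> c * norm v \<le> M"
    by (fact B_bounded_below)
  obtain K where K: "K > 0" "\<And>x. norm (ad x) \<le> K * norm x" by (fact norm_ad_le)
  have "c * norm (pr w) \<le> DIM(real^'n) * (norm w * K)" for w
  proof (rule c(2))
    fix b :: "real^'n" assume b: "b \<in> Basis"
    have "norm (w * ad b) \<le> norm w * norm (ad b)" by (rule norm_mult_ineq)
    also have "\<dots> \<le> norm w * K" using K(2)[of b] b by (intro mult_left_mono) auto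
    finally show "\<bar>B (pr w) b\<bar> \<le> DIM(real^'n) * (norm w * K)"
      unfolding B_pr using abs_tr_le[of "w * ad b"]
      by (meson mult_left_mono of_nat_0_le_iff order_trans)
  qed
  then show ?thesis using c(1)
    by (intro bounded_linear_intro[of _ "DIM(real^'n) * K / c"])
      (auto simp: pr_linear field_simps)
qed

section \<open>Automorphisms near the identity\<close>

definition Aut :: "(real^'n) endo set" where
  "Aut = {a. (\<forall>x y. app a (br x y) = br (app a x) (app a y)) \<and> (\<exists>b. a * b = 1 \<and> b * a = 1)}"

lemma Aut_br: "a \<in> Aut \<Longrightarrow> app a (br x y) = br (app a x) (app a y)"
  by (simp add: Aut_def)

lemma Aut_one [simp]: "1 \<in> Aut"
  by (auto simp: Aut_def)

lemma Aut_mult: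
  assumes "a \<in> Aut" "b \<in> Aut" shows "a * b \<in> Aut"
proof -
  obtain a' b' where "a * a' = 1" "a' * a = 1" "b * b' = 1" "b' * b = 1"
    using assms by (auto simp: Aut_def)
  then have "a * (b * b') * a' = 1" "b' * (a' * a) * b = 1"
    by simp_all
  then have "a * b * (b' * a') = 1" "b' * a' * (a * b) = 1"
    by (simp_all only: mult.assoc)
  then show ?thesis using assms unfolding Aut_def by auto
qed

lemma Aut_inverse:
  assumes "a \<in> Aut" "a * b = 1 \<or> b * a = 1"
  shows "b \<in> Aut" "a * b = 1" "b * a = 1"
proof -
  obtain a' where a': "a * a' = 1" "a' * a = 1" using assms(1) by (auto simp: Aut_def)
  have "b = a'"
    using assms(2)
  proof
    assume "a * b = 1"
    then have "a' * a * b = a'" by (simp add: mult.assoc)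
    with a' show ?thesis by simp
  next
    assume "b * a = 1"
    then have "b * a * a' = a'" by simp
    with a' show ?thesis by (simp add: mult.assoc)
  qed
  with a' show ab: "a * b = 1" "b * a = 1" by auto
  have inj: "app a x = app a y \<Longrightarrow> x = y" for x y
    using ab(2) by (metis app_mult app_one)
  have "app b (br x y) = br (app b x) (app b y)" for x y
    by (rule inj) (metis Aut_br[OF assms(1)] ab(1) app_mult app_one)
  then show "b \<in> Aut" using ab by (auto simp: Aut_def)
qed

lemma Aut_ad: "a \<in> Aut \<Longrightarrow> a * ad x = ad (app a x) * a"
  by (rule endo_eqI) (simp add: Aut_br)

lemma Aut_conj: "a \<in> Aut \<Longrightarrow> a * b = 1 \<Longrightarrow> a * ad x * b = ad (app a x)"
  by (simp add: Aut_ad mult.assoc)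

lemma Aut_B:
  assumes "a \<in> Aut" shows "B (app a x) (app a y) = B x y"
proof -
  obtain b where b: "a * b = 1" "b * a = 1" using assms by (auto simp: Aut_def)
  have "ad (app a x) * ad (app a y) = a * ad x * (b * a) * ad y * b"
    by (simp only: Aut_conj[OF assms b(1), symmetric] mult.assoc)
  then have "B (app a x) (app a y) = tr (a * (ad x * ad y * b))"
    unfolding B_def b by (simp add: mult.assoc)
  also have "\<dots> = tr (ad x * ad y * (b * a))"
    by (simp only: tr_commute[of a] mult.assoc)
  finally show ?thesis by (simp add: b B_def)
qed

text \<open>Pulling the bracket back along \<open>exp (t *\<^sub>R ad u)\<close> gives a function of
  \<open>t\<close> whose derivative vanishes by the Jacobi identity; compare its values at 0 and
  1.\<close>

lemma Aut_exp_ad: "exp (ad u) \<in> Aut"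
proof -
  let ?E = "\<lambda>t. exp (t *\<^sub>R ad u)" and ?F = "\<lambda>t. exp (t *\<^sub>R (- ad u))"
  have "app (exp (ad u)) (br x y) = br (app (exp (ad u)) x) (app (exp (ad u)) y)" for x y
  proof -
    let ?g = "\<lambda>t. app (?F t) (br (app (?E t) x) (app (?E t) y))"
    have dE: "(?E has_derivative (\<lambda>h. h *\<^sub>R (ad u * ?E t))) (at t)" for t
      using exp_scaleR_has_vector_derivative_left[of "ad u" t] by (simp add: has_vector_derivative_def)
    have dF: "(?F has_derivative (\<lambda>h. h *\<^sub>R (?F t * (- ad u)))) (at t)" for t
      using exp_scaleR_has_vector_derivative_right[of "- ad u" t] by (simp add: has_vector_derivative_def)
    have dEx: "((\<lambda>t. app (?E t) x) has_derivative (\<lambda>h. h *\<^sub>R br u (app (?E t) x))) (at t)" for t x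
      using bounded_linear.has_derivative[OF app.bounded_linear_left dE] by (simp add: app.scaleR_left)
    have "(?g has_derivative (\<lambda>h. 0)) (at t)" for t
    proof -
      have "(?g has_derivative (\<lambda>h. app (?F t) (br (app (?E t) x) (h *\<^sub>R br u (app (?E t) y))
          + br (h *\<^sub>R br u (app (?E t) x)) (app (?E t) y))
          + app (h *\<^sub>R (?F t * (- ad u))) (br (app (?E t) x) (app (?E t) y)))) (at t)"
        by (intro app.FDERIV dF br.FDERIV dEx)
      then show ?thesis
        by (rule has_derivative_eq_rhs)
          (simp add: fun_eq_iff br.scaleR_left br.scaleR_right app.scaleR_left app.scaleR_right
            app.minus_left app.minus_right app.add_right jacobi[of u] scaleR_add_right)
    qed
    then have "?g 1 = ?g 0"
      by (intro has_derivative_zero_unique[of UNIV ?g]) auto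
    then have "app (exp (ad u)) (?g 1) = app (exp (ad u)) (br x y)" by simp
    then have "app (exp (ad u) * exp (- ad u)) (br (app (exp (ad u)) x) (app (exp (ad u)) y)) = app (exp (ad u)) (br x y)"
      by (simp add: app_mult)
    then show ?thesis by (simp add: exp_minus_inverse)
  qed
  moreover have "exp (ad u) * exp (- ad u) = 1" "exp (- ad u) * exp (ad u) = 1"
    using exp_minus_inverse by auto
  ultimately show ?thesis unfolding Aut_def by (intro CollectI conjI exI[of _ "exp (- ad u)"]) auto
qed

text \<open>The function \<open>pr\<close> is a left inverse of \<open>ad\<close>.  If \<open>w = a - b\<close> is killed by \<open>pr\<close>, then
  \<open>B (w x) y = - tr (\<delta> x * ad y)\<close> with \<open>\<delta> x = w * ad x - ad x * w - ad (w x)\<close>, as in the proof that all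
  derivations are inner.  For automorphisms \<open>a\<close>, \<open>b\<close> near \<open>1\<close> the defect \<open>\<delta>\<close> is small compared with \<open>w\<close>,
  which forces \<open>w = 0\<close>.  No logarithm is needed.\<close>

lemma Aut_locally_determined:
  obtains \<delta> where "\<delta> > 0"
    "\<And>a b. a \<in> Aut \<Longrightarrow> b \<in> Aut \<Longrightarrow> norm (a - 1) < \<delta> \<Longrightarrow> norm (b - 1) < \<delta> \<Longrightarrow>
      pr (a - 1) = pr (b - 1) \<Longrightarrow> a = b"
proof -
  obtain c where c: "c > 0" "\<And>v M. (\<And>b. b \<in> Basis \<Longrightarrow> \<bar>B v b\<bar> \<le> M) \<Longrightarrow> c * norm v \<le> M"
    by (fact B_bounded_below)
  obtain K where K: "K > 0" "\<And>x. norm (ad x) \<le> K * norm x" by (fact norm_ad_le)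
  let ?N = "real DIM(real^'n)"
  \<comment> \<open>Two error terms bounded by
    \<open>?N * K * K * \<delta> * norm w * norm x\<close> arise below. This value makes the sum of
    the bounds \<open>c * norm w * norm x / 2\<close>.\<close>
  define \<delta> where "\<delta> = c / (4 * ?N * K * K)"
  have N: "?N > 0" by simp
  have pos: "\<delta> > 0" unfolding \<delta>_def using c(1) K(1) N by (intro divide_pos_pos mult_pos_pos) auto
  show ?thesis
  proof (rule that[OF pos])
    fix a b assume a: "a \<in> Aut" and b: "b \<in> Aut" and na: "norm (a - 1) < \<delta>" and nb: "norm (b - 1) < \<delta>"
      and eq: "pr (a - 1) = pr (b - 1)"
    define w where "w = a - b"
    have "pr w = pr (a - 1) - pr (b - 1)" unfolding w_def pr_linear(2)[symmetric] by simp
    with eq have pw: "pr w = 0" by simp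
    \<comment> \<open>Comparing the automorphism relations of \<open>a\<close> and \<open>b\<close>
      exhibits the failure of \<open>w\<close> to be a derivation as two terms, one with the small
      factor \<open>a - 1\<close>, the other with \<open>b - 1\<close>.\<close>
    have adw: "ad (app w x) = w * ad x - ad x * w - ad (app w x) * (a - 1) - ad (app (b - 1) x) * w" for x
    proof -
      have "w * ad x = ad (app a x) * a - ad (app b x) * b"
        unfolding w_def by (simp add: algebra_simps Aut_ad[OF a] Aut_ad[OF b])
      then show ?thesis
        unfolding w_def by (simp add: algebra_simps app.diff_left ad_linear)
    qed
    have Bw: "B (app w x) y = - tr (ad (app w x) * (a - 1) * ad y) - tr (ad (app (b - 1) x) * w * ad y)" for x y
    proof -
      have "B (app w x) y = tr ((w * ad x - ad x * w) * ad y) - tr (ad (app w x) * (a - 1) * ad y)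
          - tr (ad (app (b - 1) x) * w * ad y)"
        unfolding B_def by (subst adw) (simp only: left_diff_distrib tr_linear)
      \<comment> \<open>The commutator term becomes \<open>B (pr w) (br x y)\<close>, and
        \<open>pr w = 0\<close>.\<close>
      moreover have "tr ((w * ad x - ad x * w) * ad y) = tr (w * ad (br x y))"
        using tr_commute[of "ad x" "w * ad y"] by (simp add: ad_br algebra_simps tr_linear)
      moreover have "tr (w * ad (br x y)) = 0" using B_pr[of w "br x y"] pw by (simp add: B_linear)
      ultimately show ?thesis by simp
    qed
    have "norm (app w x) \<le> norm w / 2 * norm x" for x
    proof -
      have n1: "norm (ad (app w x) * (a - 1) * ad y) \<le> K * (norm w * norm x) * \<delta> * K" if "norm y = 1" for y
      proof -
        have "norm (ad (app w x)) \<le> K * (norm w * norm x)"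
          using K(2)[of "app w x"] norm_app[of w x] K(1) by (meson less_imp_le mult_left_mono order_trans)
        moreover have "norm (ad y) \<le> K" using K(2)[of y] that by simp
        ultimately show ?thesis using K(1) na pos
          by (intro order_trans[OF norm_mult_ineq] mult_mono order_trans[OF norm_mult_ineq[of "ad (app w x)"]]) auto
      qed
      have n2: "norm (ad (app (b - 1) x) * w * ad y) \<le> K * (\<delta> * norm x) * norm w * K" if "norm y = 1" for y
      proof -
        have "norm (app (b - 1) x) \<le> \<delta> * norm x"
          using norm_app[of "b - 1" x] nb by (meson less_imp_le mult_right_mono norm_ge_zero order_trans)
        then have "norm (ad (app (b - 1) x)) \<le> K * (\<delta> * norm x)"
          using K(2)[of "app (b - 1) x"] K(1) by (meson less_imp_le mult_left_mono order_trans)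
        moreover have "norm (ad y) \<le> K" using K(2)[of y] that by simp
        ultimately show ?thesis using K(1) pos
          by (intro order_trans[OF norm_mult_ineq] mult_mono order_trans[OF norm_mult_ineq[of "ad (app (b - 1) x)"]]) auto
      qed
      have "c * norm (app w x) \<le> ?N * (2 * K * K * \<delta> * (norm w * norm x))"
      proof (rule c(2))
        fix y :: "real^'n" assume "y \<in> Basis"
        then have y: "norm y = 1" by simp
        have "\<bar>B (app w x) y\<bar> \<le> \<bar>tr (ad (app w x) * (a - 1) * ad y)\<bar> + \<bar>tr (ad (app (b - 1) x) * w * ad y)\<bar>"
          unfolding Bw by linarith
        also have "\<dots> \<le> ?N * (K * (norm w * norm x) * \<delta> * K) + ?N * (K * (\<delta> * norm x) * norm w * K)"
          by (intro add_mono order_trans[OF abs_tr_le] mult_left_mono n1[OF y] n2[OF y]) auto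
        finally show "\<bar>B (app w x) y\<bar> \<le> ?N * (2 * K * K * \<delta> * (norm w * norm x))"
          by (simp add: algebra_simps)
      qed
      also have "\<dots> = c * (norm w / 2 * norm x)"
        unfolding \<delta>_def using N K(1) by (simp add: field_simps)
      finally show ?thesis using c(1) by simp
    qed
    then have "norm w \<le> norm w / 2" by (intro norm_endo_le) auto
    then show "a = b" by (simp add: w_def)
  qed
qed

text \<open>Sussmann's open mapping theorem, which uses the derivative at one point only, shows that
  \<open>pr (f x - 1)\<close> fills a ball around 0. By \<open>Aut_locally_determined\<close> an
  automorphism near 1 then equals the value of \<open>f\<close> that has the same
  projection.\<close>

lemma Aut_open_mapping:
  fixes f :: "real^'n \<Rightarrow> (real^'n) endo"
  assumes S: "open S" "x0 \<in> S" and cont: "continuous_on S f" and aut: "\<And>x. x \<in> S \<Longrightarrow> f x \<in> Aut"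
    and f0: "f x0 = 1" and der: "(f has_derivative f') (at x0)" and inj: "\<And>v. pr (f' v) = 0 \<Longrightarrow> v = 0"
  obtains \<delta> where "\<delta> > 0" "\<And>a. a \<in> Aut \<Longrightarrow> norm (a - 1) < \<delta> \<Longrightarrow> a \<in> f ` S"
proof -
  obtain \<delta>0 where \<delta>0: "\<delta>0 > 0" "\<And>a b. a \<in> Aut \<Longrightarrow> b \<in> Aut \<Longrightarrow> norm (a - 1) < \<delta>0 \<Longrightarrow> norm (b - 1) < \<delta>0 \<Longrightarrow>
      pr (a - 1) = pr (b - 1) \<Longrightarrow> a = b"
    by (fact Aut_locally_determined)
  define S' where "S' = S \<inter> f -` ball 1 \<delta>0"
  have S': "open S'" unfolding S'_def
    by (rule continuous_open_preimage[OF cont S(1) open_ball])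
  have x0: "x0 \<in> S'" using S \<delta>0 by (simp add: S'_def f0)
  let ?g = "\<lambda>x. pr (f x - 1)"
  interpret p: bounded_linear pr by (rule bounded_linear_pr)
  have contg: "continuous_on S' ?g"
    by (intro p.continuous_on continuous_intros continuous_on_subset[OF cont]) (auto simp: S'_def)
  have derg: "(?g has_derivative (\<lambda>v. pr (f' v))) (at x0)"
    using p.has_derivative[OF has_derivative_diff[OF der has_derivative_const[of 1]]] by simp
  have lin: "linear (\<lambda>v. pr (f' v))" using derg by (rule has_derivative_linear)
  then have "inj (\<lambda>v. pr (f' v))" unfolding linear_injective_0[OF lin] using inj by simp
  then have "surj (\<lambda>v. pr (f' v))" by (rule linear_inj_imp_surj[OF lin])
  from linear_surjective_right_inverse[OF lin this]
  obtain g' where "linear g'" "(\<lambda>v. pr (f' v)) \<circ> g' = id" by auto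
  then have "?g x0 \<in> interior (?g ` S')"
    using sussmann_open_mapping[OF S' contg x0 derg, of g' S'] x0 S'
    by (simp add: linear_conv_bounded_linear interior_open)
  then obtain r where r: "r > 0" "ball 0 r \<subseteq> ?g ` S'"
    by (auto simp: f0 p.zero mem_interior)
  obtain K where K: "K > 0" "\<And>x. norm (pr x) \<le> norm x * K" using p.pos_bounded by auto
  show ?thesis
  proof (rule that[of "min \<delta>0 (r / K)"])
    show "min \<delta>0 (r / K) > 0" using \<delta>0 r K by simp
    fix a assume a: "a \<in> Aut" "norm (a - 1) < min \<delta>0 (r / K)"
    have "norm (pr (a - 1)) < r"
      using K(2)[of "a - 1"] a(2) K(1) by (simp add: pos_less_divide_eq)
    then have "pr (a - 1) \<in> ?g ` S'" using r(2) by (force simp: dist_norm)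
    then obtain x where x: "x \<in> S'" "pr (a - 1) = pr (f x - 1)" by blast
    then have "a = f x"
      using a by (intro \<delta>0(2)) (auto simp: S'_def aut dist_norm norm_minus_commute)
    then show "a \<in> f ` S" using x by (auto simp: S'_def)
  qed
qed

end

section \<open>Analytic continuation of the dimension of a fixed space\<close>

lemma kernel_subspace: "linear f \<Longrightarrow> subspace {x. f x = 0}"
  by (auto intro!: subspaceI simp: linear_add linear_cmul linear_0)

lemma rank_nullity:
  fixes f :: "'a::euclidean_space \<Rightarrow> 'b::euclidean_space"
  assumes f: "linear f"
  shows "dim (range f) + dim {x. f x = 0} = DIM('a)"
proof -
  let ?K = "{x. f x = 0}"
  define K' where "K' = {y. \<forall>x\<in>?K. orthogonal x y}"
  have K: "subspace ?K" by (rule kernel_subspace[OF f])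
  have dim: "dim K' + dim ?K = DIM('a)"
    using dim_subspace_orthogonal_to_vectors[OF K subspace_UNIV] by (simp add: K'_def dim_UNIV)
  have sub: "subspace K'"
    unfolding K'_def using subspace_orthogonal_to_vectors[of ?K] by simp
  have "inj_on f K'"
  proof (rule inj_onI)
    fix x y assume "x \<in> K'" "y \<in> K'" "f x = f y"
    then have "x - y \<in> K'" "x - y \<in> ?K"
      using sub by (auto simp: subspace_diff linear_diff[OF f])
    then have "orthogonal (x - y) (x - y)" by (simp add: K'_def)
    then show "x = y" by (simp add: orthogonal_def)
  qed
  then have "dim (f ` K') = dim K'"
    using sub by (intro dim_image_eq[OF f]) (simp add: span_eq_iff[THEN iffD2])
  moreover have "f ` K' = range f"
  proof
    show "range f \<subseteq> f ` K'"
    proof clarify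
      fix x
      obtain y z where yz: "y \<in> span ?K" "\<And>w. w \<in> span ?K \<Longrightarrow> orthogonal z w" "x = y + z"
        using orthogonal_subspace_decomp_exists[of ?K x] by metis
      have "y \<in> ?K" using yz(1) K by (simp add: span_eq_iff[THEN iffD2])
      moreover have "z \<in> K'"
        unfolding K'_def using yz(2)[OF span_base] by (auto simp: orthogonal_commute)
      ultimately show "f x \<in> f ` K'" using yz(3) by (auto simp: linear_add[OF f])
    qed
  qed auto
  ultimately show ?thesis using dim by simp
qed

lemma sum_eq_UNIV:
  fixes S T :: "'a::euclidean_space set"
  assumes "subspace S" "subspace T" "S \<inter> T \<subseteq> {0}" "dim S + dim T = DIM('a)"
  shows "\<exists>s\<in>S. \<exists>t\<in>T. x = s + t"
proof -
  have "dim (S \<inter> T) = 0" using assms(3) dim_eq_0 by blast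
  then have "dim {x + y | x y. x \<in> S \<and> y \<in> T} = DIM('a)"
    using dim_sums_Int[OF assms(1,2)] assms(4) by linarith
  then have "span {x + y | x y. x \<in> S \<and> y \<in> T} = UNIV"
    by (simp add: dim_eq_full)
  then have "{x + y | x y. x \<in> S \<and> y \<in> T} = UNIV"
    using span_eq_iff[THEN iffD2, OF subspace_sums[OF assms(1,2)]] by simp
  then have "x \<in> {x + y | x y. x \<in> S \<and> y \<in> T}" by simp
  then show ?thesis by blast
qed

lemma projection_exists:
  fixes S T :: "'a::real_vector set"
  assumes S: "subspace S" and T: "subspace T" and int: "S \<inter> T \<subseteq> {0}"
    and sum: "\<And>x. \<exists>s\<in>S. \<exists>t\<in>T. x = s + t"
  obtains p where "linear p" "\<And>x. p x \<in> S" "\<And>x. x - p x \<in> T"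
    "\<And>x. x \<in> S \<Longrightarrow> p x = x" "\<And>x. x \<in> T \<Longrightarrow> p x = 0"
proof -
  have "\<forall>x. \<exists>s. s \<in> S \<and> x - s \<in> T"
    using sum by (metis add_diff_cancel_left')
  then obtain p where p: "\<And>x. p x \<in> S" "\<And>x. x - p x \<in> T"
    using choice[of "\<lambda>x s. s \<in> S \<and> x - s \<in> T"] by auto
  have uniq: "p x = s" if "s \<in> S" "x - s \<in> T" for x s
  proof -
    have "p x - s \<in> S" using p that S by (simp add: subspace_diff)
    moreover have "(x - s) - (x - p x) \<in> T" using p that T subspace_diff by blast
    ultimately have "p x - s \<in> S \<inter> T" by simp
    then show ?thesis using int by auto
  qed
  have "linear p"
  proof (rule linearI)
    fix x y and r :: real
    have "x + y - (p x + p y) = (x - p x) + (y - p y)" by simp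
    then have "x + y - (p x + p y) \<in> T" using p(2) T by (metis subspace_add)
    then show "p (x + y) = p x + p y" using p S by (intro uniq) (simp_all add: subspace_add)
    have "r *\<^sub>R x - r *\<^sub>R p x = r *\<^sub>R (x - p x)" by (simp add: scaleR_diff_right)
    then have "r *\<^sub>R x - r *\<^sub>R p x \<in> T" using p(2) T by (metis subspace_scale)
    then show "p (r *\<^sub>R x) = r *\<^sub>R p x" using p S by (intro uniq) (simp_all add: subspace_scale)
  qed
  moreover have "p x = x" if "x \<in> S" for x using that T by (intro uniq) (auto simp: subspace_0)
  moreover have "p x = 0" if "x \<in> T" for x using that S by (intro uniq) (auto simp: subspace_0)
  ultimately show ?thesis using that p by blast
qed

text \<open>\<open>S\<close> maps the kernel of \<open>M\<close> isomorphically onto the orthogonal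
  complement of the range of \<open>M\<close> and kills the orthogonal complement of the
  kernel.\<close>

lemma low_rank_perturbation:
  fixes M :: "'a::euclidean_space endo"
  obtains S where "dim (range (app S)) \<le> dim {x. app M x = 0}" "inj (app (M + S))"
proof -
  let ?K = "{x. app M x = 0}" and ?R = "range (app M)"
  have K: "subspace ?K" by (rule kernel_subspace[OF linear_app])
  have R: "subspace ?R" using linear_subspace_image[OF linear_app subspace_UNIV] .
  define K' where "K' = {y. \<forall>x\<in>?K. orthogonal x y}"
  define C where "C = {y. \<forall>x\<in>?R. orthogonal x y}"
  have K': "subspace K'" unfolding K'_def using subspace_orthogonal_to_vectors[of ?K] by simp
  have C: "subspace C" unfolding C_def using subspace_orthogonal_to_vectors[of ?R] by simp
  have "dim C + dim ?R = DIM('a)"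
    using dim_subspace_orthogonal_to_vectors[OF R subspace_UNIV] by (simp add: C_def dim_UNIV)
  with rank_nullity[OF linear_app, of M] have "dim ?K = dim C" by simp
  then obtain f where f: "linear f" "f ` ?K = C" "inj_on f ?K"
    using subspace_isomorphism[OF K C] by blast
  have "dim K' + dim ?K = DIM('a)"
    using dim_subspace_orthogonal_to_vectors[OF K subspace_UNIV] by (simp add: K'_def dim_UNIV)
  moreover have "?K \<inter> K' \<subseteq> {0}" by (auto simp: K'_def orthogonal_def)
  ultimately obtain p where p: "linear p" "\<And>x. p x \<in> ?K" "\<And>x. x \<in> ?K \<Longrightarrow> p x = x"
    using projection_exists[OF K K'] sum_eq_UNIV[OF K K'] by (metis add.commute)
  have lin: "linear (f \<circ> p)" using f(1) p(1) by (rule linear_compose[rotated])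
  let ?S = "endo (f \<circ> p)"
  have S: "app ?S x = f (p x)" for x by (simp add: app_endo[OF lin])
  show ?thesis
  proof (rule that[of ?S])
    have "range (app ?S) \<subseteq> C" unfolding S using f(2) p(2) by blast
    then show "dim (range (app ?S)) \<le> dim ?K" using \<open>dim ?K = dim C\<close> dim_subset by metis
    have "x = 0" if "app (M + ?S) x = 0" for x
    proof -
      have eq: "app M x = - f (p x)"
        using that by (simp add: app.add_left S eq_neg_iff_add_eq_0)
      have fC: "f (p x) \<in> C" using f(2) p(2) by blast
      then have "orthogonal (app M x) (f (p x))" unfolding C_def by blast
      then have "f (p x) = 0" unfolding eq by (simp add: orthogonal_def)
      then have "x \<in> ?K" using eq by simp
      moreover have "p x = 0"
        using inj_onD[OF f(3), of "p x" 0] \<open>f (p x) = 0\<close> p(2)[of x] by (simp add: linear_0[OF f(1)] app.zero_right)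
      ultimately show "x = 0" using p(3) by simp
    qed
    then show "inj (app (M + ?S))" by (simp add: linear_injective_0[OF linear_app])
  qed
qed

section \<open>Real functions that extend to entire functions\<close>

definition entire_real :: "(real \<Rightarrow> real) \<Rightarrow> bool" where
  "entire_real f \<longleftrightarrow> (\<exists>F. F holomorphic_on UNIV \<and> (\<forall>s. F (complex_of_real s) = of_real (f s)))"

lemma entire_real_const: "entire_real (\<lambda>s. c)"
  unfolding entire_real_def by (rule exI[of _ "\<lambda>s. of_real c"]) auto

lemma entire_real_add: "entire_real f \<Longrightarrow> entire_real g \<Longrightarrow> entire_real (\<lambda>s. f s + g s)"
  unfolding entire_real_def
proof clarify
  fix F G assume "F holomorphic_on UNIV" "\<forall>s. F (complex_of_real s) = of_real (f s)"
    "G holomorphic_on UNIV" "\<forall>s. G (complex_of_real s) = of_real (g s)"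
  then show "\<exists>F. F holomorphic_on UNIV \<and> (\<forall>s. F (complex_of_real s) = of_real (f s + g s))"
    by (intro exI[of _ "\<lambda>z. F z + G z"]) (auto intro: holomorphic_intros)
qed

lemma entire_real_mult: "entire_real f \<Longrightarrow> entire_real g \<Longrightarrow> entire_real (\<lambda>s. f s * g s)"
  unfolding entire_real_def
proof clarify
  fix F G assume "F holomorphic_on UNIV" "\<forall>s. F (complex_of_real s) = of_real (f s)"
    "G holomorphic_on UNIV" "\<forall>s. G (complex_of_real s) = of_real (g s)"
  then show "\<exists>F. F holomorphic_on UNIV \<and> (\<forall>s. F (complex_of_real s) = of_real (f s * g s))"
    by (intro exI[of _ "\<lambda>z. F z * G z"]) (auto intro: holomorphic_intros)
qed

lemma entire_real_sum: "(\<And>i. i \<in> I \<Longrightarrow> entire_real (f i)) \<Longrightarrow> entire_real (\<lambda>s. \<Sum>i\<in>I. f i s)"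
  by (induction I rule: infinite_finite_induct) (auto intro: entire_real_const entire_real_add)

lemma entire_real_prod: "(\<And>i. i \<in> I \<Longrightarrow> entire_real (f i)) \<Longrightarrow> entire_real (\<lambda>s. \<Prod>i\<in>I. f i s)"
  by (induction I rule: infinite_finite_induct) (auto intro: entire_real_const entire_real_mult)

lemma entire_real_eq_0:
  assumes "entire_real f" "\<delta> > 0" "\<And>s. \<bar>s\<bar> < \<delta> \<Longrightarrow> f s = 0"
  shows "f s = 0"
proof -
  obtain F where F: "F holomorphic_on UNIV" "\<And>s. F (complex_of_real s) = of_real (f s)"
    using assms(1) by (auto simp: entire_real_def)
  have "F (of_real s) = 0"
  proof (rule analytic_continuation[OF F(1), of "of_real ` {-\<delta><..<\<delta>}" 0])
    show "(0::complex) islimpt of_real ` {-\<delta><..<\<delta>}"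
    proof (rule islimptI)
      fix T :: "complex set" assume "0 \<in> T" "open T"
      then obtain e where e: "e > 0" "ball 0 e \<subseteq> T" by (auto simp: open_contains_ball)
      let ?y = "complex_of_real (min (e/2) (\<delta>/2))"
      have "?y \<in> of_real ` {-\<delta><..<\<delta>}" using e(1) assms(2) by (intro imageI) auto
      moreover have "?y \<in> T" using e assms(2) by (intro subsetD[OF e(2)]) (simp add: norm_of_real)
      moreover have "?y \<noteq> 0" using e assms(2) by (simp add: min_def)
      ultimately show "\<exists>y\<in>of_real ` {-\<delta><..<\<delta>}. y \<in> T \<and> y \<noteq> 0" by blast
    qed
    show "F z = 0" if "z \<in> of_real ` {-\<delta><..<\<delta>}" for z
      using that assms(3) by (auto simp: F(2))
  qed auto
  then show ?thesis by (simp add: F(2))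
qed

definition entire_path :: "(real \<Rightarrow> 'a::euclidean_space endo) \<Rightarrow> bool" where
  "entire_path T \<longleftrightarrow> (\<forall>x. \<forall>b\<in>Basis. entire_real (\<lambda>s. app (T s) x \<bullet> b))"

lemma entire_path_const: "entire_path (\<lambda>s. A)"
  by (simp add: entire_path_def entire_real_const)

lemma entire_path_mult:
  assumes "entire_path T" "entire_path U" shows "entire_path (\<lambda>s. T s * U s)"
  unfolding entire_path_def
proof (intro allI ballI)
  fix x b :: 'a assume b: "b \<in> Basis"
  have "app (T s * U s) x \<bullet> b = (\<Sum>c\<in>Basis. (app (U s) x \<bullet> c) * (app (T s) c \<bullet> b))" for s
    unfolding app_mult
    by (subst euclidean_representation[of "app (U s) x", symmetric])
      (simp only: app.sum_right app.scaleR_right inner_sum_left inner_scaleR_left)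
  moreover have "entire_real (\<lambda>s. \<Sum>c\<in>Basis. (app (U s) x \<bullet> c) * (app (T s) c \<bullet> b))"
    using assms b by (intro entire_real_sum entire_real_mult) (auto simp: entire_path_def)
  ultimately show "entire_real (\<lambda>s. app (T s * U s) x \<bullet> b)" by simp
qed

lemma entire_path_exp: "entire_path (\<lambda>s. exp (s *\<^sub>R D))" for D :: "'a::euclidean_space endo"
  unfolding entire_path_def
proof (intro allI ballI)
  fix x b :: 'a assume "b \<in> Basis"
  define c where "c k = (app (D ^ k) x \<bullet> b) / fact k" for k
  have sums: "(\<lambda>k. c k * s ^ k) sums (app (exp (s *\<^sub>R D)) x \<bullet> b)" for s
  proof -
    have "(\<lambda>k. (app ((s *\<^sub>R D) ^ k) x /\<^sub>R fact k) \<bullet> b) sums (app (exp (s *\<^sub>R D)) x \<bullet> b)"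
      by (rule bounded_linear.sums[OF bounded_linear_inner_left app_exp_sums])
    then show ?thesis
      by (simp add: c_def scaleR_power app.scaleR_left divide_inverse mult_ac)
  qed
  let ?F = "\<lambda>z. \<Sum>k. of_real (c k) * (z::complex) ^ k"
  have summ: "summable (\<lambda>k. complex_of_real (c k) * z ^ k)" for z
  proof -
    \<comment> \<open>The series converges on the real axis at a point of modulus larger than that
      of \<open>z\<close>, hence at \<open>z\<close>.\<close>
    have "summable (\<lambda>k. complex_of_real (c k) * complex_of_real (norm z + 1) ^ k)"
      using sums[of "norm z + 1"] sums_summable summable_of_real
      by (simp add: of_real_power[symmetric] of_real_mult[symmetric] del: of_real_power of_real_mult of_real_add)
    then show ?thesis by (rule powser_inside) (simp add: norm_of_real del: of_real_add)
  qed
  have "?F holomorphic_on UNIV"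
  proof -
    have "\<exists>f'. (?F has_field_derivative f') (at z)" for z
    proof -
      have "(?F has_field_derivative (\<Sum>n. diffs (\<lambda>k. of_real (c k)) n * z ^ n)) (at z)"
        by (rule termdiffs_strong[of _ "of_real (norm z + 1)"]) (use summ in \<open>auto simp: norm_of_real simp del: of_real_add\<close>)
      then show ?thesis by blast
    qed
    then show ?thesis by (auto simp: holomorphic_on_def field_differentiable_def)
  qed
  moreover have "?F (of_real s) = of_real (app (exp (s *\<^sub>R D)) x \<bullet> b)" for s
  proof -
    have "(\<lambda>k. complex_of_real (c k * s ^ k)) sums of_real (app (exp (s *\<^sub>R D)) x \<bullet> b)"
      using sums[of s] by (rule sums_of_real)
    then show ?thesis by (simp add: sums_iff)
  qed
  ultimately show "entire_real (\<lambda>s. app (exp (s *\<^sub>R D)) x \<bullet> b)"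
    unfolding entire_real_def by blast
qed

lemma entire_real_det:
  fixes T :: "real \<Rightarrow> (real^'n) endo"
  assumes "entire_path T"
  shows "entire_real (\<lambda>s. det (matrix (app (T s + A))))"
proof -
  have "entire_real (\<lambda>s. matrix (app (T s + A)) $ i $ j)" for i j
  proof -
    have "matrix (app (T s + A)) $ i $ j = app (T s) (axis j 1) \<bullet> axis i 1 + app A (axis j 1) \<bullet> axis i 1" for s
      by (simp add: matrix_def app.add_left inner_axis)
    moreover have "entire_real (\<lambda>s. app (T s) (axis j 1) \<bullet> axis i 1 + app A (axis j 1) \<bullet> axis i 1)"
      using assms by (intro entire_real_add entire_real_const) (auto simp: entire_path_def)
    ultimately show ?thesis by simp
  qed
  then show ?thesis
    unfolding det_def by (intro entire_real_sum entire_real_mult entire_real_const entire_real_prod)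
qed

text \<open>A perturbation \<open>S\<close> of rank less than \<open>dim h\<close> cannot make \<open>T s - 1\<close> invertible when \<open>T s\<close> fixes a space
  of dimension \<open>dim h\<close>.  So the bound on the dimension is a family of equations
  \<open>det (T s - 1 + S) = 0\<close>, to which the identity theorem applies.\<close>

lemma fixed_space_dim_continuation:
  fixes T :: "real \<Rightarrow> (real^'n) endo"
  assumes T: "entire_path T" and "\<delta> > 0" and h: "subspace h"
    and fixd: "\<And>s. \<bar>s\<bar> < \<delta> \<Longrightarrow> \<exists>u. inj (app u) \<and> (\<forall>x\<in>h. app (T s) (app u x) = app u x)"
  shows "dim h \<le> dim {x. app (T s) x = x}"
proof (rule ccontr)
  assume "\<not> ?thesis"
  moreover have "{x. app (T s) x = x} = {x. app (T s - 1) x = 0}" by (simp add: app.diff_left)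
  moreover obtain S where S: "dim (range (app S)) \<le> dim {x. app (T s - 1) x = 0}" "inj (app (T s - 1 + S))"
    by (fact low_rank_perturbation)
  ultimately have dimS: "dim (range (app S)) < dim h" by simp
  have "det (matrix (app (T t + (S - 1)))) = 0" if t: "\<bar>t\<bar> < \<delta>" for t
  proof -
    obtain u where u: "inj (app u)" "\<And>x. x \<in> h \<Longrightarrow> app (T t) (app u x) = app u x"
      using fixd[OF t] by blast
    \<comment> \<open>\<open>S * u\<close> maps \<open>h\<close> into a space of smaller dimension.
      Two vectors that it identifies give a nonzero difference of fixed vectors of
      \<open>T t\<close> in the kernel of \<open>S\<close>.\<close>
    have "\<not> inj_on (app (S * u)) h"
    proof
      assume "inj_on (app (S * u)) h"
      then have "dim (app (S * u) ` h) = dim h"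
        using h by (intro dim_image_eq[OF linear_app]) (simp add: span_eq_iff[THEN iffD2])
      moreover have "app (S * u) ` h \<subseteq> range (app S)" by auto
      ultimately show False using dimS dim_subset leD by metis
    qed
    then obtain x y where xy: "x \<in> h" "y \<in> h" "x \<noteq> y" "app S (app u x) = app S (app u y)"
      by (auto simp: inj_on_def)
    have "app (T t + (S - 1)) (app u x) = app (T t + (S - 1)) (app u y)"
      using u(2)[OF xy(1)] u(2)[OF xy(2)] xy(4) by (simp add: app.add_left app.diff_left)
    moreover have "app u x \<noteq> app u y" using u(1) xy(3) by (simp add: inj_eq)
    ultimately have "\<not> inj (app (T t + (S - 1)))" by (auto simp: inj_def)
    then show ?thesis using det_nz_iff_inj[OF linear_app] by auto
  qed
  then have "det (matrix (app (T s + (S - 1)))) = 0"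
    using entire_real_eq_0[OF entire_real_det[OF T] \<open>\<delta> > 0\<close>] by blast
  moreover have "inj (app (T s + (S - 1)))" using S(2) by (simp add: algebra_simps)
  ultimately show False using det_nz_iff_inj[OF linear_app] by auto
qed

section \<open>Stabilizers of regular elements\<close>

text \<open>The expansion property of an orthonormal basis of \<open>S\<close>. It is a list because
  the exponentials formed from its entries need not commute.\<close>

definition coordinates :: "'a::euclidean_space set \<Rightarrow> 'a list \<Rightarrow> bool" where
  "coordinates S es \<longleftrightarrow> set es \<subseteq> S \<and> (\<forall>z\<in>S. (\<Sum>e\<leftarrow>es. (z \<bullet> e) *\<^sub>R e) = z)"

lemma coordinates_exist:
  assumes "subspace S" obtains es where "coordinates S es"
proof -
  obtain B where B: "B \<subseteq> S" "pairwise orthogonal B" "\<And>x. x \<in> B \<Longrightarrow> norm x = 1"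
    "independent B" "span B = S"
    using orthonormal_basis_subspace[OF assms] by metis
  have fin: "finite B" using B(4) by (rule independent_imp_finite)
  then obtain es where es: "set es = B" "distinct es" using finite_distinct_list by blast
  have "(\<Sum>e\<leftarrow>es. (z \<bullet> e) *\<^sub>R e) = z" if "z \<in> S" for z
  proof -
    have inner: "b \<bullet> b' = (if b = b' then 1 else 0)" if "b \<in> B" "b' \<in> B" for b b'
      using that B(2,3) by (auto simp: pairwise_def orthogonal_def dot_square_norm)
    have "z \<in> span B" using that B(5) by simp
    then obtain u where u: "z = (\<Sum>b\<in>B. u b *\<^sub>R b)" using span_finite[OF fin] by auto
    have "z \<bullet> b = u b" if "b \<in> B" for b
      unfolding u inner_sum_left using that fin by (simp add: inner if_distrib cong: if_cong)
    then have "(\<Sum>b\<in>B. (z \<bullet> b) *\<^sub>R b) = z" using u by simp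
    then show ?thesis using es by (simp add: sum_list_distinct_conv_sum_set)
  qed
  then show ?thesis using that es(1) B(1) by (auto simp: coordinates_def)
qed

text \<open>The induction proves differentiability only; the value at 0 comes from differentiating
  the relation \<open>expprod ds z * expinv ds z = 1\<close>.\<close>

lemma expinv_derivative_0:
  "(expinv ds has_derivative (\<lambda>v. - expdiff ds 0 v)) (at 0)"
proof -
  have "\<exists>J. (expinv ds has_derivative J) (at z)" for z
  proof (induction ds)
    case Nil
    show ?case by (rule exI[of _ "\<lambda>v. 0"]) simp
  next
    case (Cons d ds)
    obtain e D where d: "d = (e, D)" by force
    from Cons obtain J where "(expinv ds has_derivative J) (at z)" by blast
    from has_derivative_mult[OF this exp_has_derivative[OF bounded_linear_inner_left, of e "- D"]]
    show ?case unfolding d expinv.simps by blast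
  qed
  then obtain J where J: "(expinv ds has_derivative J) (at 0)" by blast
  from has_derivative_mult[OF expprod_derivative[of ds] J]
  have "((\<lambda>z. 1) has_derivative (\<lambda>v. J v + expdiff ds 0 v)) (at (0::'a))"
    by (simp add: expprod_expinv)
  then have "(\<lambda>v. J v + expdiff ds 0 v) = (\<lambda>v. 0)"
    by (rule has_derivative_unique[OF _ has_derivative_const])
  then have "J = (\<lambda>v. - expdiff ds 0 v)" by (simp add: fun_eq_iff eq_neg_iff_add_eq_0)
  with J show ?thesis by simp
qed

context cartan_lie_algebra
begin

definition W :: "(real^'n) list \<Rightarrow> real^'n \<Rightarrow> (real^'n) endo" where
  "W es = expprod (map (\<lambda>e. (e, ad e)) es)"

definition Winv :: "(real^'n) list \<Rightarrow> real^'n \<Rightarrow> (real^'n) endo" where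
  "Winv es = expinv (map (\<lambda>e. (e, ad e)) es)"

lemma W_simps [simp]: "W [] z = 1" "W (e # es) z = exp (ad ((z \<bullet> e) *\<^sub>R e)) * W es z"
  by (simp_all add: W_def ad_linear)

lemma W_inverse [simp]: "W es z * Winv es z = 1" "Winv es z * W es z = 1"
  by (simp_all add: W_def Winv_def expprod_expinv)

lemma app_W_inverse [simp]: "app (W es z) (app (Winv es z) x) = x" "app (Winv es z) (app (W es z) x) = x"
  by (simp_all flip: app_mult)

lemma W_0 [simp]: "W es 0 = 1" "Winv es 0 = 1"
  by (simp_all add: W_def Winv_def)

lemma W_Aut: "W es z \<in> Aut"
  by (induction es) (auto intro: Aut_mult Aut_exp_ad)

lemma Winv_Aut: "Winv es z \<in> Aut"
  using Aut_inverse(1)[OF W_Aut] by (metis W_inverse(1))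

lemma continuous_W [continuous_intros]:
  fixes f :: "'b::topological_space \<Rightarrow> real^'n"
  shows "continuous_on S f \<Longrightarrow> continuous_on S (\<lambda>z. W es (f z))"
    "continuous_on S f \<Longrightarrow> continuous_on S (\<lambda>z. Winv es (f z))"
  unfolding W_def Winv_def by (rule continuous_expprod; assumption)+

lemma expdiff_ad_0: "expdiff (map (\<lambda>e. (e, ad e)) es) 0 v = ad (\<Sum>e\<leftarrow>es. (v \<bullet> e) *\<^sub>R e)"
  by (induction es) (simp_all add: ad_linear)

lemma W_derivative_0:
  fixes p :: "real^'n \<Rightarrow> real^'n"
  assumes es: "coordinates S es" and p: "linear p" and pS: "\<And>z. p z \<in> S"
  shows "((\<lambda>z. W es (p z)) has_derivative (\<lambda>v. ad (p v))) (at 0)"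
    "((\<lambda>z. Winv es (p z)) has_derivative (\<lambda>v. - ad (p v))) (at 0)"
proof -
  have p': "(p has_derivative p) (at 0)" by (rule linear_imp_has_derivative[OF p])
  have ad: "expdiff (map (\<lambda>e. (e, ad e)) es) 0 (p v) = ad (p v)" for v
    unfolding expdiff_ad_0 using es pS by (simp add: coordinates_def)
  have 1: "(W es has_derivative expdiff (map (\<lambda>e. (e, ad e)) es) 0) (at (p 0))"
    "(Winv es has_derivative (\<lambda>v. - expdiff (map (\<lambda>e. (e, ad e)) es) 0 v)) (at (p 0))"
    unfolding W_def Winv_def linear_0[OF p] by (rule expprod_derivative expinv_derivative_0)+
  show "((\<lambda>z. W es (p z)) has_derivative (\<lambda>v. ad (p v))) (at 0)"
    "((\<lambda>z. Winv es (p z)) has_derivative (\<lambda>v. - ad (p v))) (at 0)"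
    using diff_chain_at[OF p' 1(1)] diff_chain_at[OF p' 1(2)] by (simp_all add: o_def ad)
qed

lemma W_subspace:
  assumes T: "subspace T" and es: "\<And>e x. e \<in> set es \<Longrightarrow> x \<in> T \<Longrightarrow> br e x \<in> T" and x: "x \<in> T"
  shows "app (W es z) x \<in> T"
  using es
proof (induction es)
  case (Cons e es)
  have "app (exp (ad ((z \<bullet> e) *\<^sub>R e))) y \<in> T" if "y \<in> T" for y
    using that Cons.prems T by (intro exp_subspace) (auto simp: br.scaleR_left subspace_scale)
  with Cons show ?case by simp
qed (simp add: x)

lemma W_fixes:
  assumes "\<And>e. e \<in> set es \<Longrightarrow> br e x = 0" shows "app (W es z) x = x"
  using assms by (induction es) (auto simp: exp_fixes br.scaleR_left)

text \<open>Elements of the group generated by exponentials, kept as lists of exponents so that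
  scaling every entry joins them to 1 by an analytic path.\<close>

definition expad_list :: "(real^'n) list \<Rightarrow> (real^'n) endo" where
  "expad_list ys = prod_list (map (\<lambda>y. exp (ad y)) ys)"

lemma expad_list_Aut: "expad_list ys \<in> Aut"
  by (induction ys) (auto simp: expad_list_def intro: Aut_mult Aut_exp_ad)

end

locale regular_cartan = cartan_lie_algebra br \<theta>
  for br :: "real^'n \<Rightarrow> real^'n \<Rightarrow> real^'n" and \<theta> +
  fixes h :: "(real^'n) set" and X :: "real^'n"
  assumes h_def: "h = {y. br X y = 0}"
    and h_abelian: "\<And>x y. x \<in> h \<Longrightarrow> y \<in> h \<Longrightarrow> br x y = 0"
    and h_theta: "\<And>x. x \<in> h \<Longrightarrow> \<theta> x \<in> h"
begin

text \<open>The real points of the sum of the root spaces of \<open>h\<close>. By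
  \<open>V_eq_orthogonal\<close> it is the orthogonal complement of \<open>h\<close> for
  \<open>ip\<close>, so it depends on \<open>X\<close> only through \<open>h\<close>.\<close>

definition V :: "(real^'n) set" where "V = range (br X)"

lemma X_in_h [simp]: "X \<in> h" by (simp add: h_def)

lemma subspace_h: "subspace h"
  unfolding h_def by (rule kernel_subspace[OF linear_br(1)])

lemma subspace_V: "subspace V"
  unfolding V_def using linear_subspace_image[OF linear_br(1) subspace_UNIV] .

text \<open>The adjoint of \<open>br X\<close> is \<open>- br (\<theta> X)\<close>, and
  \<open>\<theta> X\<close> lies in the abelian \<open>h\<close>.\<close>

lemma h_orthogonal_V: "x \<in> h \<Longrightarrow> y \<in> V \<Longrightarrow> ip y x = 0"
  unfolding V_def using h_abelian[OF h_theta[OF X_in_h]] by (auto simp: ip_adjoint ip_linear)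

lemma h_Int_V: "h \<inter> V \<subseteq> {0}"
  using h_orthogonal_V by (metis Int_iff ip_eq_0 singletonI subsetI)

lemma dim_h_V: "dim h + dim V = DIM(real^'n)"
  using rank_nullity[OF linear_br(1), of X] by (simp add: V_def h_def)

lemma sum_h_V: "\<exists>s\<in>h. \<exists>t\<in>V. x = s + t"
  by (rule sum_eq_UNIV[OF subspace_h subspace_V h_Int_V dim_h_V])

lemma V_eq_orthogonal: "x \<in> V \<longleftrightarrow> (\<forall>y\<in>h. ip x y = 0)"
proof
  assume *: "\<forall>y\<in>h. ip x y = 0"
  obtain s t where st: "s \<in> h" "t \<in> V" "x = s + t" using sum_h_V by blast
  then have "ip s s = 0" using bspec[OF * st(1)] h_orthogonal_V[OF st(1,2)] by (simp add: ip_linear del: ip_eq_0)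
  then show "x \<in> V" using st by simp
qed (use h_orthogonal_V in auto)

lemma br_h_V: "x \<in> h \<Longrightarrow> y \<in> V \<Longrightarrow> br x y \<in> V"
  unfolding V_eq_orthogonal using h_theta h_abelian by (simp add: ip_adjoint[of x] ip_linear)

lemma X_injective_V: "x \<in> V \<Longrightarrow> br X x = 0 \<Longrightarrow> x = 0"
  using h_Int_V by (auto simp: h_def)

text \<open>To first order \<open>exp (r *\<^sub>R ad X) - 1\<close> is
  \<open>r *\<^sub>R ad X\<close>, which is bounded below by \<open>c * \<bar>r\<bar>\<close> on
  \<open>V\<close>. An error of at most half of that leaves no room for a nonzero fixed
  vector.\<close>

lemma exp_X_no_fixed_vectors:
  obtains \<epsilon> where "\<epsilon> > 0"
    "\<And>r v. 0 < \<bar>r\<bar> \<Longrightarrow> \<bar>r\<bar> < \<epsilon> \<Longrightarrow> v \<in> V \<Longrightarrow> app (exp (r *\<^sub>R ad X)) v = v \<Longrightarrow> v = 0"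
proof -
  obtain c where c: "c > 0" "\<And>v. v \<in> V \<Longrightarrow> c * norm v \<le> norm (br X v)"
    using injective_imp_isometric[OF closed_subspace[OF subspace_V] subspace_V br.bounded_linear_right, of X]
      X_injective_V by blast
  have "((\<lambda>t. exp (t *\<^sub>R ad X)) has_derivative (\<lambda>t. t *\<^sub>R ad X)) (at 0)"
    using exp_scaleR_has_vector_derivative_left[of "ad X" 0] by (simp add: has_vector_derivative_def)
  then have "\<forall>e>0. \<exists>d>0. \<forall>r. norm (r - 0) < d \<longrightarrow>
      norm (exp (r *\<^sub>R ad X) - exp (0 *\<^sub>R ad X) - (r - 0) *\<^sub>R ad X) \<le> e * norm (r - 0)"
    unfolding has_derivative_at_alt by (rule conjunct2)
  from this[rule_format, of "c/2"] c(1)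
  obtain \<epsilon> where \<epsilon>: "\<epsilon> > 0" "\<And>r. \<bar>r\<bar> < \<epsilon> \<Longrightarrow> norm (exp (r *\<^sub>R ad X) - 1 - r *\<^sub>R ad X) \<le> c/2 * \<bar>r\<bar>"
    by auto
  show ?thesis
  proof (rule that[OF \<epsilon>(1)])
    fix r v assume r: "0 < \<bar>r\<bar>" "\<bar>r\<bar> < \<epsilon>" and v: "v \<in> V" "app (exp (r *\<^sub>R ad X)) v = v"
    have "\<bar>r\<bar> * (c * norm v) \<le> norm (r *\<^sub>R br X v)"
      using c(2)[OF v(1)] by (simp add: mult_left_mono)
    also have "r *\<^sub>R br X v = - app (exp (r *\<^sub>R ad X) - 1 - r *\<^sub>R ad X) v"
      using v(2) by (simp add: app.diff_left app.scaleR_left)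
    also have "norm \<dots> \<le> c/2 * \<bar>r\<bar> * norm v"
      unfolding norm_minus_cancel
      by (rule order_trans[OF norm_app mult_right_mono[OF \<epsilon>(2)[OF r(2)] norm_ge_zero]])
    finally have "c * (\<bar>r\<bar> * norm v) \<le> 0" by (simp add: ac_simps)
    then show "v = 0" using r(1) c(1) by (simp add: mult_le_0_iff)
  qed
qed

lemma exp_X_V: "v \<in> V \<Longrightarrow> app (exp (r *\<^sub>R ad X)) v \<in> V"
  using br_h_V[OF X_in_h] subspace_V
  by (intro exp_subspace[OF subspace_V]) (auto simp: app.scaleR_left subspace_scale)

lemma exp_X_h: "v \<in> h \<Longrightarrow> app (exp (r *\<^sub>R ad X)) v = v"
  by (rule exp_fixes) (simp add: app.scaleR_left h_def)

text \<open>Every automorphism near \<open>exp (\<epsilon> ad X)\<close> is conjugate to \<open>exp (\<epsilon> ad X) exp (ad H)\<close> for some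
  \<open>H \<in> h\<close>, since the conjugates of these elements fill a neighbourhood.\<close>

lemma fixed_space_near:
  "\<exists>\<epsilon> \<delta>. \<delta> > 0 \<and> (\<forall>T\<in>Aut. norm (T * exp (- (\<epsilon> *\<^sub>R ad X)) - 1) < \<delta> \<longrightarrow>
      (\<exists>u. inj (app u) \<and> (\<forall>x\<in>h. app T (app u x) = app u x)))"
proof -
  obtain \<epsilon>0 where \<epsilon>0: "\<epsilon>0 > 0"
    "\<And>r v. 0 < \<bar>r\<bar> \<Longrightarrow> \<bar>r\<bar> < \<epsilon>0 \<Longrightarrow> v \<in> V \<Longrightarrow> app (exp (r *\<^sub>R ad X)) v = v \<Longrightarrow> v = 0"
    by (fact exp_X_no_fixed_vectors)
  define \<epsilon> where "\<epsilon> = \<epsilon>0 / 2"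
  have \<epsilon>: "0 < \<bar>\<epsilon>\<bar>" "\<bar>\<epsilon>\<bar> < \<epsilon>0" using \<epsilon>0(1) by (auto simp: \<epsilon>_def)
  define A A' where "A = exp (\<epsilon> *\<^sub>R ad X)" and "A' = exp (- (\<epsilon> *\<^sub>R ad X))"
  have AA: "A * A' = 1" "A' * A = 1" by (simp_all add: A_def A'_def exp_minus_inverse)
  have A_Aut: "A \<in> Aut" unfolding A_def using Aut_exp_ad[of "\<epsilon> *\<^sub>R X"] by (simp add: ad_linear)
  have A'_Aut: "A' \<in> Aut" by (rule Aut_inverse[OF A_Aut]) (simp add: AA)
  obtain p where p: "linear p" "\<And>x. p x \<in> h" "\<And>x. x - p x \<in> V" "\<And>x. x \<in> h \<Longrightarrow> p x = x"
    "\<And>x. x \<in> V \<Longrightarrow> p x = 0"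
    by (rule projection_exists[OF subspace_h subspace_V h_Int_V sum_h_V]) blast
  define q where "q x = x - p x" for x
  have q: "linear q" "\<And>x. q x \<in> V"
    using p unfolding q_def by (auto intro!: linear_compose_sub linear_ident simp: linear_id[unfolded id_def])
  obtain es where es: "coordinates V es" by (rule coordinates_exist[OF subspace_V])
  obtain fs where fs: "coordinates h fs" by (rule coordinates_exist[OF subspace_h])
  \<comment> \<open>\<open>A\<close> times an element of the group of \<open>h\<close>, conjugated
    by coordinates along \<open>V\<close>, then multiplied by the inverse of \<open>A\<close> so
    that the family passes through 1.\<close>
  let ?f = "\<lambda>z. W es (q z) * (A * W fs (p z) * Winv es (q z) * A')"
  have cp: "continuous_on UNIV p" "continuous_on UNIV q"
    using p(1) q(1) by (simp_all add: linear_continuous_on linear_conv_bounded_linear)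
  have cont: "continuous_on UNIV ?f" by (intro continuous_intros cp)
  have aut: "?f z \<in> Aut" for z by (intro Aut_mult W_Aut Winv_Aut A_Aut A'_Aut)
  have f0: "?f 0 = 1" by (simp add: AA linear_0[OF p(1)] linear_0[OF q(1)])
  let ?f' = "\<lambda>v. ad (q v) + ad (app A (p v)) - ad (app A (q v))"
  have der: "(?f has_derivative ?f') (at 0)"
  proof -
    note d = W_derivative_0[OF es q(1) q(2)] W_derivative_0(1)[OF fs p(1) p(2)]
    have "(?f has_derivative (\<lambda>v. W es (q 0) * ((A * W fs (p 0) * (- ad (q v)) + (A * ad (p v)) * Winv es (q 0)) * A')
        + ad (q v) * (A * W fs (p 0) * Winv es (q 0) * A'))) (at 0)"
      by (intro has_derivative_mult d has_derivative_mult_left has_derivative_mult_right)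
    moreover have "A * (ad u * A') = ad (app A u)" for u
      using Aut_conj[OF A_Aut AA(1)] by (simp add: mult.assoc)
    ultimately show ?thesis
      by (elim has_derivative_eq_rhs)
        (simp add: fun_eq_iff linear_0[OF p(1)] linear_0[OF q(1)] AA ring_distribs mult.assoc)
  qed
  \<comment> \<open>\<open>A\<close> is the identity on \<open>h\<close> and preserves
    \<open>V\<close>. So the derivative splits into the identity on \<open>h\<close> and
    \<open>1 - A\<close> on \<open>V\<close>, which is injective by the choice of
    \<epsilon>.\<close>
  have inj: "v = 0" if "pr (?f' v) = 0" for v
  proof -
    have Ap: "app A (p v) = p v" unfolding A_def by (rule exp_X_h[OF p(2)])
    have "q v + p v - app A (q v) = 0" using that by (simp add: pr_linear Ap)
    then have "p v = app A (q v) - q v" by (simp add: algebra_simps)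
    moreover have AV: "app A (q v) \<in> V" unfolding A_def by (rule exp_X_V[OF q(2)])
    ultimately have "p v \<in> h \<inter> V" using p(2)[of v] subspace_diff[OF subspace_V AV q(2)] by simp
    then have pv: "p v = 0" using h_Int_V by auto
    then have "app A (q v) = q v" using \<open>q v + p v - app A (q v) = 0\<close> by simp
    then have "q v = 0" using \<epsilon>0(2)[OF \<epsilon> q(2)] by (simp add: A_def)
    then show "v = 0" using pv by (simp add: q_def)
  qed
  have "\<exists>\<delta>>0. \<forall>a\<in>Aut. norm (a - 1) < \<delta> \<longrightarrow> a \<in> range ?f"
    by (rule Aut_open_mapping[OF open_UNIV UNIV_I cont aut f0 der inj]) auto
  then obtain \<delta> where \<delta>: "\<delta> > 0" "\<And>a. a \<in> Aut \<Longrightarrow> norm (a - 1) < \<delta> \<Longrightarrow> a \<in> range ?f"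
    by auto
  show ?thesis
  proof (rule exI[of _ \<epsilon>], rule exI[of _ \<delta>], intro conjI \<delta>(1) ballI impI)
    fix T assume T: "T \<in> Aut" "norm (T * exp (- (\<epsilon> *\<^sub>R ad X)) - 1) < \<delta>"
    have "T * A' \<in> range ?f"
      using T by (intro \<delta>(2) Aut_mult A'_Aut) (auto simp: A'_def)
    then obtain z where z: "T * A' = ?f z" by blast
    have "T = T * (A' * A)" by (simp add: AA)
    also have "\<dots> = ?f z * A" by (simp only: z mult.assoc[symmetric])
    also have "\<dots> = W es (q z) * A * W fs (p z) * Winv es (q z) * (A' * A)" by (simp only: mult.assoc)
    finally have T_eq: "T = W es (q z) * A * W fs (p z) * Winv es (q z)" by (simp add: AA)
    have "app T (app (W es (q z)) x) = app (W es (q z)) x" if "x \<in> h" for x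
    proof -
      have "br e x = 0" if "e \<in> set fs" for e
        using that \<open>x \<in> h\<close> fs h_abelian by (auto simp: coordinates_def)
      then have "app (W fs (p z)) x = x" by (rule W_fixes)
      moreover have "app A x = x" unfolding A_def by (rule exp_X_h[OF that])
      ultimately show ?thesis by (simp add: T_eq)
    qed
    moreover have "inj (app (W es (q z)))"
      by (rule inj_on_inverseI[of _ "app (Winv es (q z))"]) simp
    ultimately show "\<exists>u. inj (app u) \<and> (\<forall>x\<in>h. app T (app u x) = app u x)" by blast
  qed
qed

lemma dim_fixed_space: "dim h \<le> dim {x. app (expad_list ys) x = x}"
proof -
  obtain \<epsilon> \<delta> where \<delta>: "\<delta> > 0"
    "\<And>T. T \<in> Aut \<Longrightarrow> norm (T * exp (- (\<epsilon> *\<^sub>R ad X)) - 1) < \<delta> \<Longrightarrow>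
      \<exists>u. inj (app u) \<and> (\<forall>x\<in>h. app T (app u x) = app u x)"
    using fixed_space_near by auto
  let ?P = "\<lambda>ys s. prod_list (map (\<lambda>y. exp (s *\<^sub>R ad y)) ys)"
  define T where "T s = ?P (- (\<epsilon> *\<^sub>R X) # ys) s" for s
  have ent: "entire_path (?P ys)" for ys
    by (induction ys) (auto intro: entire_path_const entire_path_mult entire_path_exp)
  have cont: "continuous_on UNIV (?P ys)" for ys
  proof (induction ys)
    case (Cons y ys)
    have "continuous_on UNIV (\<lambda>s. exp (s *\<^sub>R ad y))"
      by (rule has_derivative_continuous_on[OF exp_has_derivative[OF bounded_linear_ident]])
    with Cons show ?case by (auto intro: continuous_intros)
  qed auto
  have aut: "?P ys s \<in> Aut" for ys s
    using Aut_exp_ad by (induction ys) (auto intro!: Aut_mult simp: ad_linear(3)[symmetric])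
  let ?A = "exp (\<epsilon> *\<^sub>R ad X)" and ?A' = "exp (- (\<epsilon> *\<^sub>R ad X))"
  have AA: "?A * ?A' = 1" by (simp add: exp_minus_inverse)
  \<comment> \<open>At \<open>s = 0\<close> the path is at
    \<open>exp (\<epsilon> *\<^sub>R ad X)\<close>, around which the bound on the fixed space is
    known. At \<open>s = 1\<close> the prepended factor with exponent
    \<open>- (\<epsilon> *\<^sub>R X)\<close> cancels \<open>?A\<close> and leaves the given
    product.\<close>
  let ?U = "\<lambda>s. ?A * ?P (- (\<epsilon> *\<^sub>R X) # ys) s"
  have P0: "?P ys 0 = 1" for ys by (induction ys) auto
  have cont': "continuous_on UNIV (\<lambda>s. ?A * ?P (- (\<epsilon> *\<^sub>R X) # ys) s * ?A')"
    by (intro continuous_intros cont)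
  then have "isCont (\<lambda>s. ?A * ?P (- (\<epsilon> *\<^sub>R X) # ys) s * ?A') 0"
    by (simp add: continuous_on_eq_continuous_at)
  then obtain r where r: "r > 0" "\<And>s. \<bar>s\<bar> < r \<Longrightarrow> dist (?U s * ?A') (?U 0 * ?A') < \<delta>"
    unfolding continuous_at_eps_delta using \<delta>(1) by (auto simp: dist_real_def)
  have "dim h \<le> dim {x. app (?U 1) x = x}"
  proof (rule fixed_space_dim_continuation[where T = ?U and s = 1, OF _ r(1) subspace_h])
    show "entire_path ?U" by (intro entire_path_mult entire_path_const ent)
    fix s :: real assume s: "\<bar>s\<bar> < r"
    have "?U 0 * ?A' = 1" unfolding P0 by (simp add: AA)
    then have "norm (?U s * ?A' - 1) < \<delta>" using r(2)[OF s] by (simp add: dist_norm)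
    moreover have "?U s \<in> Aut"
      using Aut_exp_ad[of "\<epsilon> *\<^sub>R X"] by (intro Aut_mult aut) (simp add: ad_linear)
    ultimately show "\<exists>u. inj (app u) \<and> (\<forall>x\<in>h. app (?U s) (app u x) = app u x)" using \<delta>(2)[of "?U s"] by simp
  qed
  moreover have "?U 1 = expad_list ys"
    by (simp add: expad_list_def ad_linear mult.assoc[symmetric] AA)
  ultimately show ?thesis by (simp only:)
qed

lemma exp_X_add: "exp (s *\<^sub>R ad X) * exp (t *\<^sub>R ad X) = exp ((s + t) *\<^sub>R ad X)"
  by (subst exp_add_commuting[symmetric]) (auto simp: scaleR_add_left)

text \<open>The product with \<open>exp (t ad X)\<close> still fixes a space of dimension \<open>dim h\<close>, but for some small
  \<open>t\<close> it fixes no vector outside \<open>h\<close>: the fixed spaces in \<open>V\<close> for different \<open>t\<close> are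
  linearly independent.\<close>

theorem stabilizer_fixes_h:
  assumes AX: "app (expad_list ys) X = X" and H: "H \<in> h"
  shows "app (expad_list ys) H = H"
proof -
  let ?A = "expad_list ys" and ?E = "\<lambda>t. exp (t *\<^sub>R ad X)"
  obtain \<epsilon> where \<epsilon>: "\<epsilon> > 0"
    "\<And>r v. 0 < \<bar>r\<bar> \<Longrightarrow> \<bar>r\<bar> < \<epsilon> \<Longrightarrow> v \<in> V \<Longrightarrow> app (?E r) v = v \<Longrightarrow> v = 0"
    by (fact exp_X_no_fixed_vectors)
  have A_br: "app ?A (br X x) = br X (app ?A x)" for x
    using Aut_br[OF expad_list_Aut, of ys X x] AX by simp
  have AV: "app ?A v \<in> V" if "v \<in> V" for v using that by (auto simp: V_def A_br)
  have Ah: "app ?A x \<in> h" if "x \<in> h" for x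
    using A_br[of x] that by (simp add: h_def app.zero_right)
  have commute: "?A * (t *\<^sub>R ad X) = (t *\<^sub>R ad X) * ?A" for t
    using Aut_ad[OF expad_list_Aut, of ys X] AX by simp
  note commE = exp_commutes[OF commute]
  define K where "K t = {v \<in> V. app (?A * ?E t) v = v}" for t
  have K_sub: "subspace (K t)" for t
    unfolding K_def using subspace_V by (auto intro!: subspaceI simp: subspace_0 subspace_add subspace_scale
      app.zero_right app.add_right app.scaleR_right simp del: app_mult)
  have K_E: "app (?E s) v \<in> K t" if "v \<in> K t" for s t v
  proof -
    have "(?A * ?E t) * ?E s = ?A * (?E s * ?E t)"
      by (simp only: exp_X_add add.commute mult.assoc)
    also have "\<dots> = (?A * ?E s) * ?E t" by (simp only: mult.assoc)
    also have "\<dots> = ?E s * (?A * ?E t)" by (simp only: commE[of s] mult.assoc)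
    finally have "app (?A * ?E t) (app (?E s) v) = app (?E s) (app (?A * ?E t) v)"
      by (simp only: app_mult[symmetric])
    then show ?thesis using that exp_X_V by (simp add: K_def)
  qed
  have indep: "\<forall>t\<in>F. v t = 0"
    if "finite F" "F \<subseteq> {0<..<\<epsilon>}" "\<And>t. t \<in> F \<Longrightarrow> v t \<in> K t" "(\<Sum>t\<in>F. v t) = 0" for F v
    using that
  proof (induction F arbitrary: v rule: finite_induct)
    case (insert t0 F)
    \<comment> \<open>As for eigenvectors, apply the operator \<open>?A * ?E t0\<close> to the
      relation and subtract the relation: the term of \<open>t0\<close> drops out, and the others
      become \<open>?w t\<close>, still in \<open>K t\<close>. Differences of parameters stay below
      \<epsilon>, so \<open>?w t = 0\<close> forces \<open>v t = 0\<close>.\<close>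
    let ?w = "\<lambda>t. app (?E (t0 - t)) (v t) - v t"
    have Kt: "v t \<in> K t" if "t \<in> insert t0 F" for t using insert.prems(2) that by blast
    have "app (?A * ?E t0) (v t) = app (?E (t0 - t)) (v t)" if "t \<in> insert t0 F" for t
    proof -
      have "?A * ?E t0 = ?A * (?E (t0 - t) * ?E t)" by (simp add: exp_X_add)
      also have "\<dots> = (?A * ?E (t0 - t)) * ?E t" by (simp only: mult.assoc)
      also have "\<dots> = ?E (t0 - t) * (?A * ?E t)" by (simp only: commE[of "t0 - t"] mult.assoc)
      finally have "app (?A * ?E t0) (v t) = app (?E (t0 - t)) (app (?A * ?E t) (v t))"
        by (simp only: app_mult)
      then show ?thesis using Kt[OF that] by (simp add: K_def)
    qed
    then have "(\<Sum>t\<in>insert t0 F. app (?E (t0 - t)) (v t)) = app (?A * ?E t0) (\<Sum>t\<in>insert t0 F. v t)"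
      by (simp only: app.sum_right cong: sum.cong)
    then have "(\<Sum>t\<in>insert t0 F. app (?E (t0 - t)) (v t)) - (\<Sum>t\<in>insert t0 F. v t) = 0"
      unfolding insert.prems(3) by (simp add: app.zero_right)
    then have "(\<Sum>t\<in>F. ?w t) = 0"
      using insert.hyps by (simp add: sum_subtractf)
    moreover have "?w t \<in> K t" if "t \<in> F" for t
      using Kt[of t] that K_E K_sub by (intro subspace_diff) auto
    ultimately have w0: "\<forall>t\<in>F. ?w t = 0" using insert.prems(1) by (intro insert.IH) auto
    have "v t = 0" if "t \<in> F" for t
    proof (rule \<epsilon>(2)[of "t0 - t"])
      show "0 < \<bar>t0 - t\<bar>" using that insert.hyps(2) by auto
      have "t \<in> {0<..<\<epsilon>}" "t0 \<in> {0<..<\<epsilon>}" using insert.prems(1) that by auto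
      then show "\<bar>t0 - t\<bar> < \<epsilon>" by auto
      show "v t \<in> V" using Kt[of t] that by (simp add: K_def)
      show "app (?E (t0 - t)) (v t) = v t" using w0 that by simp
    qed
    with insert.prems(3) insert.hyps show ?case by simp
  qed simp
  \<comment> \<open>Otherwise one could pick nonzero vectors from more spaces \<open>K t\<close>
    than the dimension allows to be independent.\<close>
  have "\<exists>t\<in>{0<..<\<epsilon>}. K t \<subseteq> {0}"
  proof (rule ccontr)
    assume "\<not> ?thesis"
    then have "\<forall>t\<in>{0<..<\<epsilon>}. \<exists>v. v \<in> K t \<and> v \<noteq> 0" by blast
    then obtain v where v: "\<And>t. t \<in> {0<..<\<epsilon>} \<Longrightarrow> v t \<in> K t" "\<And>t. t \<in> {0<..<\<epsilon>} \<Longrightarrow> v t \<noteq> 0"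
      by metis
    have "infinite {0<..<\<epsilon>}" using \<epsilon>(1) infinite_Ioo by blast
    then obtain F where F: "F \<subseteq> {0<..<\<epsilon>}" "finite F" "card F = Suc (DIM(real^'n))"
      using infinite_arbitrarily_large by blast
    have inj: "inj_on v F"
    proof (rule inj_onI, rule ccontr)
      fix s t assume st: "s \<in> F" "t \<in> F" "v s = v t" "s \<noteq> t"
      let ?v = "\<lambda>r. if r = s then v s else - v t"
      have "\<forall>r\<in>{s, t}. ?v r = 0"
      proof (rule indep)
        show "{s, t} \<subseteq> {0<..<\<epsilon>}" using st F by auto
        show "?v r \<in> K r" if "r \<in> {s, t}" for r
          using that st(1,2,4) F(1) v(1) K_sub by (auto intro!: subspace_neg)
        show "(\<Sum>r\<in>{s, t}. ?v r) = 0" using st(3,4) by simp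
      qed simp
      then show False using v(2)[of s] st F by auto
    qed
    have "independent (v ` F)"
    proof (rule independent_if_scalars_zero)
      fix f x assume sum: "(\<Sum>x\<in>v ` F. f x *\<^sub>R x) = 0" and x: "x \<in> v ` F"
      have "\<forall>t\<in>F. f (v t) *\<^sub>R v t = 0"
        using sum F v(1) K_sub by (intro indep) (auto simp: sum.reindex[OF inj] subspace_scale)
      moreover obtain t where "t \<in> F" "x = v t" using x by blast
      ultimately show "f x = 0" using v(2)[OF subsetD[OF F(1)], of t] by auto
    qed (use F in simp)
    then have "card (v ` F) \<le> DIM(real^'n)" using independent_card_le by blast
    then show False using card_image[OF inj] F(3) by simp
  qed
  then obtain t where t: "K t \<subseteq> {0}" by blast
  let ?T = "?A * ?E t"
  have T: "?T = expad_list (ys @ [t *\<^sub>R X])" by (simp add: expad_list_def ad_linear)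
  \<comment> \<open>\<open>?T\<close> preserves \<open>h\<close> and \<open>V\<close>, so the
    component in \<open>V\<close> of a fixed vector is itself fixed and lies in
    \<open>K t\<close>.\<close>
  have fix_h: "{x. app ?T x = x} \<subseteq> h"
  proof clarify
    fix x assume x: "app ?T x = x"
    obtain y v where yv: "y \<in> h" "v \<in> V" "x = y + v" using sum_h_V by blast
    have 1: "app ?T y \<in> h" "app ?T v \<in> V" using yv by (simp_all add: exp_X_h exp_X_V Ah AV)
    have "app ?T y + app ?T v = y + v" using x yv(3) by (simp add: app.add_right)
    then have "app ?T y - y = v - app ?T v" by (simp add: algebra_simps)
    then have "v - app ?T v \<in> h \<inter> V"
      using 1 yv subspace_diff[OF subspace_h] subspace_diff[OF subspace_V] by (metis IntI)
    then have "app ?T v = v" using h_Int_V by auto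
    then have "v \<in> K t" using yv by (simp add: K_def)
    then show "x \<in> h" using t yv by auto
  qed
  have "subspace {x. app ?T x = x}"
    using kernel_subspace[OF linear_app, of "?T - 1"] by (simp add: app.diff_left)
  \<comment> \<open>The lower bound \<open>dim_fixed_space\<close> turns the inclusion into an
    equality; on \<open>h\<close> the factor \<open>?E t\<close> is the identity, so what remains is
    the claim about \<open>?A\<close>.\<close>
  then have "{x. app ?T x = x} = h"
    using fix_h dim_fixed_space[of "ys @ [t *\<^sub>R X]"] subspace_h
    by (intro subspace_dim_equal) (simp_all add: T[symmetric] del: app_mult)
  then have "app ?T H = H" using H by blast
  then show ?thesis by (simp add: exp_X_h[OF H])
qed

end

section \<open>Root spaces\<close>

context cartan_lie_algebra
begin

text \<open>The complement is taken for \<open>ip\<close>, not for the inner product of the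
  coordinate space. The map \<open>g\<close> is the Gram operator of \<open>ip\<close> on
  \<open>S\<close>. It is invertible there, so \<open>g s = g x\<close> has a solution
  \<open>s\<close> in \<open>S\<close>, and \<open>x - s\<close> is orthogonal to
  \<open>S\<close>.\<close>

lemma ip_decomposition:
  assumes S: "subspace S"
  shows "\<exists>s\<in>S. \<exists>t\<in>{y. \<forall>s\<in>S. ip s y = 0}. x = s + t"
proof -
  obtain es where "coordinates S es" by (rule coordinates_exist[OF S])
  then have es: "set es \<subseteq> S" "\<And>z. z \<in> S \<Longrightarrow> (\<Sum>e\<leftarrow>es. (z \<bullet> e) *\<^sub>R e) = z"
    by (simp_all add: coordinates_def)
  define g where "g y = (\<Sum>e\<leftarrow>es. ip e y *\<^sub>R e)" for y
  have lin: "linear g"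
  proof (rule linearI)
    fix x y and r :: real
    have "(\<Sum>e\<leftarrow>fs. ip e (x + y) *\<^sub>R e) = (\<Sum>e\<leftarrow>fs. ip e x *\<^sub>R e) + (\<Sum>e\<leftarrow>fs. ip e y *\<^sub>R e)" for fs
      by (induction fs) (simp_all add: ip_linear scaleR_add_left)
    then show "g (x + y) = g x + g y" unfolding g_def .
    have "(\<Sum>e\<leftarrow>fs. ip e (r *\<^sub>R x) *\<^sub>R e) = r *\<^sub>R (\<Sum>e\<leftarrow>fs. ip e x *\<^sub>R e)" for fs
      by (induction fs) (simp_all add: ip_linear scaleR_add_right)
    then show "g (r *\<^sub>R x) = r *\<^sub>R g x" unfolding g_def .
  qed
  have gS: "g y \<in> S" for y
    unfolding g_def using es(1) by (induction es) (auto simp: subspace_0[OF S] subspace_add[OF S] subspace_scale[OF S])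
  have ip_g: "ip s y = s \<bullet> g y" if "s \<in> S" for s y
  proof -
    have "ip (\<Sum>e\<leftarrow>fs. (s \<bullet> e) *\<^sub>R e) y = s \<bullet> (\<Sum>e\<leftarrow>fs. ip e y *\<^sub>R e)" for fs
      by (induction fs) (auto simp: ip_linear inner_add_right)
    from this[of es] show ?thesis unfolding es(2)[OF that] g_def .
  qed
  have "inj_on g S"
  proof (rule inj_onI)
    fix s t assume st: "s \<in> S" "t \<in> S" "g s = g t"
    then have "ip (s - t) (s - t) = 0"
      using ip_g[of "s - t" "s - t"] by (simp add: subspace_diff[OF S] linear_diff[OF lin] del: ip_eq_0)
    then show "s = t" by simp
  qed
  then have "dim (g ` S) = dim S"
    using S by (intro dim_image_eq[OF lin]) (simp add: span_eq_iff[THEN iffD2])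
  then have "g ` S = S"
    using gS linear_subspace_image[OF lin S] S by (intro subspace_dim_equal) auto
  then have "g x \<in> g ` S" using gS[of x] by simp
  then obtain s where s: "s \<in> S" "g x = g s" by (rule imageE)
  then have "ip s' (x - s) = 0" if "s' \<in> S" for s'
    using ip_g[OF that, of "x - s"] by (simp add: linear_diff[OF lin])
  with s(1) show ?thesis by (intro bexI[of _ s] bexI[of _ "x - s"]) auto
qed

lemma subspace_ip_complement: "subspace {y. \<forall>s\<in>S. ip s y = 0}"
  by (auto intro!: subspaceI simp: ip_linear)

lemma continuous_on_ip:
  assumes K: "linear K" shows "continuous_on S (\<lambda>x. ip (K x) x)"
proof -
  have "bilinear ip"
    unfolding bilinear_def by (auto intro!: linearI simp: ip_linear)
  then have "bounded_bilinear ip" by (simp add: bilinear_conv_bounded_bilinear)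
  then show ?thesis
    by (rule bounded_bilinear.continuous_on)
      (use K in \<open>simp_all add: linear_continuous_on linear_conv_bounded_linear\<close>)
qed

text \<open>The eigenvector maximizes the Rayleigh quotient.\<close>

lemma symmetric_eigenvector:
  assumes S: "subspace S" "S \<noteq> {0}" and K: "linear K" "\<And>x. x \<in> S \<Longrightarrow> K x \<in> S"
    and sym: "\<And>x y. x \<in> S \<Longrightarrow> y \<in> S \<Longrightarrow> ip (K x) y = ip x (K y)"
  obtains u m where "u \<in> S" "u \<noteq> 0" "K u = m *\<^sub>R u"
proof -
  let ?U = "S \<inter> sphere 0 1"
  let ?f = "\<lambda>x. ip (K x) x / ip x x"
  obtain v where v: "v \<in> S" "v \<noteq> 0" using S subspace_0 by blast
  then have "v /\<^sub>R norm v \<in> ?U" using S(1) by (simp add: subspace_scale)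
  then have "?U \<noteq> {}" by blast
  moreover have "compact ?U"
    using closed_subspace[OF S(1)] by (simp add: closed_Int_compact)
  moreover have "continuous_on ?U ?f"
    by (intro continuous_on_divide continuous_on_ip K linear_ident) auto
  ultimately obtain u where u: "u \<in> ?U" "\<And>y. y \<in> ?U \<Longrightarrow> ?f y \<le> ?f u"
    using continuous_attains_sup[of ?U ?f] by blast
  define m where "m = ?f u"
  have uS: "u \<in> S" "u \<noteq> 0" using u(1) by auto
  have max: "ip (K x) x \<le> m * ip x x" if "x \<in> S" for x
  proof (cases "x = 0")
    case False
    let ?y = "x /\<^sub>R norm x"
    have "?y \<in> ?U" using that S(1) False by (simp add: subspace_scale)
    then have "?f ?y \<le> m" using u(2) m_def by blast
    moreover have "?f ?y = ?f x"
      using False by (simp add: linear_cmul[OF K(1)] ip_linear)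
    ultimately show ?thesis using ip_pos[OF False] by (simp add: pos_divide_le_eq)
  qed (simp add: linear_0[OF K(1)] ip_linear)
  have mu: "ip (K u) u = m * ip u u" using uS by (simp add: m_def)
  have orth: "ip (K u - m *\<^sub>R u) y = 0" if y: "y \<in> S" for y
  proof (rule ccontr)
    let ?b = "ip (K u - m *\<^sub>R u) y" and ?c = "ip (K y) y - m * ip y y"
    assume b: "?b \<noteq> 0"
    have poly: "2 * t * ?b + t\<^sup>2 * ?c \<le> 0" for t
    proof -
      have "u + t *\<^sub>R y \<in> S" using uS y S(1) by (simp add: subspace_add subspace_scale)
      from max[OF this] show ?thesis
        using mu sym[OF uS(1) y] ip_sym[of u y] ip_sym[of "K y" u]
        by (simp add: linear_add[OF K(1)] linear_cmul[OF K(1)] ip_linear power2_eq_square algebra_simps)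
    qed
    \<comment> \<open>For this \<open>t\<close> the linear term wins:
      \<open>t\<^sup>2 * (\<bar>?c\<bar> + 1) = t * ?b\<close>, so the quadratic expression is at
      least \<open>t * ?b > 0\<close>.\<close>
    define t where "t = ?b / (\<bar>?c\<bar> + 1)"
    have "\<bar>?c\<bar> + 1 > 0" by simp
    then have tb: "t * ?b > 0" and "t * ?b * (\<bar>?c\<bar> + 1) = ?b\<^sup>2" "t\<^sup>2 * (\<bar>?c\<bar> + 1) = t * ?b"
      using b by (auto simp: t_def power2_eq_square zero_less_mult_iff zero_less_divide_iff)
    moreover have "t\<^sup>2 * (- ?c) \<le> t\<^sup>2 * (\<bar>?c\<bar> + 1)" by (intro mult_left_mono) auto
    ultimately show False using poly[of t] by simp
  qed
  have "K u - m *\<^sub>R u \<in> S" using K(2)[OF uS(1)] uS S(1) by (simp add: subspace_diff subspace_scale)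
  from orth[OF this] have "K u = m *\<^sub>R u" by simp
  then show ?thesis using that uS by blast
qed

end

context regular_cartan
begin

lemma h_split:
  assumes "H \<in> h"
  obtains Hp Hk where "Hp \<in> h" "\<theta> Hp = - Hp" "Hk \<in> h" "\<theta> Hk = Hk" "H = Hp + Hk"
proof (rule that[of "(1/2) *\<^sub>R (H - \<theta> H)" "(1/2) *\<^sub>R (H + \<theta> H)"])
  show "(1/2) *\<^sub>R (H - \<theta> H) \<in> h" "(1/2) *\<^sub>R (H + \<theta> H) \<in> h"
    using assms h_theta subspace_h by (simp_all add: subspace_scale subspace_diff subspace_add)
  have "H = (1/2) *\<^sub>R (H + H)" by (simp add: scaleR_2[symmetric])
  then show "H = (1/2) *\<^sub>R (H - \<theta> H) + (1/2) *\<^sub>R (H + \<theta> H)" by (simp add: scaleR_add_right[symmetric])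
qed (simp_all add: theta_linear algebra_simps)

lemma in_h_if:
  assumes "\<And>H. H \<in> h \<Longrightarrow> \<theta> H = - H \<Longrightarrow> br H z = 0" "\<And>H. H \<in> h \<Longrightarrow> \<theta> H = H \<Longrightarrow> br H z = 0"
  shows "z \<in> h"
proof -
  obtain Hp Hk where "Hp \<in> h" "\<theta> Hp = - Hp" "Hk \<in> h" "\<theta> Hk = Hk" "X = Hp + Hk"
    by (rule h_split[OF X_in_h])
  then have "br X z = 0" using assms by (simp add: br.add_left)
  then show ?thesis by (simp add: h_def)
qed

lemma zero_if_B_h:
  assumes z: "z \<in> h" and "\<And>H. H \<in> h \<Longrightarrow> \<theta> H = - H \<Longrightarrow> B z H = 0" "\<And>H. H \<in> h \<Longrightarrow> \<theta> H = H \<Longrightarrow> B z H = 0"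
  shows "z = 0"
proof -
  obtain Hp Hk where "Hp \<in> h" "\<theta> Hp = - Hp" "Hk \<in> h" "\<theta> Hk = Hk" "\<theta> z = Hp + Hk"
    by (rule h_split[OF h_theta[OF z]])
  then have "B z (\<theta> z) = 0" using assms by (simp add: B_linear)
  then have "ip z z = 0" by (simp add: ip_def)
  then show ?thesis by simp
qed

text \<open>With \<open>v = u + \<i> u'\<close> and \<open>v' = w + \<i> w'\<close> this says that two vectors of the same root space of
  \<open>h\<close> which are orthogonal for the Hermitian form are linearly dependent, so that the root spaces are
  lines.  Its point is \<open>\<bar>[v, v']\<bar>\<^sup>2 = - \<alpha>([\<sigma> v, v]) \<bar>v'\<bar>\<^sup>2\<close>, where \<open>\<sigma>\<close> is the conjugation
  with respect to the compact form.\<close>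

lemma root_spaces_are_lines:
  assumes u: "u \<in> V" "u \<noteq> 0"
    and real: "\<And>H. H \<in> h \<Longrightarrow> \<theta> H = - H \<Longrightarrow> \<exists>l. br H u = l *\<^sub>R u \<and> br H u' = l *\<^sub>R u' \<and>
      br H w = l *\<^sub>R w \<and> br H w' = l *\<^sub>R w'"
    and imag: "\<And>H. H \<in> h \<Longrightarrow> \<theta> H = H \<Longrightarrow> \<exists>m. br H u = - (m *\<^sub>R u') \<and> br H u' = m *\<^sub>R u \<and>
      br H w = - (m *\<^sub>R w') \<and> br H w' = m *\<^sub>R w"
    and orth: "ip u w = 0" "ip u w' = 0" "ip u' w = 0" "ip u' w' = 0"
  shows "w = 0" "w' = 0"
proof -
  have theta_real: "br H (\<theta> x) = - (l *\<^sub>R \<theta> x)" if "\<theta> H = - H" "br H x = l *\<^sub>R x" for H x l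
  proof -
    have "br H (\<theta> x) = \<theta> (br (\<theta> H) x)" by (simp add: theta_br)
    with that show ?thesis by (simp add: br.minus_left theta_linear)
  qed
  have theta_imag: "br H (\<theta> x) = \<theta> (br H x)" if "\<theta> H = H" for H x
    using that by (simp add: theta_br)
  \<comment> \<open>These are the real and imaginary parts of [\<sigma> v, y + \<i> y']. The weights
    of the two factors cancel, so both parts centralize \<open>h\<close>.\<close>
  have in_h: "br (\<theta> u) y + br (\<theta> u') y' \<in> h \<and> br (\<theta> u) y' - br (\<theta> u') y \<in> h"
    if re: "\<And>H. H \<in> h \<Longrightarrow> \<theta> H = - H \<Longrightarrow> \<exists>l. br H u = l *\<^sub>R u \<and> br H u' = l *\<^sub>R u' \<and>
        br H y = l *\<^sub>R y \<and> br H y' = l *\<^sub>R y'"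
      and im: "\<And>H. H \<in> h \<Longrightarrow> \<theta> H = H \<Longrightarrow> \<exists>m. br H u = - (m *\<^sub>R u') \<and> br H u' = m *\<^sub>R u \<and>
        br H y = - (m *\<^sub>R y') \<and> br H y' = m *\<^sub>R y" for y y'
  proof (intro conjI in_h_if)
    fix H assume H: "H \<in> h" "\<theta> H = - H"
    obtain l where l: "br H u = l *\<^sub>R u" "br H u' = l *\<^sub>R u'" "br H y = l *\<^sub>R y" "br H y' = l *\<^sub>R y'"
      using re[OF H] by auto
    then show "br H (br (\<theta> u) y + br (\<theta> u') y') = 0" "br H (br (\<theta> u) y' - br (\<theta> u') y) = 0"
      using theta_real[OF H(2) l(1)] theta_real[OF H(2) l(2)]
      by (simp_all add: br.add_right br.diff_right jacobi[of H] br.scaleR_left br.scaleR_right br.minus_left)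
  next
    fix H assume H: "H \<in> h" "\<theta> H = H"
    obtain m where "br H u = - (m *\<^sub>R u')" "br H u' = m *\<^sub>R u" "br H y = - (m *\<^sub>R y')" "br H y' = m *\<^sub>R y"
      using im[OF H] by auto
    then show "br H (br (\<theta> u) y + br (\<theta> u') y') = 0" "br H (br (\<theta> u) y' - br (\<theta> u') y) = 0"
      using theta_imag[OF H(2)]
      by (simp_all add: br.add_right br.diff_right jacobi[of H] br.scaleR_left br.scaleR_right br.minus_left
          br.minus_right theta_linear)
  qed
  \<comment> \<open>a + \<i> b is [\<sigma> v, v'], and z0 + \<i> z1 is [\<sigma> v, v].\<close>
  define a b where "a = br (\<theta> u) w + br (\<theta> u') w'" and "b = br (\<theta> u) w' - br (\<theta> u') w"
  define z0 z1 where "z0 = br (\<theta> u) u + br (\<theta> u') u'" and "z1 = br (\<theta> u) u' - br (\<theta> u') u"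
  have "a \<in> h \<and> b \<in> h" unfolding a_def b_def by (rule in_h[OF real imag])
  then have ab_h: "a \<in> h" "b \<in> h" by simp_all
  have "z0 \<in> h \<and> z1 \<in> h"
    unfolding z0_def z1_def
  proof (rule in_h)
    fix H assume H: "H \<in> h"
    show "\<exists>l. br H u = l *\<^sub>R u \<and> br H u' = l *\<^sub>R u' \<and> br H u = l *\<^sub>R u \<and> br H u' = l *\<^sub>R u'"
      if "\<theta> H = - H" using real[OF H that] by blast
    show "\<exists>m. br H u = - (m *\<^sub>R u') \<and> br H u' = m *\<^sub>R u \<and> br H u = - (m *\<^sub>R u') \<and> br H u' = m *\<^sub>R u"
      if "\<theta> H = H" using imag[OF H that] by blast
  qed
  then have z_h: "z0 \<in> h" "z1 \<in> h" by simp_all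
  have B_br: "B (br x y) H = - B x (br H y)" for x y H
    unfolding B_invariant by (subst br_anti) (simp add: B_linear)
  have B_orth: "B (\<theta> u) w = 0" "B (\<theta> u) w' = 0" "B (\<theta> u') w = 0" "B (\<theta> u') w' = 0"
    using orth unfolding ip_sym[of u] ip_sym[of u'] by (simp_all add: ip_def B_sym[of "\<theta> u"] B_sym[of "\<theta> u'"])
  have B_same: "B (\<theta> u) u = - ip u u" "B (\<theta> u') u' = - ip u' u'"
    by (simp_all add: ip_def B_sym)
  have "B a H = 0 \<and> B b H = 0" if H: "H \<in> h" "\<theta> H = - H" for H
    using real[OF H] B_orth by (auto simp: a_def b_def B_linear B_br)
  moreover have "B a H = 0 \<and> B b H = 0" if H: "H \<in> h" "\<theta> H = H" for H
    using imag[OF H] B_orth by (auto simp: a_def b_def B_linear B_br)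
  \<comment> \<open>By invariance and the assumed orthogonality [\<sigma> v, v'] is orthogonal to
    \<open>h\<close> for the Killing form, while its two parts lie in \<open>h\<close>.\<close>
  ultimately have ab: "a = 0" "b = 0"
    using zero_if_B_h[OF ab_h(1)] zero_if_B_h[OF ab_h(2)] by blast+
  let ?R = "ip u u + ip u' u'"
  have R: "?R > 0" using ip_pos[OF u(2)] ip_ge_0[of u'] by linarith
  have theta_z: "\<theta> z0 = - z0" "\<theta> z1 = z1"
    using br_anti[of u "\<theta> u"] br_anti[of u' "\<theta> u'"] br_anti[of u "\<theta> u'"] br_anti[of u' "\<theta> u"]
    by (simp_all add: z0_def z1_def theta_linear theta_br)
  have Bz0: "B z0 H = l * ?R" if "br H u = l *\<^sub>R u" "br H u' = l *\<^sub>R u'" for H l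
    using that B_same by (simp add: z0_def B_linear B_br algebra_simps)
  have Bz1: "B z1 H = m * ?R" if "br H u = - (m *\<^sub>R u')" "br H u' = m *\<^sub>R u" for H m
    using that B_same by (simp add: z1_def B_linear B_br algebra_simps)
  obtain l where l: "br z0 u = l *\<^sub>R u" "br z0 u' = l *\<^sub>R u'" "br z0 w = l *\<^sub>R w" "br z0 w' = l *\<^sub>R w'"
    using real[OF z_h(1) theta_z(1)] by auto
  obtain m where m: "br z1 u = - (m *\<^sub>R u')" "br z1 u' = m *\<^sub>R u" "br z1 w = - (m *\<^sub>R w')" "br z1 w' = m *\<^sub>R w"
    using imag[OF z_h(2) theta_z(2)] by auto
  have lR: "l * ?R = ip z0 z0" using Bz0[OF l(1,2)] by (simp add: ip_def theta_z B_linear)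
  have mR: "m * ?R = - ip z1 z1" using Bz1[OF m(1,2)] by (simp add: ip_def theta_z)
  \<comment> \<open>The number \<alpha>([\<sigma> v, v]) is \<open>l - m\<close>, and
    \<open>(l - m) * ?R\<close> is the sum of the squared norms of \<open>z0\<close> and
    \<open>z1\<close>. It is positive because a vanishing bracket would kill all weights and put
    \<open>u\<close> into \<open>h\<close>.\<close>
  have "\<not> (z0 = 0 \<and> z1 = 0)"
  proof
    assume z: "z0 = 0 \<and> z1 = 0"
    have "u \<in> h"
    proof (rule in_h_if)
      fix H assume H: "H \<in> h" "\<theta> H = - H"
      obtain l' where l': "br H u = l' *\<^sub>R u" "br H u' = l' *\<^sub>R u'" using real[OF H] by auto
      have "l' * ?R = 0" using Bz0[OF l'] z by (simp add: B_linear)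
      then show "br H u = 0" using R l' by simp
    next
      fix H assume H: "H \<in> h" "\<theta> H = H"
      obtain m' where m': "br H u = - (m' *\<^sub>R u')" "br H u' = m' *\<^sub>R u" using imag[OF H] by auto
      have "m' * ?R = 0" using Bz1[OF m'] z by (simp add: B_linear)
      then show "br H u = 0" using R m' by simp
    qed
    then show False using u h_Int_V by auto
  qed
  then have "ip z0 z0 + ip z1 z1 > 0"
    using ip_pos[of z0] ip_pos[of z1] ip_ge_0[of z0] ip_ge_0[of z1] by linarith
  then have "(l - m) * ?R > 0" using lR mR by (simp add: left_diff_distrib)
  then have lm: "l - m > 0" using R by (simp add: zero_less_mult_iff)
  define x y where "x = br u w - br u' w'" and "y = br u w' + br u' w"
  \<comment> \<open>With x + \<i> y = [v, v'], this is the Jacobi identity for [\<sigma> v,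
    [v, v']]: since [\<sigma> v, v'] = 0, only \<alpha>([\<sigma> v, v]) v' remains.
    \<open>P\<close> and \<open>Q\<close> are the real and imaginary parts.\<close>
  have P: "br (\<theta> u) x + br (\<theta> u') y = (l - m) *\<^sub>R w"
  proof -
    have "br (\<theta> u) x + br (\<theta> u') y = br z0 w - br z1 w' + br u a - br u' b"
      by (simp add: x_def y_def z0_def z1_def a_def b_def br.add_right br.add_left br.diff_left br.diff_right
          jacobi[of "\<theta> u" u] jacobi[of "\<theta> u" u'] jacobi[of "\<theta> u'" u] jacobi[of "\<theta> u'" u'])
    then show ?thesis by (simp add: ab br.zero_right l m scaleR_diff_left)
  qed
  have Q: "br (\<theta> u) y - br (\<theta> u') x = (l - m) *\<^sub>R w'"
  proof -
    have "br (\<theta> u) y - br (\<theta> u') x = br z0 w' + br z1 w + br u b + br u' a"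
      by (simp add: x_def y_def z0_def z1_def a_def b_def br.add_right br.add_left br.diff_left br.diff_right
          jacobi[of "\<theta> u" u] jacobi[of "\<theta> u" u'] jacobi[of "\<theta> u'" u] jacobi[of "\<theta> u'" u'])
    then show ?thesis by (simp add: ab br.zero_right l m scaleR_diff_left)
  qed
  have "ip x x + ip y y = ip (br u w) x - ip (br u' w') x + (ip (br u w') y + ip (br u' w) y)"
    by (simp add: x_def[symmetric] y_def[symmetric] ip_linear[symmetric])
  also have "\<dots> = - ip w (br (\<theta> u) x + br (\<theta> u') y) - ip w' (br (\<theta> u) y - br (\<theta> u') x)"
    by (simp add: ip_adjoint ip_linear)
  also have "\<dots> = - ((l - m) * (ip w w + ip w' w'))"
    unfolding P Q by (simp add: ip_linear algebra_simps)
  finally have "(l - m) * (ip w w + ip w' w') \<le> 0"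
    using ip_ge_0[of x] ip_ge_0[of y] by linarith
  then have "ip w w + ip w' w' \<le> 0" using lm by (simp add: mult_le_0_iff)
  then have "ip w w = 0" "ip w' w' = 0" using ip_ge_0[of w] ip_ge_0[of w'] by linarith+
  then show "w = 0" "w' = 0" by simp_all
qed

section \<open>Subspaces stable under the Cartan subalgebra\<close>

definition h_stable :: "(real^'n) set \<Rightarrow> bool" where
  "h_stable S \<longleftrightarrow> subspace S \<and> (\<forall>H\<in>h. \<forall>x\<in>S. br H x \<in> S)"

text \<open>Since \<open>h\<close> is \<theta>-stable, the operators \<open>br H\<close> with
  \<open>H\<close> in \<open>h\<close> are closed under adjoints up to sign.\<close>

lemma h_stable_complement: "h_stable S \<Longrightarrow> h_stable {y. \<forall>s\<in>S. ip s y = 0}"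
proof -
  assume S: "h_stable S"
  have "ip s (br H y) = 0" if "H \<in> h" "s \<in> S" "\<forall>s\<in>S. ip s y = 0" for H y s
  proof -
    have "br (\<theta> H) s \<in> S" using S that h_theta by (simp add: h_stable_def)
    then have "ip (br (\<theta> H) s) y = 0" using that by blast
    then show ?thesis by (simp add: ip_adjoint[of "\<theta> H"])
  qed
  then show ?thesis using subspace_ip_complement by (auto simp: h_stable_def)
qed

lemma h_stable_Int: "h_stable S \<Longrightarrow> h_stable T \<Longrightarrow> h_stable (S \<inter> T)"
  by (auto simp: h_stable_def subspace_inter)

text \<open>The kernel of \<open>br X\<close> is \<open>h\<close>, so \<open>br X\<close> is
  injective on \<open>n\<close> and by dimension onto. Hence \<open>n\<close> lies in
  \<open>V\<close>, and the tangent vectors [u, X] with \<open>u\<close> in \<open>n\<close> fill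
  \<open>n\<close> itself.\<close>

lemma h_stable_br_X:
  assumes n: "h_stable n" and "n \<inter> h \<subseteq> {0}"
  shows "br X ` n = n"
proof -
  have sub: "subspace n" and "br X ` n \<subseteq> n" using n by (auto simp: h_stable_def)
  moreover have "inj_on (br X) n"
  proof (rule inj_onI)
    fix x y assume "x \<in> n" "y \<in> n" "br X x = br X y"
    then have "x - y \<in> n \<inter> h" using sub by (simp add: subspace_diff h_def br.diff_right)
    then show "x = y" using assms(2) by auto
  qed
  then have "dim (br X ` n) = dim n"
    using sub by (intro dim_image_eq[OF linear_br(1)]) (simp add: span_eq_iff[THEN iffD2])
  ultimately show ?thesis
    using linear_subspace_image[OF linear_br(1) sub] by (intro subspace_dim_equal) auto
qed

lemma h_stable_subset_V: "h_stable n \<Longrightarrow> n \<inter> h \<subseteq> {0} \<Longrightarrow> n \<subseteq> V"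
  unfolding V_def by (subst h_stable_br_X[symmetric, of n]) auto

lemma br_commute_h: "H \<in> h \<Longrightarrow> H' \<in> h \<Longrightarrow> br H (br H' x) = br H' (br H x)"
  using jacobi[of H H' x] h_abelian[of H H'] by (simp add: br.zero_left)

text \<open>A complex weight vector u + \<i> u' in real terms: elements of \<open>h\<close> negated
  by \<theta> act with the real weight \<open>l\<close>, those fixed by \<theta> with the imaginary
  weight \<i> m.\<close>

lemma irreducible_weight_pair:
  assumes S: "h_stable S" "S \<noteq> {0}"
    and irr: "\<And>S'. h_stable S' \<Longrightarrow> S' \<subseteq> S \<Longrightarrow> S' \<noteq> {0} \<Longrightarrow> S' = S"
  shows "\<exists>u\<in>S. \<exists>u'\<in>S. u \<noteq> 0 \<and> (\<forall>H\<in>h.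
    (\<theta> H = - H \<longrightarrow> (\<exists>l. br H u = l *\<^sub>R u \<and> br H u' = l *\<^sub>R u')) \<and>
    (\<theta> H = H \<longrightarrow> (\<exists>m. br H u = - (m *\<^sub>R u') \<and> br H u' = m *\<^sub>R u)))"
proof -
  have sub: "subspace S" and stab: "\<And>H x. H \<in> h \<Longrightarrow> x \<in> S \<Longrightarrow> br H x \<in> S"
    using S(1) by (auto simp: h_stable_def)
  \<comment> \<open>Schur's lemma for symmetric operators: an eigenspace of \<open>K\<close> is
    stable, hence all of \<open>S\<close>.\<close>
  have scalar: "\<exists>m. \<forall>x\<in>S. K x = m *\<^sub>R x"
    if K: "linear K" "\<And>x. x \<in> S \<Longrightarrow> K x \<in> S" "\<And>x y. x \<in> S \<Longrightarrow> y \<in> S \<Longrightarrow> ip (K x) y = ip x (K y)"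
      "\<And>H x. H \<in> h \<Longrightarrow> x \<in> S \<Longrightarrow> K (br H x) = br H (K x)" for K
  proof -
    obtain v m where v: "v \<in> S" "v \<noteq> 0" "K v = m *\<^sub>R v"
      using symmetric_eigenvector[OF sub S(2) K(1-3)] by metis
    let ?E = "{x \<in> S. K x = m *\<^sub>R x}"
    have "h_stable ?E"
      using sub stab K(1,4) unfolding h_stable_def
      by (auto intro!: subspaceI simp: subspace_0 subspace_add subspace_scale linear_0 linear_add linear_cmul
          scaleR_add_right br.scaleR_right)
    then have "?E = S" using v by (intro irr) auto
    then show ?thesis by blast
  qed
  have real: "\<exists>l. \<forall>x\<in>S. br H x = l *\<^sub>R x" if H: "H \<in> h" "\<theta> H = - H" for H
    using H stab br_commute_h by (intro scalar linear_br) (auto simp: ip_adjoint br.minus_left ip_linear)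
  show ?thesis
  proof (cases "\<forall>H\<in>h. \<theta> H = H \<longrightarrow> (\<forall>x\<in>S. br H x = 0)")
    case True
    obtain u where u: "u \<in> S" "u \<noteq> 0" using S(2) sub subspace_0 by blast
    show ?thesis
    proof (rule bexI[of _ u], rule bexI[of _ 0], intro conjI ballI impI)
      show "0 \<in> S" using sub by (rule subspace_0)
      fix H assume H: "H \<in> h"
      show "\<theta> H = - H \<Longrightarrow> \<exists>l. br H u = l *\<^sub>R u \<and> br H 0 = l *\<^sub>R 0"
        using real[OF H] u(1) by (auto simp: br.zero_right)
      show "\<theta> H = H \<Longrightarrow> \<exists>m. br H u = - (m *\<^sub>R 0) \<and> br H 0 = m *\<^sub>R u"
        using True H u(1) by (intro exI[of _ 0]) (auto simp: br.zero_right)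
    qed (use u in auto)
  next
    case False
    then obtain H0 x0 where H0: "H0 \<in> h" "\<theta> H0 = H0" and x0: "x0 \<in> S" "br H0 x0 \<noteq> 0" by blast
    have skew: "ip (br H x) y = - ip x (br H y)" if "\<theta> H = H" for H x y
      using ip_adjoint[of H x y] that by simp
    have "\<exists>m. \<forall>x\<in>S. br H0 (br H0 x) = m *\<^sub>R x"
    proof (rule scalar)
      show "linear (\<lambda>x. br H0 (br H0 x))" using linear_compose[OF linear_br(1) linear_br(1)] by (simp add: o_def)
      show "ip (br H0 (br H0 x)) y = ip x (br H0 (br H0 y))" for x y
        by (simp add: skew[OF H0(2)])
      show "br H0 (br H0 (br H x)) = br H (br H0 (br H0 x))" if "H \<in> h" for H x
        using br_commute_h[OF H0(1) that] by simp
    qed (use stab H0 in auto)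
    then obtain m where m: "\<And>x. x \<in> S \<Longrightarrow> br H0 (br H0 x) = m *\<^sub>R x" by blast
    have "m * ip x0 x0 = - ip (br H0 x0) (br H0 x0)"
      using m[OF x0(1)] skew[OF H0(2), of "br H0 x0" x0] by (simp add: ip_linear)
    moreover have "x0 \<noteq> 0" using x0(2) by (auto simp: br.zero_right)
    ultimately have "m < 0" using ip_pos[of x0] ip_pos[OF x0(2)] by (smt (verit) mult_nonneg_nonneg)
    define c where "c = sqrt (- m)"
    have c: "c > 0" "c * c = - m" using \<open>m < 0\<close> by (auto simp: c_def)
    \<comment> \<open>The square of \<open>br H0\<close> is a negative scalar on \<open>S\<close>,
      so dividing by \<open>c\<close> gives a complex structure. It supplies the second vector of
      the pair.\<close>
    define J where "J x = (1/c) *\<^sub>R br H0 x" for x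
    have JJ: "J (J x) = - x" if "x \<in> S" for x
    proof -
      have "m = - (c * c)" using c(2) by simp
      then have "(1/c) * (1/c) * m = - 1" using c(1) by simp
      then show ?thesis using m[OF that] by (simp add: J_def br.scaleR_right)
    qed
    have JS: "J x \<in> S" if "x \<in> S" for x
      using that stab[OF H0(1)] sub by (simp add: J_def subspace_scale)
    have linJ: "linear J" unfolding J_def by (intro linear_compose_scale_right linear_br)
    \<comment> \<open>\<open>br H\<close> and \<open>J\<close> are skew and commute, so their
      product is symmetric and therefore a scalar on \<open>S\<close>.\<close>
    have imag: "\<exists>s. \<forall>x\<in>S. br H x = - (s *\<^sub>R J x)" if H: "H \<in> h" "\<theta> H = H" for H
    proof -
      have "\<exists>s. \<forall>x\<in>S. br H (J x) = s *\<^sub>R x"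
      proof (rule scalar)
        show "linear (\<lambda>x. br H (J x))" using linear_compose[OF linJ linear_br(1)] by (simp add: o_def)
        show "ip (br H (J x)) y = ip x (br H (J y))" for x y
          by (simp add: J_def br.scaleR_right ip_linear skew[OF H(2)] skew[OF H0(2)] br_commute_h[OF H(1) H0(1)])
        show "br H (J (br H' x)) = br H' (br H (J x))" if "H' \<in> h" for H' x
          using br_commute_h[OF H0(1) that] br_commute_h[OF H(1) that] by (simp add: J_def br.scaleR_right)
      qed (use stab[OF H(1)] JS in auto)
      then obtain s where s: "\<And>x. x \<in> S \<Longrightarrow> br H (J x) = s *\<^sub>R x" by blast
      have "br H x = - (s *\<^sub>R J x)" if "x \<in> S" for x
      proof -
        have "- br H x = s *\<^sub>R J x" using s[OF JS[OF that]] JJ[OF that] by (simp add: br.minus_right)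
        then have "- (- br H x) = - (s *\<^sub>R J x)" by (rule arg_cong)
        then show ?thesis by simp
      qed
      then show ?thesis by blast
    qed
    show ?thesis
    proof (rule bexI[of _ x0], rule bexI[of _ "J x0"], intro conjI ballI impI)
      show "x0 \<noteq> 0" by fact
      fix H assume H: "H \<in> h"
      show "\<theta> H = - H \<Longrightarrow> \<exists>l. br H x0 = l *\<^sub>R x0 \<and> br H (J x0) = l *\<^sub>R J x0"
        using real[OF H] x0(1) JS[OF x0(1)] by blast
      assume "\<theta> H = H"
      then obtain s where s: "\<And>x. x \<in> S \<Longrightarrow> br H x = - (s *\<^sub>R J x)" using imag[OF H] by blast
      show "\<exists>m. br H x0 = - (m *\<^sub>R J x0) \<and> br H (J x0) = m *\<^sub>R x0"
        using s[OF x0(1)] s[OF JS[OF x0(1)]] JJ[OF x0(1)] by (intro exI[of _ s]) simp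
    qed (use x0 JS in auto)
  qed
qed

text \<open>If \<open>a\<close> moved a vector out of \<open>n\<close>, its projection \<tau> to the
  orthogonal complement of \<open>n\<close> would be a nonzero map commuting with \<open>h\<close>.
  A least stable subspace on which \<tau> is nonzero is irreducible, and \<tau> copies its weight
  vector into the complement. So two orthogonal vectors would share a root, against
  \<open>root_spaces_are_lines\<close>.\<close>

theorem h_stable_invariant:
  assumes a: "a \<in> Aut" "\<And>H. H \<in> h \<Longrightarrow> app a H = H" and n: "h_stable n" "n \<inter> h \<subseteq> {0}" and x: "x \<in> n"
  shows "app a x \<in> n"
proof (rule ccontr)
  assume ax: "app a x \<notin> n"
  have nV: "n \<subseteq> V" by (rule h_stable_subset_V[OF n])
  define N where "N = {y. \<forall>s\<in>n. ip s y = 0}"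
  have subn: "subspace n" using n(1) by (simp add: h_stable_def)
  have N: "h_stable N" unfolding N_def by (rule h_stable_complement[OF n(1)])
  have subN: "subspace N" using N by (simp add: h_stable_def)
  have int: "N \<inter> n \<subseteq> {0}"
  proof
    fix y assume "y \<in> N \<inter> n"
    then have "ip y y = 0" by (simp add: N_def del: ip_eq_0)
    then show "y \<in> {0}" by simp
  qed
  have sum: "\<exists>s\<in>N. \<exists>t\<in>n. y = s + t" for y
  proof -
    obtain s t where "s \<in> n" "t \<in> N" "y = s + t" using ip_decomposition[OF subn, of y] unfolding N_def by blast
    then show ?thesis by (intro bexI[of _ t] bexI[of _ s]) (simp_all add: add.commute)
  qed
  obtain p where p: "linear p" "\<And>x. p x \<in> N" "\<And>x. x - p x \<in> n" "\<And>x. x \<in> N \<Longrightarrow> p x = x"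
    "\<And>x. x \<in> n \<Longrightarrow> p x = 0"
    by (rule projection_exists[OF subN subn int sum]) blast
  have p_br: "p (br H y) = br H (p y)" if H: "H \<in> h" for H y
  proof -
    have "br H (p y) \<in> N" "br H (y - p y) \<in> n"
      using N n(1) p(2,3) H by (auto simp: h_stable_def)
    then have "p (br H (p y) + br H (y - p y)) = br H (p y)"
      using p(4,5) by (simp add: linear_add[OF p(1)])
    then show ?thesis by (simp add: br.add_right[symmetric])
  qed
  define \<tau> where "\<tau> y = p (app a y)" for y
  have lin: "linear \<tau>" unfolding \<tau>_def using linear_compose[OF linear_app p(1)] by (simp add: o_def)
  have tau_br: "\<tau> (br H y) = br H (\<tau> y)" if "H \<in> h" for H y
    using that a by (simp add: \<tau>_def Aut_br p_br)
  have tau_N: "\<tau> y \<in> N" for y unfolding \<tau>_def by (rule p(2))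
  have "\<tau> x \<noteq> 0"
  proof
    assume "\<tau> x = 0"
    then show False using p(3)[of "app a x"] ax by (simp add: \<tau>_def)
  qed
  let ?Q = "\<lambda>S. h_stable S \<and> S \<subseteq> n \<and> (\<exists>y\<in>S. \<tau> y \<noteq> 0)"
  have "?Q n" using n(1) x \<open>\<tau> x \<noteq> 0\<close> by blast
  then obtain S where S: "?Q S" and min: "\<And>S'. ?Q S' \<Longrightarrow> dim S \<le> dim S'"
    using ex_has_least_nat[of ?Q n dim] by blast
  have subS: "subspace S" using S by (simp add: h_stable_def)
  have min_eq: "S' = S" if "?Q S'" "S' \<subseteq> S" for S'
    using min[OF that(1)] that subS by (intro subspace_dim_equal) (auto simp: h_stable_def)
  have kernel: "h_stable {y. \<tau> y = 0}"
    using kernel_subspace[OF lin] by (auto simp: h_stable_def tau_br br.zero_right)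
  let ?S0 = "S \<inter> {y. \<tau> y = 0}"
  let ?C = "{y. \<forall>s\<in>?S0. ip s y = 0}"
  have S0: "h_stable ?S0" using S kernel by (intro h_stable_Int) auto
  have S1: "h_stable (S \<inter> ?C)" using S h_stable_complement[OF S0] by (intro h_stable_Int) auto
  obtain y where y: "y \<in> S" "\<tau> y \<noteq> 0" using S by blast
  have "subspace ?S0" using S0 by (simp add: h_stable_def)
  from ip_decomposition[OF this, of y] obtain s t where st: "s \<in> ?S0" "t \<in> ?C" "y = s + t" by blast
  then have "t \<in> S" using y(1) subspace_diff[OF subS, of y s] by simp
  moreover have "\<tau> t \<noteq> 0" using y(2) st by (simp add: linear_add[OF lin])
  \<comment> \<open>The complement in \<open>S\<close> of the kernel of \<tau> still contains a
    vector that \<tau> does not kill. Minimality makes it all of \<open>S\<close>, so \<tau> is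
    injective on \<open>S\<close>.\<close>
  ultimately have "S \<inter> ?C = S" using S S1 st(2) by (intro min_eq) auto
  then have inj: "v = 0" if "v \<in> S" "\<tau> v = 0" for v
  proof -
    have "v \<in> ?S0" "v \<in> ?C" using that \<open>S \<inter> ?C = S\<close> by auto
    then have "ip v v = 0" by blast
    then show ?thesis by simp
  qed
  have irr: "S' = S" if S': "h_stable S'" "S' \<subseteq> S" "S' \<noteq> {0}" for S'
  proof (rule min_eq)
    have "0 \<in> S'" using S'(1) by (simp add: h_stable_def subspace_0)
    then obtain v where "v \<in> S'" "v \<noteq> 0" using S'(3) by blast
    then show "?Q S'" using S' S inj[of v] by blast
  qed (rule S'(2))
  have "S \<noteq> {0}" using y by (auto simp: linear_0[OF lin])
  from S have "h_stable S" by simp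
  obtain u u' where u: "u \<in> S" "u' \<in> S" "u \<noteq> 0"
    and real: "\<And>H. H \<in> h \<Longrightarrow> \<theta> H = - H \<Longrightarrow> \<exists>l. br H u = l *\<^sub>R u \<and> br H u' = l *\<^sub>R u'"
    and imag: "\<And>H. H \<in> h \<Longrightarrow> \<theta> H = H \<Longrightarrow> \<exists>m. br H u = - (m *\<^sub>R u') \<and> br H u' = m *\<^sub>R u"
    using irreducible_weight_pair[OF \<open>h_stable S\<close> \<open>S \<noteq> {0}\<close> irr] by auto
  have "\<tau> u = 0"
  proof (rule root_spaces_are_lines(1)[of u u' "\<tau> u" "\<tau> u'"])
    show "u \<in> V" using u(1) S nV by blast
    show "\<exists>l. br H u = l *\<^sub>R u \<and> br H u' = l *\<^sub>R u' \<and> br H (\<tau> u) = l *\<^sub>R \<tau> u \<and> br H (\<tau> u') = l *\<^sub>R \<tau> u'"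
      if H: "H \<in> h" "\<theta> H = - H" for H
    proof -
      obtain l where "br H u = l *\<^sub>R u" "br H u' = l *\<^sub>R u'" using real[OF H] by blast
      then show ?thesis using tau_br[OF H(1), symmetric] by (intro exI[of _ l]) (simp add: linear_cmul[OF lin])
    qed
    show "\<exists>m. br H u = - (m *\<^sub>R u') \<and> br H u' = m *\<^sub>R u \<and> br H (\<tau> u) = - (m *\<^sub>R \<tau> u') \<and> br H (\<tau> u') = m *\<^sub>R \<tau> u"
      if H: "H \<in> h" "\<theta> H = H" for H
    proof -
      obtain m where "br H u = - (m *\<^sub>R u')" "br H u' = m *\<^sub>R u" using imag[OF H] by blast
      then show ?thesis using tau_br[OF H(1), symmetric]
        by (intro exI[of _ m]) (simp add: linear_cmul[OF lin] linear_neg[OF lin])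
    qed
    have "u \<in> n" "u' \<in> n" using u S by auto
    then show "ip u (\<tau> u) = 0" "ip u (\<tau> u') = 0" "ip u' (\<tau> u) = 0" "ip u' (\<tau> u') = 0"
      using tau_N by (auto simp: N_def)
  qed (rule u(3))
  then show False using inj u by blast
qed

end

section \<open>The adjoint representation of a Lie group\<close>

context cartan_lie_algebra
begin

lemma expad_list_append: "expad_list (xs @ ys) = expad_list xs * expad_list ys"
  by (simp add: expad_list_def)

lemma W_expad_list: "W es z = expad_list (map (\<lambda>e. (z \<bullet> e) *\<^sub>R e) es)"
  by (induction es) (simp_all add: expad_list_def)

lemma expad_list_inverse: "\<exists>zs. expad_list zs * expad_list ys = 1"
proof (induction ys)
  case Nil
  show ?case by (rule exI[of _ "[]"]) (simp add: expad_list_def)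
next
  case (Cons y ys)
  then obtain zs where zs: "expad_list zs * expad_list ys = 1" by blast
  have "expad_list (zs @ [- y]) * expad_list (y # ys) = expad_list zs * (exp (- ad y) * (exp (ad y) * expad_list ys))"
    by (simp add: expad_list_def ad_linear mult.assoc)
  also have "\<dots> = expad_list zs * ((exp (- ad y) * exp (ad y)) * expad_list ys)"
    by (simp only: mult.assoc)
  finally have "expad_list (zs @ [- y]) * expad_list (y # ys) = expad_list zs * expad_list ys" by simp
  then show ?case using zs by auto
qed

lemma Aut_near_one_expad:
  "\<exists>\<delta>>0. \<forall>a\<in>Aut. norm (a - 1) < \<delta> \<longrightarrow> (\<exists>ys. a = expad_list ys)"
proof -
  obtain es where es: "coordinates (UNIV :: (real^'n) set) es" by (rule coordinates_exist[OF subspace_UNIV])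
  have der: "(W es has_derivative ad) (at 0)"
    using W_derivative_0(1)[OF es linear_ident] by simp
  have cont: "continuous_on UNIV (W es)"
    using continuous_W(1)[OF continuous_on_id] by (simp add: id_def)
  have "\<exists>\<delta>>0. \<forall>a\<in>Aut. norm (a - 1) < \<delta> \<longrightarrow> a \<in> range (W es)"
    by (rule Aut_open_mapping[OF open_UNIV UNIV_I cont W_Aut W_0(1) der]) auto
  then show ?thesis by (auto simp: W_expad_list)
qed

end

locale lie_group_algebra = cartan_lie_algebra br \<theta>
  for br :: "real^'n \<Rightarrow> real^'n \<Rightarrow> real^'n" and \<theta> +
  fixes G :: "('p::{t2_space, second_countable_topology}) monoid"
    and C :: "('p, real^'n) chart set"
    and U :: "'p set" and \<phi> :: "'p \<Rightarrow> real^'n"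
  assumes lie_group: "lie_group G C" and lie_algebra_of: "lie_algebra_of G C (U, \<phi>) br"
begin

sublocale group G
  using lie_group by (simp add: lie_group_def)

lemma carrier_UNIV [simp]: "carrier G = UNIV"
  using lie_group by (simp add: lie_group_def)

lemmas group_simps = m_assoc[simplified] inv_mult_group[simplified] r_inv[simplified] l_inv[simplified]
  inv_inv[simplified] r_one[simplified] l_one[simplified]

lemma cancel [simp]: "inv\<^bsub>G\<^esub> g \<otimes>\<^bsub>G\<^esub> (g \<otimes>\<^bsub>G\<^esub> x) = x" "g \<otimes>\<^bsub>G\<^esub> (inv\<^bsub>G\<^esub> g \<otimes>\<^bsub>G\<^esub> x) = x"
  by (simp_all add: m_assoc[simplified, symmetric])

lemma chart_c: "(U, \<phi>) \<in> C" and one_in_U: "\<one>\<^bsub>G\<^esub> \<in> U"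
  using lie_algebra_of by (auto simp: lie_algebra_of_def)

lemma chart_open: "(V, \<psi>) \<in> C \<Longrightarrow> open V" "(V, \<psi>) \<in> C \<Longrightarrow> open (\<psi> ` V)"
  and chart_homeo: "(V, \<psi>) \<in> C \<Longrightarrow> homeomorphism V (\<psi> ` V) \<psi> (inv_into V \<psi>)"
  using lie_group by (auto simp: lie_group_def smooth_atlas_def)

lemma chart_inv: "(V, \<psi>) \<in> C \<Longrightarrow> x \<in> V \<Longrightarrow> inv_into V \<psi> (\<psi> x) = x"
  using chart_homeo homeomorphism_apply1 by blast

lemma chart_exists: obtains V \<psi> where "(V, \<psi>) \<in> C" "x \<in> V"
proof -
  have "(\<Union>(U, \<phi>)\<in>C. U) = UNIV" using lie_group by (simp add: lie_group_def smooth_atlas_def)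
  then have "x \<in> (\<Union>(U, \<phi>)\<in>C. U)" by simp
  then show ?thesis using that by auto
qed

lemma chart_continuous:
  assumes "(V, \<psi>) \<in> C"
  shows "continuous_on V \<psi>" "continuous_on (\<psi> ` V) (inv_into V \<psi>)"
  using chart_homeo[OF assms] by (auto simp: homeomorphism_def)

lemma chart_isCont:
  assumes "(V, \<psi>) \<in> C" "x \<in> V"
  shows "isCont \<psi> x" "isCont (inv_into V \<psi>) (\<psi> x)"
  using chart_continuous[OF assms(1)] chart_open[OF assms(1)] assms(2)
  by (auto simp: continuous_on_eq_continuous_at)

lemma continuous_mult: "continuous_on UNIV (\<lambda>x. g \<otimes>\<^bsub>G\<^esub> x)" "continuous_on UNIV (\<lambda>x. x \<otimes>\<^bsub>G\<^esub> g)"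
proof -
  have m: "continuous_on UNIV (\<lambda>(x, y). x \<otimes>\<^bsub>G\<^esub> y)" using lie_group by (simp add: lie_group_def)
  have "continuous_on UNIV (\<lambda>x. (g, x))" "continuous_on UNIV (\<lambda>x. (x, g))" by (auto intro!: continuous_intros)
  from continuous_on_compose2[OF m this(1)] continuous_on_compose2[OF m this(2)]
  show "continuous_on UNIV (\<lambda>x. g \<otimes>\<^bsub>G\<^esub> x)" "continuous_on UNIV (\<lambda>x. x \<otimes>\<^bsub>G\<^esub> g)" by simp_all
qed

lemma isCont_conj: "isCont (\<lambda>x. g \<otimes>\<^bsub>G\<^esub> x \<otimes>\<^bsub>G\<^esub> k) x"
proof -
  have "continuous_on UNIV (\<lambda>x. g \<otimes>\<^bsub>G\<^esub> x \<otimes>\<^bsub>G\<^esub> k)"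
    by (rule continuous_on_compose2[OF continuous_mult(2) continuous_mult(1)]) simp
  then show ?thesis by (simp add: continuous_on_eq_continuous_at)
qed

lemma mult_differentiable:
  assumes "(V1, \<psi>1) \<in> C" "(V2, \<psi>2) \<in> C" "(V3, \<psi>3) \<in> C" and "x \<in> V1" "y \<in> V2" "x \<otimes>\<^bsub>G\<^esub> y \<in> V3"
  shows "\<exists>D. ((\<lambda>(s, t). \<psi>3 (inv_into V1 \<psi>1 s \<otimes>\<^bsub>G\<^esub> inv_into V2 \<psi>2 t)) has_derivative D) (at (\<psi>1 x, \<psi>2 y))"
proof -
  let ?S = "{(\<psi>1 x, \<psi>2 y) | x y. x \<in> V1 \<and> y \<in> V2 \<and> x \<otimes>\<^bsub>G\<^esub> y \<in> V3}"
  have "\<forall>(U, \<phi>)\<in>C. \<forall>(V, \<psi>)\<in>C. \<forall>(W, \<xi>)\<in>C.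
        smooth_on {(\<phi> x, \<psi> y) | x y. x \<in> U \<and> y \<in> V \<and> x \<otimes>\<^bsub>G\<^esub> y \<in> W}
          (\<lambda>(s, t). \<xi> (inv_into U \<phi> s \<otimes>\<^bsub>G\<^esub> inv_into V \<psi> t))"
    using lie_group by (simp add: lie_group_def)
  from bspec[OF bspec[OF bspec[OF this assms(1), simplified] assms(2), simplified] assms(3), simplified]
  have "smooth_on ?S (\<lambda>(s, t). \<psi>3 (inv_into V1 \<psi>1 s \<otimes>\<^bsub>G\<^esub> inv_into V2 \<psi>2 t))" .
  then have "Ck_on (Suc 0) ?S (\<lambda>(s, t). \<psi>3 (inv_into V1 \<psi>1 s \<otimes>\<^bsub>G\<^esub> inv_into V2 \<psi>2 t))"
    unfolding smooth_on_def ..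
  then obtain f' where "\<forall>z\<in>?S. ((\<lambda>(s, t). \<psi>3 (inv_into V1 \<psi>1 s \<otimes>\<^bsub>G\<^esub> inv_into V2 \<psi>2 t)) has_derivative f' z) (at z)"
    unfolding Ck_on.simps by blast
  moreover have "(\<psi>1 x, \<psi>2 y) \<in> ?S" using assms(4-6) by blast
  ultimately show ?thesis by blast
qed

lemma has_derivative_transform_nhds:
  assumes "(f has_derivative f') (at x)" "\<forall>\<^sub>F s in nhds x. f s = g s"
  shows "(g has_derivative f') (at x)"
proof (rule has_derivative_transform_eventually[OF assms(1)])
  show "f x = g x" using assms(2) by (rule eventually_nhds_x_imp_x)
  show "\<forall>\<^sub>F s in at x. f s = g s" using assms(2) unfolding eventually_at_filter by (rule eventually_mono) simp
qed simp

definition conj_chart :: "'p \<Rightarrow> real^'n \<Rightarrow> real^'n" where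
  "conj_chart g s = \<phi> (g \<otimes>\<^bsub>G\<^esub> inv_into U \<phi> s \<otimes>\<^bsub>G\<^esub> inv\<^bsub>G\<^esub> g)"

abbreviation "s0 \<equiv> \<phi> \<one>\<^bsub>G\<^esub>"

lemma eventually_conj_in_chart:
  assumes "open V" "g \<otimes>\<^bsub>G\<^esub> k \<in> V"
  shows "\<forall>\<^sub>F s in nhds s0. g \<otimes>\<^bsub>G\<^esub> inv_into U \<phi> s \<otimes>\<^bsub>G\<^esub> k \<in> V"
proof -
  have 1: "isCont (inv_into U \<phi>) s0" by (rule chart_isCont[OF chart_c one_in_U])
  have "isCont (\<lambda>s. g \<otimes>\<^bsub>G\<^esub> inv_into U \<phi> s \<otimes>\<^bsub>G\<^esub> k) s0"
    using isCont_o2[OF 1 isCont_conj] .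
  then have "((\<lambda>s. g \<otimes>\<^bsub>G\<^esub> inv_into U \<phi> s \<otimes>\<^bsub>G\<^esub> k) \<longlongrightarrow> g \<otimes>\<^bsub>G\<^esub> k) (nhds s0)"
    using chart_inv[OF chart_c one_in_U] by (simp add: tendsto_nhds_iff isCont_def group_simps)
  then show ?thesis using assms by (rule topological_tendstoD)
qed

lemma conj_chart_s0: "conj_chart g s0 = s0"
  using chart_inv[OF chart_c one_in_U] by (simp add: conj_chart_def group_simps)

text \<open>Smoothness of the product is given chartwise. So conjugation is factored through a chart
  \<open>V\<close> at \<open>g\<close>: left multiplication leads from \<open>U\<close> to
  \<open>V\<close>, right multiplication by the inverse back to \<open>U\<close>.\<close>

lemma conj_chart_derivative: "(conj_chart g has_derivative Ad G (U, \<phi>) g) (at s0)"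
proof -
  obtain V \<psi> where V: "(V, \<psi>) \<in> C" "g \<in> V" by (rule chart_exists)
  obtain V' \<psi>' where V': "(V', \<psi>') \<in> C" "inv\<^bsub>G\<^esub> g \<in> V'" by (rule chart_exists)
  let ?L = "\<lambda>s. \<psi> (g \<otimes>\<^bsub>G\<^esub> inv_into U \<phi> s)"
  let ?R = "\<lambda>s. \<phi> (inv_into V \<psi> s \<otimes>\<^bsub>G\<^esub> inv\<^bsub>G\<^esub> g)"
  obtain D where D: "((\<lambda>(s, t). \<psi> (inv_into V \<psi> s \<otimes>\<^bsub>G\<^esub> inv_into U \<phi> t)) has_derivative D) (at (\<psi> g, s0))"
    using mult_differentiable[OF V(1) chart_c V(1) V(2) one_in_U] V(2) by (auto simp: group_simps)
  have "((\<lambda>t. (\<psi> g, t)) has_derivative (\<lambda>t. (0, t))) (at s0)"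
    by (intro derivative_intros)
  from diff_chain_at[OF this D]
  have L: "(?L has_derivative (D \<circ> (\<lambda>t. (0, t)))) (at s0)"
    by (simp add: o_def chart_inv[OF V])
  obtain D' where D': "((\<lambda>(s, t). \<phi> (inv_into V \<psi> s \<otimes>\<^bsub>G\<^esub> inv_into V' \<psi>' t)) has_derivative D') (at (\<psi> g, \<psi>' (inv\<^bsub>G\<^esub> g)))"
    using mult_differentiable[OF V(1) V'(1) chart_c V(2) V'(2)] one_in_U by (auto simp: group_simps)
  have "((\<lambda>s. (s, \<psi>' (inv\<^bsub>G\<^esub> g))) has_derivative (\<lambda>s. (s, 0))) (at (\<psi> g))"
    by (intro derivative_intros)
  from diff_chain_at[OF this D']
  have R: "(?R has_derivative (D' \<circ> (\<lambda>s. (s, 0)))) (at (\<psi> g))"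
    by (simp add: o_def chart_inv[OF V'])
  have "?L s0 = \<psi> g" using chart_inv[OF chart_c one_in_U] by (simp add: group_simps)
  with diff_chain_at[OF L] R have "(?R \<circ> ?L has_derivative (D' \<circ> (\<lambda>s. (s, 0))) \<circ> (D \<circ> (\<lambda>t. (0, t)))) (at s0)"
    by simp
  moreover have "\<forall>\<^sub>F s in nhds s0. g \<otimes>\<^bsub>G\<^esub> inv_into U \<phi> s \<in> V"
    using eventually_conj_in_chart[OF chart_open(1)[OF V(1)], of g "\<one>\<^bsub>G\<^esub>"] V(2) by (simp add: group_simps)
  then have "\<forall>\<^sub>F s in nhds s0. (?R \<circ> ?L) s = conj_chart g s"
    by eventually_elim (simp add: conj_chart_def chart_inv[OF V(1)])
  ultimately have "(conj_chart g has_derivative (D' \<circ> (\<lambda>s. (s, 0))) \<circ> (D \<circ> (\<lambda>t. (0, t)))) (at s0)"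
    by (rule has_derivative_transform_nhds)
  then have "conj_chart g differentiable (at s0)" by (auto simp: differentiable_def)
  then show ?thesis
    unfolding frechet_derivative_works Ad_def conj_chart_def by (simp add: conj_chart_def[abs_def])
qed

lemma linear_Ad: "linear (Ad G (U, \<phi>) g)"
  using conj_chart_derivative has_derivative_linear by blast

lemma derivative_unique_nhds:
  assumes "(f has_derivative f') (at s0)" "(g has_derivative g') (at s0)" "\<forall>\<^sub>F s in nhds s0. f s = g s"
  shows "f' = g'"
proof -
  have "(g has_derivative f') (at s0)"
    by (rule has_derivative_transform_nhds[OF assms(1,3)])
  then show ?thesis using assms(2) by (rule has_derivative_unique)
qed

lemma Ad_mult: "Ad G (U, \<phi>) (g \<otimes>\<^bsub>G\<^esub> k) = Ad G (U, \<phi>) g \<circ> Ad G (U, \<phi>) k"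
proof (rule derivative_unique_nhds[OF conj_chart_derivative])
  have "(conj_chart g has_derivative Ad G (U, \<phi>) g) (at (conj_chart k s0))"
    unfolding conj_chart_s0 by (rule conj_chart_derivative)
  from diff_chain_at[OF conj_chart_derivative this]
  show "(conj_chart g \<circ> conj_chart k has_derivative Ad G (U, \<phi>) g \<circ> Ad G (U, \<phi>) k) (at s0)" .
  have "\<forall>\<^sub>F s in nhds s0. k \<otimes>\<^bsub>G\<^esub> inv_into U \<phi> s \<otimes>\<^bsub>G\<^esub> inv\<^bsub>G\<^esub> k \<in> U"
    using eventually_conj_in_chart[OF chart_open(1)[OF chart_c], of k "inv\<^bsub>G\<^esub> k"] one_in_U by (simp add: group_simps)
  then show "\<forall>\<^sub>F s in nhds s0. conj_chart (g \<otimes>\<^bsub>G\<^esub> k) s = (conj_chart g \<circ> conj_chart k) s"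
    by eventually_elim (simp add: conj_chart_def chart_inv[OF chart_c] group_simps)
qed

lemma Ad_one: "Ad G (U, \<phi>) \<one>\<^bsub>G\<^esub> = id"
proof (rule derivative_unique_nhds[OF conj_chart_derivative])
  show "(id has_derivative id) (at s0)" by (simp add: id_def)
  have "\<forall>\<^sub>F s in nhds s0. s \<in> \<phi> ` U"
    using chart_open(2)[OF chart_c] one_in_U by (intro eventually_nhds_in_open) auto
  then show "\<forall>\<^sub>F s in nhds s0. conj_chart \<one>\<^bsub>G\<^esub> s = id s"
    by eventually_elim (auto simp: conj_chart_def group_simps f_inv_into_f inv_one[simplified])
qed

lemma Ad_derivative: "((\<lambda>s. Ad G (U, \<phi>) (inv_into U \<phi> s) v) has_derivative (\<lambda>u. br u v)) (at s0)"
  using lie_algebra_of by (simp add: lie_algebra_of_def)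

text \<open>Differentiate Ad(g k g^-1) (Ad(g) v) = Ad(g) (Ad(k) v) with respect to \<open>k\<close>
  at the identity.\<close>

lemma Ad_br: "Ad G (U, \<phi>) g (br u v) = br (Ad G (U, \<phi>) g u) (Ad G (U, \<phi>) g v)"
proof -
  let ?w = "Ad G (U, \<phi>) g v"
  let ?F = "\<lambda>v s. Ad G (U, \<phi>) (inv_into U \<phi> s) v"
  have inv: "Ad G (U, \<phi>) (inv\<^bsub>G\<^esub> g) ?w = v"
    using Ad_mult[of "inv\<^bsub>G\<^esub> g" g] by (simp add: group_simps Ad_one fun_eq_iff)
  have "(?F ?w has_derivative (\<lambda>u. br u ?w)) (at (conj_chart g s0))"
    unfolding conj_chart_s0 by (rule Ad_derivative)
  from diff_chain_at[OF conj_chart_derivative this]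
  have 1: "(?F ?w \<circ> conj_chart g has_derivative (\<lambda>u. br u ?w) \<circ> Ad G (U, \<phi>) g) (at s0)" .
  have "bounded_linear (Ad G (U, \<phi>) g)" using linear_Ad by (simp add: linear_conv_bounded_linear)
  from bounded_linear.has_derivative[OF this Ad_derivative]
  have 2: "((\<lambda>s. Ad G (U, \<phi>) g (?F v s)) has_derivative (\<lambda>u. Ad G (U, \<phi>) g (br u v))) (at s0)" .
  have "\<forall>\<^sub>F s in nhds s0. g \<otimes>\<^bsub>G\<^esub> inv_into U \<phi> s \<otimes>\<^bsub>G\<^esub> inv\<^bsub>G\<^esub> g \<in> U"
    using eventually_conj_in_chart[OF chart_open(1)[OF chart_c], of g "inv\<^bsub>G\<^esub> g"] one_in_U by (simp add: group_simps)
  then have "\<forall>\<^sub>F s in nhds s0. (?F ?w \<circ> conj_chart g) s = Ad G (U, \<phi>) g (?F v s)"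
    by eventually_elim (simp add: conj_chart_def chart_inv[OF chart_c] Ad_mult inv)
  from derivative_unique_nhds[OF 1 2 this] show ?thesis by (simp add: fun_eq_iff)
qed

definition AdE :: "'p \<Rightarrow> (real^'n) endo" where
  "AdE g = endo (Ad G (U, \<phi>) g)"

lemma app_AdE: "app (AdE g) = Ad G (U, \<phi>) g"
  by (simp add: AdE_def app_endo linear_Ad)

lemma AdE_mult: "AdE (g \<otimes>\<^bsub>G\<^esub> k) = AdE g * AdE k"
  by (rule endo_eqI) (simp add: app_AdE Ad_mult)

lemma AdE_one: "AdE \<one>\<^bsub>G\<^esub> = 1"
  by (rule endo_eqI) (simp add: app_AdE Ad_one)

lemma AdE_inv: "AdE g * AdE (inv\<^bsub>G\<^esub> g) = 1" "AdE (inv\<^bsub>G\<^esub> g) * AdE g = 1"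
  by (simp_all add: AdE_mult[symmetric] group_simps AdE_one)

lemma AdE_Aut: "AdE g \<in> Aut"
  unfolding Aut_def using AdE_inv[of g] by (auto simp: app_AdE Ad_br)

lemma AdE_chart_derivative: "((\<lambda>s. AdE (inv_into U \<phi> s)) has_derivative ad) (at s0)"
  by (rule has_derivative_endo) (simp add: app_AdE Ad_derivative)

lemma AdE_isCont_one: "isCont AdE \<one>\<^bsub>G\<^esub>"
proof -
  have "isCont (\<lambda>s. AdE (inv_into U \<phi> s)) s0"
    using AdE_chart_derivative has_derivative_continuous by blast
  from isCont_o2[OF chart_isCont(1)[OF chart_c one_in_U] this]
  have "isCont (\<lambda>x. AdE (inv_into U \<phi> (\<phi> x))) \<one>\<^bsub>G\<^esub>" .
  moreover have "\<forall>\<^sub>F x in nhds \<one>\<^bsub>G\<^esub>. x \<in> U"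
    using chart_open(1)[OF chart_c] one_in_U by (rule eventually_nhds_in_open)
  then have "\<forall>\<^sub>F x in nhds \<one>\<^bsub>G\<^esub>. AdE (inv_into U \<phi> (\<phi> x)) = AdE x"
    by eventually_elim (simp add: chart_inv[OF chart_c])
  from isCont_cong[OF this] have "isCont (\<lambda>x. AdE (inv_into U \<phi> (\<phi> x))) \<one>\<^bsub>G\<^esub> = isCont AdE \<one>\<^bsub>G\<^esub>" .
  ultimately show ?thesis by simp
qed

lemma continuous_AdE: "continuous_on UNIV AdE"
proof -
  have "isCont AdE g" for g
  proof -
    have "isCont (\<lambda>x. inv\<^bsub>G\<^esub> g \<otimes>\<^bsub>G\<^esub> x) g"
      using continuous_mult(1) by (simp add: continuous_on_eq_continuous_at)
    moreover have "isCont AdE (inv\<^bsub>G\<^esub> g \<otimes>\<^bsub>G\<^esub> g)" using AdE_isCont_one by (simp add: group_simps)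
    ultimately have "isCont (\<lambda>x. AdE (inv\<^bsub>G\<^esub> g \<otimes>\<^bsub>G\<^esub> x)) g" by (rule isCont_o2)
    then have "isCont (\<lambda>x. AdE g * AdE (inv\<^bsub>G\<^esub> g \<otimes>\<^bsub>G\<^esub> x)) g" by (intro continuous_intros)
    then show ?thesis by (simp add: AdE_mult mult.assoc[symmetric] AdE_inv)
  qed
  then show ?thesis by (simp add: continuous_on_eq_continuous_at)
qed

text \<open>\<open>Ad\<close> is open at the identity, as a map to \<open>Aut\<close>: in a chart
  its derivative there is \<open>ad\<close>, and \<open>pr\<close> inverts \<open>ad\<close> from
  the left.\<close>

lemma AdE_open:
  assumes N: "open N" "\<one>\<^bsub>G\<^esub> \<in> N"
  shows "\<exists>\<delta>>0. \<forall>a\<in>Aut. norm (a - 1) < \<delta> \<longrightarrow> a \<in> AdE ` N"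
proof -
  let ?S = "\<phi> ` (U \<inter> N)"
  have S: "open ?S"
  proof -
    have "openin (top_of_set (\<phi> ` U)) ?S"
      using homeomorphism_imp_open_map[OF chart_homeo[OF chart_c]] N(1) by (simp add: openin_open_Int)
    then show ?thesis using chart_open(2)[OF chart_c] openin_open_trans by blast
  qed
  have "continuous_on ?S (inv_into U \<phi>)"
    using chart_continuous(2)[OF chart_c] by (rule continuous_on_subset) auto
  then have cont: "continuous_on ?S (\<lambda>s. AdE (inv_into U \<phi> s))"
    by (rule continuous_on_compose2[OF continuous_AdE]) simp
  have s0: "s0 \<in> ?S" using one_in_U N by auto
  have 0: "AdE (inv_into U \<phi> s0) = 1" by (simp add: chart_inv[OF chart_c one_in_U] AdE_one)
  have "\<exists>\<delta>>0. \<forall>a\<in>Aut. norm (a - 1) < \<delta> \<longrightarrow> a \<in> (\<lambda>s. AdE (inv_into U \<phi> s)) ` ?S"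
    by (rule Aut_open_mapping[OF S s0 cont AdE_Aut 0 AdE_chart_derivative]) auto
  then obtain \<delta> where \<delta>: "\<delta> > 0" "\<forall>a\<in>Aut. norm (a - 1) < \<delta> \<longrightarrow> a \<in> (\<lambda>s. AdE (inv_into U \<phi> s)) ` ?S"
    by (elim exE conjE)
  have sub: "(\<lambda>s. AdE (inv_into U \<phi> s)) ` ?S \<subseteq> AdE ` N"
    by (auto simp: chart_inv[OF chart_c])
  show ?thesis
    using \<delta> subsetD[OF sub] by (intro exI[of _ \<delta>] conjI ballI impI) simp_all
qed

text \<open>Connectedness of \<open>G\<close> enters here. The elements \<open>g\<close> whose
  \<open>AdE g\<close> is a product of exponentials form a subgroup containing a neighbourhood of
  the identity; such a subgroup is open and closed.\<close>

lemma AdE_expad_list: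
  assumes conn: "connected (UNIV :: 'p set)"
  shows "\<exists>ys. AdE g = expad_list ys"
proof -
  define H where "H = {g. \<exists>ys. AdE g = expad_list ys}"
  obtain \<delta> where \<delta>: "\<delta> > 0" "\<And>a. a \<in> Aut \<Longrightarrow> norm (a - 1) < \<delta> \<Longrightarrow> \<exists>ys. a = expad_list ys"
    using Aut_near_one_expad by auto
  define N where "N = AdE -` ball 1 \<delta>"
  have N: "open N" unfolding N_def using continuous_AdE by (rule open_vimage[OF open_ball])
  have one: "\<one>\<^bsub>G\<^esub> \<in> N" using \<delta>(1) by (simp add: N_def AdE_one)
  have NH: "n \<in> H" if "n \<in> N" for n
    using that \<delta>(2)[OF AdE_Aut] by (simp add: N_def H_def dist_norm norm_minus_commute)
  have mult: "x \<otimes>\<^bsub>G\<^esub> y \<in> H" if "x \<in> H" "y \<in> H" for x y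
    using that by (auto simp: H_def AdE_mult expad_list_append[symmetric])
  have inverse: "inv\<^bsub>G\<^esub> x \<in> H" if "x \<in> H" for x
  proof -
    obtain ys where ys: "AdE x = expad_list ys" using \<open>x \<in> H\<close> by (auto simp: H_def)
    obtain zs where "expad_list zs * AdE x = 1" using expad_list_inverse[of ys] ys by auto
    then have "expad_list zs * (AdE x * AdE (inv\<^bsub>G\<^esub> x)) = AdE (inv\<^bsub>G\<^esub> x)" by (simp add: mult.assoc[symmetric])
    then have "expad_list zs = AdE (inv\<^bsub>G\<^esub> x)" by (simp add: AdE_inv)
    then show ?thesis unfolding H_def by (intro CollectI exI[of _ zs]) (rule sym)
  qed
  have nbhd: "\<exists>T. open T \<and> x \<in> T \<and> T \<subseteq> {y. inv\<^bsub>G\<^esub> x \<otimes>\<^bsub>G\<^esub> y \<in> N}" for x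
    using open_vimage[OF N continuous_mult(1)[of "inv\<^bsub>G\<^esub> x"]] one
    by (intro exI[of _ "(\<lambda>y. inv\<^bsub>G\<^esub> x \<otimes>\<^bsub>G\<^esub> y) -` N"]) (auto simp: group_simps)
  have "open H"
  proof (subst open_subopen, intro ballI)
    fix x assume x: "x \<in> H"
    have "y \<in> H" if "inv\<^bsub>G\<^esub> x \<otimes>\<^bsub>G\<^esub> y \<in> N" for y
      using mult[OF x NH[OF that]] by simp
    then show "\<exists>T. open T \<and> x \<in> T \<and> T \<subseteq> H" using nbhd[of x] by blast
  qed
  moreover have "open (- H)"
  proof (subst open_subopen, intro ballI)
    fix x assume x: "x \<in> - H"
    have "y \<in> - H" if y: "inv\<^bsub>G\<^esub> x \<otimes>\<^bsub>G\<^esub> y \<in> N" for y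
    proof
      assume "y \<in> H"
      then have "y \<otimes>\<^bsub>G\<^esub> inv\<^bsub>G\<^esub> (inv\<^bsub>G\<^esub> x \<otimes>\<^bsub>G\<^esub> y) \<in> H" using mult inverse NH[OF y] by blast
      then show False using x by (simp add: group_simps)
    qed
    then show "\<exists>T. open T \<and> x \<in> T \<and> T \<subseteq> - H" using nbhd[of x] by blast
  qed
  moreover have "\<one>\<^bsub>G\<^esub> \<in> H" using NH one by blast
  ultimately have "H = UNIV"
    using connectedD[OF conn, of H "- H"] by auto
  then show ?thesis by (auto simp: H_def)
qed

end

section \<open>The orbit topology\<close>

lemma expfun_locally_injective:
  fixes f :: "'e::euclidean_space \<Rightarrow> 'e"
  assumes f: "expfun f" and D: "(f has_derivative D) (at 0)" and inj: "\<And>v. D v = 0 \<Longrightarrow> v = 0"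
  shows "\<exists>r>0. inj_on f (ball 0 r) \<and> (\<forall>z\<in>ball 0 r. \<forall>D'. (f has_derivative D') (at z) \<longrightarrow> inj D')"
proof -
  obtain f' where f': "\<And>z. (f has_derivative f' z) (at z)" "\<And>v. expfun (\<lambda>z. f' z v)"
    using expfun_derivative[OF f] by auto
  have "D = f' 0" using D f'(1) by (rule has_derivative_unique)
  then have inj0: "v = 0" if "f' 0 v = 0" for v using inj that by simp
  have uniq: "D' = f' z" if "(f has_derivative D') (at z)" for D' z
    using that f'(1) by (rule has_derivative_unique)
  show ?thesis
  proof (rule C1_locally_injective[OF f'(1) expfun_continuous[OF f'(2)] inj0])
    fix r :: real
    assume r: "r > 0" "inj_on f (ball 0 r)" "\<And>z. z \<in> ball 0 r \<Longrightarrow> inj (f' z)"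
    have "inj D'" if "z \<in> ball 0 r" "(f has_derivative D') (at z)" for z D'
      unfolding uniq[OF that(2)] by (rule r(3)[OF that(1)])
    with r(1,2) show ?thesis by (intro exI[of _ r] conjI ballI allI impI)
  qed
qed

context cartan_lie_algebra
begin

abbreviation dW :: "(real^'n) list \<Rightarrow> real^'n \<Rightarrow> real^'n \<Rightarrow> (real^'n) endo" where
  "dW es \<equiv> expdiff (map (\<lambda>e. (e, ad e)) es)"

lemma W_derivative:
  assumes "linear (p :: real^'n \<Rightarrow> real^'n)"
  shows "((\<lambda>z. W es (p z)) has_derivative (\<lambda>v. dW es (p z) (p v))) (at z)"
  using diff_chain_at[OF linear_imp_has_derivative[OF assms] expprod_derivative]
  unfolding W_def o_def .

lemma dW_0: "coordinates S es \<Longrightarrow> v \<in> S \<Longrightarrow> dW es 0 v = ad v"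
  by (simp add: expdiff_ad_0 coordinates_def)

lemma expfun_W:
  "bounded_linear L \<Longrightarrow> expfun f \<Longrightarrow> expfun (\<lambda>z. app (W es (L z)) (f z))"
  unfolding W_def by (rule expfun_expprod)

lemma app_W_derivative_0:
  assumes es: "coordinates S es" and p: "linear p" and pS: "\<And>z. p z \<in> S"
    and f: "(f has_derivative f') (at (0 :: real^'n))"
  shows "((\<lambda>z. app (W es (p z)) (f z)) has_derivative (\<lambda>v. f' v + br (p v) (f 0))) (at 0)"
  using app.FDERIV[OF W_derivative_0(1)[OF es p pS] f] by (simp add: linear_0[OF p])

text \<open>The logarithmic derivative of a product of exponentials of a subalgebra stays in the
  subalgebra: peeling off the first factor adds a multiple of \<open>e\<close> and transforms the
  rest by an exponential of \<open>ad e\<close>, which preserves \<open>n\<close>.\<close>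

lemma W_orbit_tangent:
  assumes n: "subspace n" "\<And>x y. x \<in> n \<Longrightarrow> y \<in> n \<Longrightarrow> br x y \<in> n" and es: "set es \<subseteq> n"
  shows "\<exists>w\<in>n. app (dW es y u) x = br w (app (W es y) x)"
  using es
proof (induction es)
  case Nil
  show ?case using subspace_0[OF n(1)] by (intro bexI[of _ 0]) (auto simp: app.zero_left br.zero_left)
next
  case (Cons e es)
  let ?E = "exp (ad ((y \<bullet> e) *\<^sub>R e))"
  obtain w where w: "w \<in> n" "app (dW es y u) x = br w (app (W es y) x)" using Cons by auto
  have e: "e \<in> n" using Cons.prems by simp
  have "app ?E w \<in> n"
    using e n by (intro exp_subspace[OF n(1) _ w(1)]) (auto simp: br.scaleR_left subspace_scale)
  then have wn: "(u \<bullet> e) *\<^sub>R e + app ?E w \<in> n"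
    using e n(1) by (simp add: subspace_add subspace_scale)
  have "app (dW (e # es) y u) x = (u \<bullet> e) *\<^sub>R br e (app (W (e # es) y) x) + app ?E (app (dW es y u) x)"
    by (simp add: app.add_left app.scaleR_left W_def ad_linear)
  also have "app ?E (app (dW es y u) x) = br (app ?E w) (app (W (e # es) y) x)"
    by (simp add: w(2) Aut_br[OF Aut_exp_ad])
  finally have "app (dW (e # es) y u) x = br ((u \<bullet> e) *\<^sub>R e + app ?E w) (app (W (e # es) y) x)"
    by (simp add: br.add_left br.scaleR_left)
  then show ?case using wn by (rule bexI)
qed

end

context lie_group_algebra
begin

definition AdG :: "(real^'n) endo set" where "AdG = range AdE"

lemma AdG_Aut: "A \<in> AdG \<Longrightarrow> A \<in> Aut"
  using AdE_Aut by (auto simp: AdG_def)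

lemma AdG_mult: "A \<in> AdG \<Longrightarrow> A' \<in> AdG \<Longrightarrow> A * A' \<in> AdG"
  by (auto simp: AdG_def AdE_mult[symmetric])

lemma AdG_one [simp]: "1 \<in> AdG"
  unfolding AdG_def by (rule range_eqI[of _ _ "\<one>\<^bsub>G\<^esub>"]) (simp add: AdE_one)

lemma AdG_inverse: "A \<in> AdG \<Longrightarrow> \<exists>A'\<in>AdG. A * A' = 1 \<and> A' * A = 1"
  using AdE_inv by (auto simp: AdG_def)

text \<open>\<open>Ad\<close> covers a neighbourhood of 1 in \<open>Aut\<close>, so the exponential
  of \<open>ad\<close> of \<open>(1/2)^k *\<^sub>R y\<close> is attained for large \<open>k\<close>.
  Squaring \<open>k\<close> times gives the exponential of \<open>ad y\<close>.\<close>

lemma exp_ad_AdG: "exp (ad y) \<in> AdG"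
proof -
  have dbl: "exp (ad y) \<in> AdG" if "exp (ad ((1/2)^k *\<^sub>R y)) \<in> AdG" for k y
    using that
  proof (induction k arbitrary: y)
    case (Suc k)
    have "exp (ad ((1/2) *\<^sub>R y)) \<in> AdG" by (rule Suc.IH) (use Suc.prems in \<open>simp add: mult.commute\<close>)
    moreover have "exp (ad ((1/2) *\<^sub>R y)) * exp (ad ((1/2) *\<^sub>R y)) = exp (ad y)"
      by (subst exp_add_commuting[symmetric]) (auto simp: ad_linear(1)[symmetric] scaleR_add_left[symmetric])
    ultimately show ?case using AdG_mult by metis
  qed simp
  obtain \<delta> where \<delta>: "\<delta> > 0" "\<And>a. a \<in> Aut \<Longrightarrow> norm (a - 1) < \<delta> \<Longrightarrow> \<exists>u\<in>UNIV. a = AdE u"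
    using AdE_open[OF open_UNIV UNIV_I] by auto
  have "continuous_on UNIV (\<lambda>t. exp (t *\<^sub>R ad y))"
    by (rule has_derivative_continuous_on[OF exp_has_derivative[OF bounded_linear_ident]])
  then have "isCont (\<lambda>t. exp (t *\<^sub>R ad y)) 0" by (simp add: continuous_on_eq_continuous_at)
  moreover have "(\<lambda>k. (1/2::real)^k) \<longlonglongrightarrow> 0" by (rule LIMSEQ_power_zero) simp
  ultimately have "(\<lambda>k. exp ((1/2)^k *\<^sub>R ad y)) \<longlonglongrightarrow> exp (0 *\<^sub>R ad y)"
    by (rule isCont_tendsto_compose)
  then have "\<forall>\<^sub>F k in sequentially. dist (exp ((1/2)^k *\<^sub>R ad y)) (exp (0 *\<^sub>R ad y)) < \<delta>"
    using \<delta>(1) by (rule tendstoD)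
  then obtain k where "dist (exp ((1/2)^k *\<^sub>R ad y)) (exp (0 *\<^sub>R ad y)) < \<delta>"
    using eventually_happens' sequentially_bot by blast
  then have "norm (exp (ad ((1/2)^k *\<^sub>R y)) - 1) < \<delta>" by (simp add: dist_norm ad_linear)
  then have "exp (ad ((1/2)^k *\<^sub>R y)) \<in> AdG" using \<delta>(2)[OF Aut_exp_ad] by (auto simp: AdG_def)
  then show ?thesis by (rule dbl)
qed

lemma W_AdG: "W es z \<in> AdG"
  by (induction es) (auto intro: AdG_mult exp_ad_AdG)

lemma Ad_orbit_eq: "Ad_orbit G (U, \<phi>) x = (\<lambda>A. app A x) ` AdG"
  unfolding Ad_orbit_def AdG_def image_image app_AdE ..

lemma openin_orbit_topology:
  "openin (orbit_topology G (U, \<phi>) x) Y \<longleftrightarrow> Y \<subseteq> Ad_orbit G (U, \<phi>) x \<and> open {g. app (AdE g) x \<in> Y}"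
proof -
  have "istopology (\<lambda>Y. Y \<subseteq> Ad_orbit G (U, \<phi>) x \<and> open {g. app (AdE g) x \<in> Y})"
    unfolding istopology_def
  proof (intro conjI allI impI)
    fix S T assume "S \<subseteq> Ad_orbit G (U, \<phi>) x \<and> open {g. app (AdE g) x \<in> S}"
      "T \<subseteq> Ad_orbit G (U, \<phi>) x \<and> open {g. app (AdE g) x \<in> T}"
    moreover have "{g. app (AdE g) x \<in> S \<inter> T} = {g. app (AdE g) x \<in> S} \<inter> {g. app (AdE g) x \<in> T}" by auto
    ultimately show "S \<inter> T \<subseteq> Ad_orbit G (U, \<phi>) x" "open {g. app (AdE g) x \<in> S \<inter> T}" by auto
  next
    fix K assume K: "\<forall>S\<in>K. S \<subseteq> Ad_orbit G (U, \<phi>) x \<and> open {g. app (AdE g) x \<in> S}"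
    then show "\<Union>K \<subseteq> Ad_orbit G (U, \<phi>) x" by blast
    have "{g. app (AdE g) x \<in> \<Union>K} = (\<Union>S\<in>K. {g. app (AdE g) x \<in> S})" by auto
    then show "open {g. app (AdE g) x \<in> \<Union>K}" using K by auto
  qed
  then show ?thesis
    unfolding orbit_topology_def by (simp add: topology_inverse' app_AdE)
qed

text \<open>With \<open>openin_orbitI\<close> this expresses the quotient topology in the operator
  norm: a subset of the orbit is open if and only if, around each of its points
  \<open>app A x\<close>, it contains \<open>app A (app a x)\<close> for all automorphisms
  \<open>a\<close> near 1. This half rests on \<open>Ad\<close> being open, the other on its
  continuity.\<close>

lemma openin_orbitD:
  assumes Y: "openin (orbit_topology G (U, \<phi>) x) Y" and A: "A \<in> AdG" "app A x \<in> Y"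
  obtains \<delta> where "\<delta> > 0" "\<And>a. a \<in> Aut \<Longrightarrow> norm (a - 1) < \<delta> \<Longrightarrow> app A (app a x) \<in> Y"
proof -
  obtain g where g: "A = AdE g" using A(1) by (auto simp: AdG_def)
  let ?N = "(\<lambda>u. g \<otimes>\<^bsub>G\<^esub> u) -` {g. app (AdE g) x \<in> Y}"
  have "open ?N" using Y unfolding openin_orbit_topology by (intro open_vimage continuous_mult) simp
  moreover have "\<one>\<^bsub>G\<^esub> \<in> ?N" using A(2) by (simp add: g group_simps)
  ultimately obtain \<delta> where \<delta>: "\<delta> > 0" "\<And>a. a \<in> Aut \<Longrightarrow> norm (a - 1) < \<delta> \<Longrightarrow> \<exists>u\<in>?N. a = AdE u"
    using AdE_open[of ?N] by auto
  have "app A (app a x) \<in> Y" if "a \<in> Aut" "norm (a - 1) < \<delta>" for a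
    using \<delta>(2)[OF that] by (auto simp: g AdE_mult)
  with \<delta>(1) show ?thesis by (rule that)
qed

lemma openin_orbitI:
  assumes Y: "Y \<subseteq> Ad_orbit G (U, \<phi>) x"
    and nbhd: "\<And>A. A \<in> AdG \<Longrightarrow> app A x \<in> Y \<Longrightarrow>
      \<exists>\<delta>>0. \<forall>a\<in>Aut. norm (a - 1) < \<delta> \<longrightarrow> app A (app a x) \<in> Y"
  shows "openin (orbit_topology G (U, \<phi>) x) Y"
  unfolding openin_orbit_topology
proof (intro conjI Y, subst open_subopen, intro ballI)
  fix g assume "g \<in> {g. app (AdE g) x \<in> Y}"
  then obtain \<delta> where \<delta>: "\<delta> > 0" "\<And>a. a \<in> Aut \<Longrightarrow> norm (a - 1) < \<delta> \<Longrightarrow> app (AdE g) (app a x) \<in> Y"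
    using nbhd[of "AdE g"] by (auto simp: AdG_def)
  let ?N = "(\<lambda>k. AdE (inv\<^bsub>G\<^esub> g \<otimes>\<^bsub>G\<^esub> k)) -` ball 1 \<delta>"
  have "continuous_on UNIV (\<lambda>k. AdE (inv\<^bsub>G\<^esub> g \<otimes>\<^bsub>G\<^esub> k))"
    by (rule continuous_on_compose2[OF continuous_AdE continuous_mult(1)]) simp
  then have "open ?N" by (rule open_vimage[OF open_ball])
  moreover have "g \<in> ?N" using \<delta>(1) by (simp add: group_simps AdE_one)
  moreover have "?N \<subseteq> {g. app (AdE g) x \<in> Y}"
  proof
    fix k assume k: "k \<in> ?N"
    have "app (AdE g) (app (AdE (inv\<^bsub>G\<^esub> g \<otimes>\<^bsub>G\<^esub> k)) x) \<in> Y"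
      using k by (intro \<delta>(2) AdE_Aut) (simp add: dist_norm norm_minus_commute)
    then show "k \<in> {g. app (AdE g) x \<in> Y}" by (simp flip: app_mult AdE_mult)
  qed
  ultimately show "\<exists>T. open T \<and> g \<in> T \<and> T \<subseteq> {g. app (AdE g) x \<in> Y}" by (intro exI[of _ ?N]) simp
qed

lemma topspace_orbit: "topspace (orbit_topology G (U, \<phi>) x) = Ad_orbit G (U, \<phi>) x"
proof -
  have "openin (orbit_topology G (U, \<phi>) x) (Ad_orbit G (U, \<phi>) x)"
    unfolding openin_orbit_topology by (simp add: Ad_orbit_eq AdG_def)
  then show ?thesis
    using openin_subset[of "orbit_topology G (U, \<phi>) x"] openin_topspace[of "orbit_topology G (U, \<phi>) x"]
    unfolding openin_orbit_topology by blast
qed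

end

section \<open>Foliated charts\<close>

locale foliated_orbit = lie_group_algebra br \<theta> G C U \<phi> + regular_cartan br \<theta> h X
  for br :: "real^'n \<Rightarrow> real^'n \<Rightarrow> real^'n" and \<theta>
    and G :: "('p::{t2_space, second_countable_topology}) monoid" and C U \<phi> h X +
  fixes n :: "(real^'n) set"
  assumes conn: "connected (UNIV :: 'p set)"
    and n_closed: "\<And>x y. x \<in> n \<Longrightarrow> y \<in> n \<Longrightarrow> br x y \<in> n"
    and n_stable: "h_stable n"
    and n_h: "n \<inter> h \<subseteq> {0}"
begin

lemma subspace_n: "subspace n"
  using n_stable by (simp add: h_stable_def)

lemma n_V: "x \<in> n \<Longrightarrow> x \<in> V"
  using h_stable_subset_V[OF n_stable n_h] by blast

lemma br_h_n: "H \<in> h \<Longrightarrow> x \<in> n \<Longrightarrow> br H x \<in> n" "H \<in> h \<Longrightarrow> x \<in> n \<Longrightarrow> br x H \<in> n"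
proof -
  show 1: "br H x \<in> n" if "H \<in> h" "x \<in> n" for H x using n_stable that by (simp add: h_stable_def)
  show "br x H \<in> n" if "H \<in> h" "x \<in> n"
    using subspace_neg[OF subspace_n 1[OF that]] br_anti[of x H] by simp
qed

definition b :: "(real^'n) set" where "b = {x + y | x y. x \<in> n \<and> y \<in> h}"

lemma bI: "x \<in> n \<Longrightarrow> y \<in> h \<Longrightarrow> x + y \<in> b"
  by (auto simp: b_def)

lemma bE: assumes "z \<in> b" obtains x y where "x \<in> n" "y \<in> h" "z = x + y"
  using assms by (auto simp: b_def)

lemma subspace_b: "subspace b"
  unfolding b_def by (rule subspace_sums[OF subspace_n subspace_h])

lemma n_b: "x \<in> n \<Longrightarrow> x \<in> b" and h_b: "x \<in> h \<Longrightarrow> x \<in> b"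
  using bI[of x 0] bI[of 0 x] subspace_0[OF subspace_n] subspace_0[OF subspace_h] by auto

lemma br_b: assumes "x \<in> b" "y \<in> b" shows "br x y \<in> n"
proof -
  obtain x1 x2 where x: "x1 \<in> n" "x2 \<in> h" "x = x1 + x2" using assms(1) by (rule bE)
  obtain y1 y2 where y: "y1 \<in> n" "y2 \<in> h" "y = y1 + y2" using assms(2) by (rule bE)
  have "br x y = (br x1 y1 + br x1 y2) + br x2 y1"
    using h_abelian[OF x(2) y(2)] by (simp add: x(3) y(3) br.add_left br.add_right)
  then show ?thesis
    using n_closed[OF x(1) y(1)] br_h_n(2)[OF y(2) x(1)] br_h_n(1)[OF x(2) y(1)] subspace_n
    by (simp add: subspace_add)
qed

lemma br_X_n: "u \<in> n \<Longrightarrow> \<exists>w\<in>n. br w X = u"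
proof -
  assume "u \<in> n"
  then have "- u \<in> br X ` n" unfolding h_stable_br_X[OF n_stable n_h] by (rule subspace_neg[OF subspace_n])
  then obtain w where w: "- u = br X w" "w \<in> n" by (rule imageE)
  have "br w X = u" unfolding br_anti[of w X] w(1)[symmetric] by simp
  with w(2) show ?thesis by (rule bexI[rotated])
qed

text \<open>[y, X] lies in \<open>V\<close>, so its component in \<open>h\<close> vanishes; and
  \<open>n\<close> is filled by the brackets [w, X] with \<open>w\<close> in \<open>n\<close>, so
  \<open>y - w\<close> centralizes \<open>X\<close> for some such \<open>w\<close>. As
  \<open>X\<close> is in \<open>b\<close>, this makes \<open>b\<close> its own normalizer.\<close>

lemma in_b_if_br_X: assumes "br y X \<in> b" shows "y \<in> b"
proof -
  obtain u H where uH: "u \<in> n" "H \<in> h" "br y X = u + H" using assms by (rule bE)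
  have "br y X \<in> V" using subspace_neg[OF subspace_V] br_anti[of y X] by (simp add: V_def)
  then have "br y X - u \<in> V" using n_V[OF uH(1)] subspace_diff[OF subspace_V] by blast
  then have "H \<in> h \<inter> V" using uH by simp
  then have "br y X = u" using h_Int_V uH(3) by auto
  moreover obtain w where w: "w \<in> n" "br w X = u" using br_X_n[OF uH(1)] by blast
  ultimately have "br X (y - w) = 0" using br_anti[of X "y - w"] by (simp add: br.diff_left)
  then have "w + (y - w) \<in> b" by (intro bI w(1)) (simp add: h_def)
  then show ?thesis by simp
qed

lemma B_X_n: "u \<in> n \<Longrightarrow> B X u = 0"
  using h_orthogonal_V[OF h_theta[OF X_in_h] n_V] by (simp add: ip_def B_sym[of X])

text \<open>Elements of the adjoint group fixing \<open>X\<close> need not lie in the identity component of the stabilizer.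
  That they preserve \<open>n\<close> nevertheless is what makes the invariant distribution well defined.\<close>

lemma stabilizer_n:
  assumes S: "S \<in> AdG" "app S X = X"
  shows "u \<in> n \<Longrightarrow> app S u \<in> n" "H \<in> h \<Longrightarrow> app S H = H"
proof -
  obtain g where "S = AdE g" using S(1) by (auto simp: AdG_def)
  then obtain ys where ys: "S = expad_list ys" using AdE_expad_list[OF conn] by auto
  have fix_h: "app S H = H" if "H \<in> h" for H
    using stabilizer_fixes_h[of ys] S(2) that by (simp add: ys)
  then show "H \<in> h \<Longrightarrow> app S H = H" .
  show "u \<in> n \<Longrightarrow> app S u \<in> n"
    by (rule h_stable_invariant[OF AdG_Aut[OF S(1)] fix_h n_stable n_h])
qed

lemma stabilizer_b: "S \<in> AdG \<Longrightarrow> app S X = X \<Longrightarrow> x \<in> b \<Longrightarrow> app S x \<in> b"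
  by (erule bE) (simp add: app.add_right stabilizer_n bI)

lemma AdG_transporter:
  assumes "A \<in> AdG" "A' \<in> AdG" "app A X = app A' X"
  obtains S where "S \<in> AdG" "app S X = X" "A' = A * S"
proof -
  obtain Ai where Ai: "Ai \<in> AdG" "A * Ai = 1" "Ai * A = 1" using AdG_inverse[OF assms(1)] by blast
  show ?thesis
  proof (rule that[of "Ai * A'"])
    show "Ai * A' \<in> AdG" by (rule AdG_mult[OF Ai(1) assms(2)])
    have "app (Ai * A') X = app (Ai * A) X" using assms(3) by simp
    then show "app (Ai * A') X = X" by (simp only: Ai(3) app_one)
    show "A' = A * (Ai * A')" by (simp only: mult.assoc[symmetric] Ai(2) mult_1_left)
  qed
qed

text \<open>The tangent space of the leaf through \<open>app A X\<close>. It is indexed by the group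
  element, and \<open>distribution_well_defined\<close> shows that it depends on the point
  only.\<close>

definition \<D> :: "(real^'n) endo \<Rightarrow> (real^'n) set" where
  "\<D> A = (\<lambda>u. app A (br u X)) ` n"

lemma distribution_well_defined:
  assumes "A \<in> AdG" "A' \<in> AdG" "app A X = app A' X"
  shows "\<D> A = \<D> A'"
proof -
  have sub: "\<D> A' \<subseteq> \<D> A" if A: "A \<in> AdG" "A' \<in> AdG" "app A X = app A' X" for A A'
  proof -
    obtain S where S: "S \<in> AdG" "app S X = X" "A' = A * S" by (rule AdG_transporter[OF A])
    have "app A' (br u X) = app A (br (app S u) X)" for u
      by (simp add: S Aut_br[OF AdG_Aut[OF S(1)]])
    then show ?thesis unfolding \<D>_def using stabilizer_n(1)[OF S(1,2)] by blast
  qed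
  show ?thesis using sub[OF assms] sub[OF assms(2,1) assms(3)[symmetric]] by blast
qed

text \<open>The leaves are locally the level sets of \<open>A X \<mapsto> A b\<close>, because \<open>b\<close> is its own normalizer.  This map
  is what makes the charts coherent.\<close>

lemma b_image_well_defined:
  assumes "A \<in> AdG" "A' \<in> AdG" "app A X = app A' X"
  shows "app A ` b = app A' ` b"
proof -
  have sub: "app A' ` b \<subseteq> app A ` b" if A: "A \<in> AdG" "A' \<in> AdG" "app A X = app A' X" for A A'
  proof -
    obtain S where S: "S \<in> AdG" "app S X = X" "A' = A * S" by (rule AdG_transporter[OF A])
    then show ?thesis using stabilizer_b[OF S(1,2)] by auto
  qed
  show ?thesis using sub[OF assms] sub[OF assms(2,1) assms(3)[symmetric]] by blast
qed

end

locale foliated_orbit_charts = foliated_orbit br \<theta> G C U \<phi> h X n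
  for br :: "real^'n \<Rightarrow> real^'n \<Rightarrow> real^'n" and \<theta>
    and G :: "('p::{t2_space, second_countable_topology}) monoid" and C U \<phi> h X n +
  fixes Q :: "(real^'n) set" and pq pn ph :: "real^'n \<Rightarrow> real^'n" and qs ns hs :: "(real^'n) list"
  assumes subspace_Q: "subspace Q" and Q_b: "Q \<inter> b \<subseteq> {0}"
    and linear_p: "linear pq" "linear pn" "linear ph"
    and p_in: "\<And>z. pq z \<in> Q" "\<And>z. pn z \<in> n" "\<And>z. ph z \<in> h"
    and p_sum: "\<And>z. pq z + pn z + ph z = z"
    and p_eq: "\<And>q u. q \<in> Q \<Longrightarrow> u \<in> n \<Longrightarrow> pq (u + q) = q \<and> pn (u + q) = u \<and> ph (u + q) = 0"
      "\<And>x. x \<in> b \<Longrightarrow> pq x = 0"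
    and coords: "coordinates Q qs" "coordinates n ns" "coordinates h hs"
begin

text \<open>The last factor fixes \<open>X\<close>. It completes the coordinates of the orbit to
  coordinates of the adjoint group around 1, to which \<open>Aut_open_mapping\<close>
  applies.\<close>

definition \<Psi> :: "real^'n \<Rightarrow> (real^'n) endo" where
  "\<Psi> z = W qs (pq z) * W ns (pn z) * W hs (ph z)"

lemma bounded_linear_p: "bounded_linear pq" "bounded_linear pn" "bounded_linear ph"
  using linear_p by (simp_all add: linear_conv_bounded_linear)

lemma continuous_p [continuous_intros]:
  fixes f :: "'a::topological_space \<Rightarrow> real^'n"
  shows "continuous_on S f \<Longrightarrow> continuous_on S (\<lambda>z. pq (f z))"
    "continuous_on S f \<Longrightarrow> continuous_on S (\<lambda>z. pn (f z))"
    "continuous_on S f \<Longrightarrow> continuous_on S (\<lambda>z. ph (f z))"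
  by (rule bounded_linear.continuous_on[OF bounded_linear_p(1)]
      bounded_linear.continuous_on[OF bounded_linear_p(2)]
      bounded_linear.continuous_on[OF bounded_linear_p(3)]; assumption)+

lemma p_0 [simp]: "pq 0 = 0" "pn 0 = 0" "ph 0 = 0"
  using linear_p by (simp_all add: linear_0)

lemma W_hs_X: "app (W hs z) X = X"
proof (rule W_fixes)
  fix e assume "e \<in> set hs"
  then have "e \<in> h" using coords(3) by (auto simp: coordinates_def)
  then show "br e X = 0" by (rule h_abelian[OF _ X_in_h])
qed

lemma W_ns_n: "x \<in> n \<Longrightarrow> app (W ns z) x \<in> n"
  using coords(2) n_closed by (intro W_subspace[OF subspace_n]) (auto simp: coordinates_def)

lemma br_n_b: "x \<in> n \<Longrightarrow> y \<in> b \<Longrightarrow> br x y \<in> b"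
  by (rule n_b[OF br_b[OF n_b]])

lemma W_ns_b: "x \<in> b \<Longrightarrow> app (W ns z) x \<in> b"
  using coords(2) br_n_b by (intro W_subspace[OF subspace_b]) (auto simp: coordinates_def)

lemma image_eq_of_invertible:
  assumes "subspace S" "\<And>x. x \<in> S \<Longrightarrow> app A x \<in> S" "inj (app A)"
  shows "app A ` S = S"
proof -
  have "dim (app A ` S) = dim S"
    using assms(1,3) by (intro dim_image_eq[OF linear_app]) (auto simp: span_eq_iff[THEN iffD2] intro: inj_on_subset)
  then show ?thesis
    using assms linear_subspace_image[OF linear_app assms(1)] by (intro subspace_dim_equal) auto
qed

lemma inj_W: "inj (app (W es z))"
  by (rule inj_on_inverseI[of _ "app (Winv es z)"]) simp

lemma W_ns_image: "app (W ns z) ` n = n" "app (W ns z) ` b = b"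
  by (rule image_eq_of_invertible subspace_n subspace_b W_ns_n W_ns_b inj_W; assumption?)+

lemma \<Psi>_Aut: "\<Psi> z \<in> Aut" and \<Psi>_AdG: "\<Psi> z \<in> AdG"
  unfolding \<Psi>_def by (intro Aut_mult W_Aut AdG_mult W_AdG)+

text \<open>A chart must be open at each of its points, so base points \<open>z0\<close> in a whole
  ball are needed. The derivative translated back to 1, \<open>L z\<close>, is the identity at
  \<open>z = 0\<close> and depends continuously on \<open>z\<close>, so it stays injective
  nearby.\<close>

lemma \<Psi>_open_mapping:
  "\<exists>r>0. \<forall>z0\<in>ball 0 r. \<forall>N. open N \<longrightarrow> z0 \<in> N \<longrightarrow>
    (\<exists>\<delta>>0. \<forall>a\<in>Aut. norm (a - 1) < \<delta> \<longrightarrow> (\<exists>z\<in>N. \<Psi> z = \<Psi> z0 * a))"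
proof -
  define \<Psi>' where "\<Psi>' z v = (W qs (pq z) * W ns (pn z)) * dW hs (ph z) (ph v)
    + (W qs (pq z) * dW ns (pn z) (pn v) + dW qs (pq z) (pq v) * W ns (pn z)) * W hs (ph z)" for z v
  define \<Psi>i where "\<Psi>i z = Winv hs (ph z) * Winv ns (pn z) * Winv qs (pq z)" for z
  have der: "(\<Psi> has_derivative \<Psi>' z) (at z)" for z
    unfolding \<Psi>_def[abs_def] \<Psi>'_def[abs_def] by (intro has_derivative_mult W_derivative linear_p)
  have inv: "\<Psi>i z * \<Psi> z = 1" "\<Psi> z * \<Psi>i z = 1" for z
  proof -
    have "\<Psi>i z * \<Psi> z = Winv hs (ph z) * (Winv ns (pn z) * (Winv qs (pq z) * W qs (pq z)) * W ns (pn z)) * W hs (ph z)"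
      by (simp only: \<Psi>i_def \<Psi>_def mult.assoc)
    then show "\<Psi>i z * \<Psi> z = 1" by simp
    have "\<Psi> z * \<Psi>i z = W qs (pq z) * (W ns (pn z) * (W hs (ph z) * Winv hs (ph z)) * Winv ns (pn z)) * Winv qs (pq z)"
      by (simp only: \<Psi>i_def \<Psi>_def mult.assoc)
    then show "\<Psi> z * \<Psi>i z = 1" by simp
  qed
  define L where "L z v = pr (\<Psi>i z * \<Psi>' z v)" for z v
  interpret p: bounded_linear pr by (rule bounded_linear_pr)
  have "((\<lambda>z'. pr (\<Psi>i z * \<Psi> z')) has_derivative L z) (at z)" for z
    unfolding L_def[abs_def] by (intro p.has_derivative has_derivative_mult_right der)
  then have lin: "linear (L z)" for z using has_derivative_linear by blast
  have "continuous_on UNIV (\<lambda>z. L z v)" for v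
    unfolding L_def \<Psi>'_def \<Psi>i_def by (intro p.continuous_on continuous_intros)
  then have cont: "isCont (\<lambda>z. L z v) 0" for v by (simp add: continuous_on_eq_continuous_at)
  have L0: "L 0 v = v" for v
  proof -
    have "\<Psi>' 0 v = ad (ph v) + (ad (pn v) + ad (pq v))"
      unfolding \<Psi>'_def by (simp add: dW_0[OF coords(1) p_in(1)] dW_0[OF coords(2) p_in(2)] dW_0[OF coords(3) p_in(3)])
    also have "\<dots> = ad v"
      unfolding ad_linear(1)[symmetric] using p_sum[of v] by (simp add: algebra_simps)
    finally show ?thesis by (simp add: L_def \<Psi>i_def)
  qed
  \<comment> \<open>\<open>L 0\<close> is the identity, so a perturbation of operator norm below 1
    leaves it injective.\<close>
  obtain r where r: "r > 0" "\<And>z. dist 0 z < r \<Longrightarrow> onorm (\<lambda>v. L z v - L 0 v) < 1"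
    using C1_onorm_continuous[of L 0 1, OF lin cont] by auto
  have inj: "v = 0" if z: "z \<in> ball 0 r" "L z v = 0" for z v
  proof (rule ccontr)
    assume "v \<noteq> 0"
    have "bounded_linear (\<lambda>v. L z v - L 0 v)"
      using lin by (intro bounded_linear_sub) (auto simp: linear_conv_bounded_linear)
    then have "norm (L z v - L 0 v) \<le> onorm (\<lambda>v. L z v - L 0 v) * norm v" by (rule onorm)
    also have "\<dots> < 1 * norm v" using r(2)[of z] z(1) \<open>v \<noteq> 0\<close> by (intro mult_strict_right_mono) auto
    finally show False using z(2) by (simp add: L0)
  qed
  have "\<exists>\<delta>>0. \<forall>a\<in>Aut. norm (a - 1) < \<delta> \<longrightarrow> (\<exists>z\<in>N. \<Psi> z = \<Psi> z0 * a)"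
    if z0: "z0 \<in> ball 0 r" and N: "open N" "z0 \<in> N" for z0 N
  proof -
    let ?f = "\<lambda>z. \<Psi>i z0 * \<Psi> z"
    have c: "continuous_on N ?f" unfolding \<Psi>_def by (intro continuous_intros)
    have i: "\<Psi>i z0 \<in> Aut" by (rule Aut_inverse(1)[OF \<Psi>_Aut disjI2[OF inv(1)]])
    have d: "(?f has_derivative (\<lambda>v. \<Psi>i z0 * \<Psi>' z0 v)) (at z0)"
      by (intro has_derivative_mult_right der)
    have "\<exists>\<delta>>0. \<forall>a\<in>Aut. norm (a - 1) < \<delta> \<longrightarrow> a \<in> ?f ` N"
      by (rule Aut_open_mapping[OF N c Aut_mult[OF i \<Psi>_Aut] inv(1) d])
        (use inj[OF z0] in \<open>auto simp: L_def\<close>)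
    moreover have "\<exists>z\<in>N. \<Psi> z = \<Psi> z0 * a" if a: "a \<in> ?f ` N" for a
    proof -
      obtain z where z: "a = ?f z" "z \<in> N" using a by (rule imageE)
      have "\<Psi> z0 * a = (\<Psi> z0 * \<Psi>i z0) * \<Psi> z" unfolding z(1) by (simp only: mult.assoc)
      then show ?thesis using z(2) by (intro bexI[of _ z]) (simp_all add: inv)
    qed
    ultimately show ?thesis by auto
  qed
  then show ?thesis by (intro exI[of _ r]) (simp add: r(1))
qed

definition orbit_map :: "real^'n \<Rightarrow> real^'n" where
  "orbit_map z = app (W qs (pq z)) (app (W ns (pn z)) X)"

lemma orbit_map_eq: "u \<in> n \<Longrightarrow> q \<in> Q \<Longrightarrow> orbit_map (u + q) = app (W qs q) (app (W ns u) X)"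
  by (simp add: orbit_map_def p_eq)

lemma orbit_map_\<Psi>: "orbit_map z = app (\<Psi> z) X"
  by (simp add: orbit_map_def \<Psi>_def W_hs_X)

lemma eq_zero_if_br_X:
  assumes "br (pq v + pn v) X + ph v = 0" shows "v = 0"
proof -
  let ?w = "pq v + pn v"
  have "br ?w X \<in> V" using subspace_neg[OF subspace_V] br_anti[of ?w X] by (simp add: V_def)
  moreover have "br ?w X = - ph v" using assms by (simp add: eq_neg_iff_add_eq_0)
  then have "br ?w X \<in> h" using subspace_neg[OF subspace_h p_in(3)] by simp
  ultimately have 0: "br ?w X = 0" using h_Int_V by auto
  then have w: "?w \<in> h" using br_anti[of X ?w] by (simp add: h_def)
  then have "?w - pn v \<in> b" using p_in(2) subspace_diff[OF subspace_b] h_b n_b by blast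
  then have "pq v = 0" using Q_b p_in(1)[of v] by auto
  moreover from this w have "pn v = 0" using n_h p_in(2)[of v] by auto
  moreover have "ph v = 0" using assms 0 by simp
  ultimately show "v = 0" using p_sum[of v] by simp
qed

text \<open>Adding \<open>ph z\<close> supplies the directions that the orbit lacks, so that the map
  goes between spaces of equal dimension. Its derivative at 0 is injective because [pq v + pn v, X]
  lies in \<open>V\<close>, which meets \<open>h\<close> only in 0.\<close>

lemma orbit_map_locally_injective:
  "\<exists>r>0. inj_on (\<lambda>z. orbit_map z + ph z) (ball 0 r) \<and>
    (\<forall>z\<in>ball 0 r. \<forall>D'. ((\<lambda>z. orbit_map z + ph z) has_derivative D') (at z) \<longrightarrow> inj D')"
proof (rule expfun_locally_injective)
  show "expfun (\<lambda>z. orbit_map z + ph z)"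
    unfolding orbit_map_def by (intro expfun.add expfun_W expfun.linear expfun.const bounded_linear_p)
  have "((\<lambda>z. app (W ns (pn z)) X) has_derivative (\<lambda>v. 0 + br (pn v) X)) (at 0)"
    by (rule app_W_derivative_0[OF coords(2) linear_p(2) p_in(2) has_derivative_const])
  from app_W_derivative_0[OF coords(1) linear_p(1) p_in(1) this]
  have "(orbit_map has_derivative (\<lambda>v. br (pn v) X + br (pq v) X)) (at 0)"
    unfolding orbit_map_def by simp
  from has_derivative_add[OF this linear_imp_has_derivative[OF linear_p(3)]]
  show "((\<lambda>z. orbit_map z + ph z) has_derivative (\<lambda>v. br (pn v) X + br (pq v) X + ph v)) (at 0)" .
  show "v = 0" if "br (pn v) X + br (pq v) X + ph v = 0" for v
  proof (rule eq_zero_if_br_X)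
    show "br (pq v + pn v) X + ph v = 0" using that by (simp add: br.add_left add.commute)
  qed
qed

text \<open>If the images of \<open>b\<close> agree, then \<open>W qs q\<close> sends
  \<open>X\<close> where \<open>W qs q'\<close> sends some \<open>x\<close> in \<open>b\<close>. So
  \<open>?\<Xi>\<close> takes the same value at \<open>q\<close> and at \<open>q' + (x - X)\<close>,
  and its local injectivity identifies these points and their components in \<open>Q\<close>. The
  derivative of \<open>?\<Xi>\<close> is injective by \<open>in_b_if_br_X\<close>.\<close>

lemma W_qs_b_injective:
  "\<exists>r>0. \<forall>q\<in>Q \<inter> ball 0 r. \<forall>q'\<in>Q \<inter> ball 0 r. app (W qs q) ` b = app (W qs q') ` b \<longrightarrow> q = q'"
proof -
  let ?\<Xi> = "\<lambda>z. app (W qs (pq z)) (X + (pn z + ph z))"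
  have lin: "linear (\<lambda>z. pn z + ph z)" by (intro linear_compose_add linear_p)
  have exp: "expfun ?\<Xi>"
    by (intro expfun_W expfun.add expfun.linear expfun.const bounded_linear_p)
  have "((\<lambda>z. X + (pn z + ph z)) has_derivative (\<lambda>v. 0 + (pn v + ph v))) (at 0)"
    by (intro has_derivative_add has_derivative_const linear_imp_has_derivative lin linear_p)
  from app_W_derivative_0[OF coords(1) linear_p(1) p_in(1) this]
  have der: "(?\<Xi> has_derivative (\<lambda>v. pn v + ph v + br (pq v) X)) (at 0)" by simp
  have inj: "v = 0" if v: "pn v + ph v + br (pq v) X = 0" for v
  proof -
    have "br (pq v) X = - (pn v + ph v)" by (rule minus_unique[OF v, symmetric])
    then have "br (pq v) X \<in> b" using subspace_neg[OF subspace_b bI[OF p_in(2,3)]] by simp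
    then have "pq v \<in> b" by (rule in_b_if_br_X)
    then have q: "pq v = 0" using Q_b p_in(1)[of v] by auto
    then show "v = 0" using v p_sum[of v] by (simp add: br.zero_left)
  qed
  obtain s where s: "s > 0" "inj_on ?\<Xi> (ball 0 s)"
    using expfun_locally_injective[OF exp der inj] by auto
  let ?g = "\<lambda>z. app (Winv qs (snd z)) (app (W qs (fst z)) X)"
  have "continuous_on UNIV ?g"
    by (intro app.continuous_on continuous_intros)
  then have "isCont ?g (0, 0)" by (simp add: continuous_on_eq_continuous_at)
  then have "\<forall>e>0. \<exists>d>0. \<forall>z. dist z (0, 0) < d \<longrightarrow> dist (?g z) (?g (0, 0)) < e"
    unfolding continuous_at_eps_delta .
  \<comment> \<open>Continuity keeps \<open>\<beta> = x - X\<close> below \<open>s / 2\<close>; with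
    \<open>norm q' < s / 2\<close> this places \<open>q' + \<beta>\<close> in the ball of
    injectivity.\<close>
  then obtain d where d: "d > 0" "\<And>z. dist z (0, 0) < d \<Longrightarrow> dist (?g z) (?g (0, 0)) < s / 2"
    using s(1) half_gt_zero by blast
  have "q = q'" if q: "q \<in> Q" "norm q < min (s / 2) (d / 2)" and q': "q' \<in> Q" "norm q' < min (s / 2) (d / 2)"
    and eq: "app (W qs q) ` b = app (W qs q') ` b" for q q'
  proof -
    define \<beta> where "\<beta> = app (Winv qs q') (app (W qs q) X) - X"
    have "dist (q, q') (0, 0) < d"
      using q(2) q'(2) norm_Pair_le[of q q'] by (simp add: dist_norm)
    from d(2)[OF this] have small: "norm \<beta> < s / 2" by (simp add: \<beta>_def dist_norm)
    have "app (W qs q) X \<in> app (W qs q') ` b" using eq h_b[OF X_in_h] by blast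
    then obtain x where x: "app (W qs q) X = app (W qs q') x" "x \<in> b" by (rule imageE)
    then have b: "\<beta> \<in> b" using subspace_diff[OF subspace_b x(2) h_b[OF X_in_h]] by (simp add: \<beta>_def)
    have pq': "pq (q' + \<beta>) = q'" "pq q = q"
      using p_eq(1)[OF q'(1) subspace_0[OF subspace_n]] p_eq(1)[OF q(1) subspace_0[OF subspace_n]] p_eq(2)[OF b]
      by (simp_all add: linear_add[OF linear_p(1)])
    have res: "pn z + ph z = z - pq z" for z using p_sum[of z] by (simp add: algebra_simps)
    have "?\<Xi> (q' + \<beta>) = ?\<Xi> q"
      unfolding res pq' by (simp add: \<beta>_def x(1))
    moreover have "q' + \<beta> \<in> ball 0 s" "q \<in> ball 0 s"
      using small q(2) q'(2) norm_triangle_ineq[of q' \<beta>] s(1) by auto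
    ultimately have "q' + \<beta> = q" using inj_onD[OF s(2)] by blast
    then show "q = q'" using pq' by simp
  qed
  then show ?thesis using s(1) d(1) by (intro exI[of _ "min (s/2) (d/2)"]) auto
qed

text \<open>Points of a chart are sums \<open>u + q\<close> with both summands in
  \<open>ball 0 r\<close>, hence the doubled radius.\<close>

lemma chart_radius_exists:
  "\<exists>r>0. inj_on (\<lambda>z. orbit_map z + ph z) (ball 0 (2 * r)) \<and>
    (\<forall>z\<in>ball 0 (2 * r). \<forall>D'. ((\<lambda>z. orbit_map z + ph z) has_derivative D') (at z) \<longrightarrow> inj D') \<and>
    (\<forall>q\<in>Q \<inter> ball 0 r. \<forall>q'\<in>Q \<inter> ball 0 r. app (W qs q) ` b = app (W qs q') ` b \<longrightarrow> q = q') \<and>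
    (\<forall>z0\<in>ball 0 (2 * r). \<forall>N. open N \<longrightarrow> z0 \<in> N \<longrightarrow>
      (\<exists>\<delta>>0. \<forall>a\<in>Aut. norm (a - 1) < \<delta> \<longrightarrow> (\<exists>z\<in>N. \<Psi> z = \<Psi> z0 * a)))"
proof -
  obtain r1 where r1: "r1 > 0" "inj_on (\<lambda>z. orbit_map z + ph z) (ball 0 r1)"
    "\<forall>z\<in>ball 0 r1. \<forall>D'. ((\<lambda>z. orbit_map z + ph z) has_derivative D') (at z) \<longrightarrow> inj D'"
    using orbit_map_locally_injective by auto
  obtain r2 where r2: "r2 > 0"
    "\<forall>q\<in>Q \<inter> ball 0 r2. \<forall>q'\<in>Q \<inter> ball 0 r2. app (W qs q) ` b = app (W qs q') ` b \<longrightarrow> q = q'"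
    using W_qs_b_injective by auto
  obtain r3 where r3: "r3 > 0" "\<forall>z0\<in>ball 0 r3. \<forall>N. open N \<longrightarrow> z0 \<in> N \<longrightarrow>
      (\<exists>\<delta>>0. \<forall>a\<in>Aut. norm (a - 1) < \<delta> \<longrightarrow> (\<exists>z\<in>N. \<Psi> z = \<Psi> z0 * a))"
    using \<Psi>_open_mapping by auto
  define r where "r = min (r1 / 2) (min r2 (r3 / 2))"
  have r: "r > 0" using r1 r2 r3 by (simp add: r_def)
  have sub: "ball 0 (2 * r) \<subseteq> (ball 0 r1 :: (real^'n) set)" "ball 0 (2 * r) \<subseteq> (ball 0 r3 :: (real^'n) set)"
    "ball 0 r \<subseteq> (ball 0 r2 :: (real^'n) set)"
    by (rule subset_ball; simp add: r_def)+
  show ?thesis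
    apply (rule exI[of _ r], intro conjI r)
    subgoal by (rule inj_on_subset[OF r1(2) sub(1)])
    subgoal using r1(3) sub(1) by blast
    subgoal using r2(2) sub(3) by blast
    subgoal using r3(2) sub(2) by (meson subsetD)
    done
qed

end

locale foliated_orbit_radius = foliated_orbit_charts br \<theta> G C U \<phi> h X n Q pq pn ph qs ns hs
  for br :: "real^'n \<Rightarrow> real^'n \<Rightarrow> real^'n" and \<theta>
    and G :: "('p::{t2_space, second_countable_topology}) monoid" and C U \<phi> h X n Q pq pn ph qs ns hs +
  fixes r :: real
  assumes r_pos: "r > 0"
    and r_inj: "inj_on (\<lambda>z. orbit_map z + ph z) (ball 0 (2 * r))"
    and r_der: "\<And>z D'. z \<in> ball 0 (2 * r) \<Longrightarrow> ((\<lambda>z. orbit_map z + ph z) has_derivative D') (at z) \<Longrightarrow> inj D'"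
    and r_b: "\<And>q q'. q \<in> Q \<inter> ball 0 r \<Longrightarrow> q' \<in> Q \<inter> ball 0 r \<Longrightarrow> app (W qs q) ` b = app (W qs q') ` b \<Longrightarrow> q = q'"
    and r_open: "\<And>z0 N. z0 \<in> ball 0 (2 * r) \<Longrightarrow> open N \<Longrightarrow> z0 \<in> N \<Longrightarrow>
      \<exists>\<delta>>0. \<forall>a\<in>Aut. norm (a - 1) < \<delta> \<longrightarrow> (\<exists>z\<in>N. \<Psi> z = \<Psi> z0 * a)"
begin

text \<open>The factor of \<open>n\<close> stands next to \<open>X\<close>, so a slice with fixed
  second coordinate is a piece of the orbit of \<open>X\<close> under the group of \<open>n\<close>,
  moved by one fixed operator. The leaf coordinate comes first, as \<open>foliated_chart\<close>
  requires.\<close>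

definition \<sigma> :: "(real^'n) endo \<Rightarrow> (real^'n) \<times> (real^'n) \<Rightarrow> real^'n" where
  "\<sigma> A z = app A (app (W qs (snd z)) (app (W ns (fst z)) X))"

definition Bn :: "(real^'n) set" where "Bn = ball 0 r \<inter> n"
definition BQ :: "(real^'n) set" where "BQ = ball 0 r \<inter> Q"
definition F :: "(real^'n, real^'n) param set" where "F = {(Bn, BQ, \<sigma> A) | A. A \<in> AdG}"

abbreviation "T \<equiv> orbit_topology G (U, \<phi>) X"

lemma \<sigma>_eq: "u \<in> n \<Longrightarrow> q \<in> Q \<Longrightarrow> \<sigma> A (u, q) = app A (orbit_map (u + q))"
  by (simp add: \<sigma>_def orbit_map_eq)

lemma \<sigma>_orbit: "A \<in> AdG \<Longrightarrow> \<sigma> A z \<in> Ad_orbit G (U, \<phi>) X"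
  unfolding Ad_orbit_eq
  by (rule image_eqI[of _ _ "A * (W qs (snd z) * W ns (fst z))"])
    (simp_all add: \<sigma>_def AdG_mult W_AdG)

lemma expfun_\<sigma>: "expfun (\<sigma> A)"
  unfolding \<sigma>_def[abs_def]
  by (intro expfun.app expfun_W expfun.const bounded_linear_fst bounded_linear_snd)

lemma \<sigma>_has_derivative: "(\<sigma> A has_derivative frechet_derivative (\<sigma> A) (at z)) (at z)"
  using expfun_derivative[OF expfun_\<sigma>, of A] frechet_derivative_works differentiable_def by blast

lemma inj_AdG: "A \<in> AdG \<Longrightarrow> app A x = app A y \<Longrightarrow> x = y"
proof -
  assume A: "A \<in> AdG" and eq: "app A x = app A y"
  obtain Ai where "Ai * A = 1" using AdG_inverse[OF A] by blast
  then have "app (Ai * A) x = x" "app (Ai * A) y = y" by simp_all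
  then show "x = y" using eq by simp
qed

lemma sum_in_ball: "u \<in> Bn \<Longrightarrow> q \<in> BQ \<Longrightarrow> u + q \<in> ball 0 (2 * r)"
  using norm_triangle_ineq[of u q] by (simp add: Bn_def BQ_def)

lemma sum_unique:
  assumes "u \<in> n" "q \<in> Q" "u' \<in> n" "q' \<in> Q" "u + q = u' + q'"
  shows "(u, q) = (u', q')"
proof -
  have "(u, q) = (pn (u + q), pq (u + q))" using p_eq(1)[OF assms(2,1)] by simp
  also have "\<dots> = (u', q')" unfolding assms(5) using p_eq(1)[OF assms(4,3)] by simp
  finally show ?thesis .
qed

lemma \<sigma>_inj: assumes A: "A \<in> AdG" shows "inj_on (\<sigma> A) (Bn \<times> BQ)"
proof (rule inj_onI)
  fix z z' assume z: "z \<in> Bn \<times> BQ" "z' \<in> Bn \<times> BQ" "\<sigma> A z = \<sigma> A z'"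
  obtain u q u' q' where uq: "z = (u, q)" "z' = (u', q')" by (metis surj_pair)
  have 1: "u \<in> Bn" "q \<in> BQ" "u' \<in> Bn" "q' \<in> BQ" using z uq by auto
  then have 2: "u \<in> n" "q \<in> Q" "u' \<in> n" "q' \<in> Q" by (auto simp: Bn_def BQ_def)
  have "orbit_map (u + q) = orbit_map (u' + q')"
    by (rule inj_AdG[OF A]) (use z(3) 2 in \<open>simp add: uq \<sigma>_eq\<close>)
  then have "orbit_map (u + q) + ph (u + q) = orbit_map (u' + q') + ph (u' + q')"
    using 2 by (simp add: p_eq)
  then have "u + q = u' + q'"
    by (rule inj_onD[OF r_inj _ sum_in_ball[OF 1(1,2)] sum_in_ball[OF 1(3,4)]])
  then show "z = z'" unfolding uq by (rule sum_unique[OF 2])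
qed

lemma \<sigma>_derivative_injective:
  assumes A: "A \<in> AdG" and z: "z \<in> Bn \<times> BQ"
  shows "inj_on (frechet_derivative (\<sigma> A) (at z)) (n \<times> Q)"
proof -
  obtain u0 q0 where z0: "z = (u0, q0)" by force
  have uq0: "u0 \<in> n" "q0 \<in> Q" "u0 \<in> Bn" "q0 \<in> BQ" using z by (auto simp: z0 Bn_def BQ_def)
  let ?s = "frechet_derivative (\<sigma> A) (at z)" and ?w = "u0 + q0"
  let ?L = "\<lambda>w. (pn w, pq w)"
  have L: "?L (u + q) = (u, q)" "ph (u + q) = 0" if "u \<in> n" "q \<in> Q" for u q
    using p_eq(1)[OF that(2,1)] by simp_all
  obtain Ai where Ai: "Ai * A = 1" using AdG_inverse[OF A] by blast
  have Lder: "(?L has_derivative ?L) (at ?w)"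
    by (intro has_derivative_Pair linear_imp_has_derivative linear_p)
  have "(\<sigma> A has_derivative ?s) (at (?L ?w))"
    unfolding L(1)[OF uq0(1,2)] z0 by (rule \<sigma>_has_derivative)
  from diff_chain_at[OF Lder this]
  have "((\<lambda>w. app A (orbit_map w)) has_derivative (\<lambda>v. ?s (?L v))) (at ?w)"
    by (simp add: o_def \<sigma>_def orbit_map_def)
  from bounded_linear.has_derivative[OF app.bounded_linear_right this, of Ai]
  have "(orbit_map has_derivative (\<lambda>v. app Ai (?s (?L v)))) (at ?w)"
    by (simp add: app_mult[symmetric] Ai del: app_mult)
  from has_derivative_add[OF this linear_imp_has_derivative[OF linear_p(3)]]
  have inj: "inj (\<lambda>v. app Ai (?s (?L v)) + ph v)"
    by (rule r_der[OF sum_in_ball[OF uq0(3,4)]])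
  show ?thesis
  proof (rule inj_onI)
    fix y y' assume y: "y \<in> n \<times> Q" "y' \<in> n \<times> Q" "?s y = ?s y'"
    obtain u q u' q' where uq: "y = (u, q)" "y' = (u', q')" by (metis surj_pair)
    have 2: "u \<in> n" "q \<in> Q" "u' \<in> n" "q' \<in> Q" using y uq by auto
    have "u + q = u' + q'"
      by (rule injD[OF inj]) (simp only: L[OF 2(1,2)] L[OF 2(3,4)] uq(1)[symmetric] uq(2)[symmetric] y(3))
    then show "y = y'" unfolding uq by (rule sum_unique[OF 2])
  qed
qed

lemma \<sigma>_continuous:
  assumes A: "A \<in> AdG" shows "continuous_map (top_of_set (Bn \<times> BQ)) T (\<sigma> A)"
  unfolding continuous_map_def
proof (intro conjI allI impI)
  show "\<sigma> A \<in> topspace (top_of_set (Bn \<times> BQ)) \<rightarrow> topspace T"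
    using \<sigma>_orbit[OF A] by (simp add: topspace_orbit)
  fix Y assume Y: "openin T Y"
  let ?S = "{z \<in> Bn \<times> BQ. \<sigma> A z \<in> Y}"
  have "\<exists>N. openin (top_of_set (Bn \<times> BQ)) N \<and> z0 \<in> N \<and> N \<subseteq> ?S" if z0: "z0 \<in> ?S" for z0
  proof -
    obtain p0 q0 where pq0: "z0 = (p0, q0)" by force
    let ?A = "A * (W qs q0 * W ns p0)"
    \<comment> \<open>The displacement of \<open>z\<close> relative to \<open>z0\<close>: an
      automorphism that is 1 at \<open>z0\<close>, so that openness of \<open>Y\<close> can be
      tested by automorphisms near 1.\<close>
    let ?a = "\<lambda>z. Winv ns p0 * (Winv qs q0 * (W qs (snd z) * W ns (fst z)))"
    have \<sigma>a: "\<sigma> A z = app ?A (app (?a z) X)" for z by (simp add: \<sigma>_def)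
    have a0: "?a z0 = 1"
    proof -
      have "?a z0 = Winv ns p0 * ((Winv qs q0 * W qs q0) * W ns p0)" by (simp only: pq0 mult.assoc fst_conv snd_conv)
      then show ?thesis by simp
    qed
    have AG: "?A \<in> AdG" by (intro AdG_mult A W_AdG)
    have "app ?A X \<in> Y" using z0 \<sigma>a[of z0] unfolding a0 by simp
    obtain \<delta> where \<delta>: "\<delta> > 0" "\<And>a. a \<in> Aut \<Longrightarrow> norm (a - 1) < \<delta> \<Longrightarrow> app ?A (app a X) \<in> Y"
      using openin_orbitD[OF Y AG \<open>app ?A X \<in> Y\<close>] by metis
    let ?N = "{z. norm (?a z - 1) < \<delta>}"
    have "open ?N" by (intro open_Collect_less continuous_intros)
    moreover have "z0 \<in> ?N" unfolding mem_Collect_eq a0 using \<delta>(1) by simp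
    moreover have "\<sigma> A z \<in> Y" if "z \<in> ?N" for z
      unfolding \<sigma>a using that by (intro \<delta>(2) Aut_mult W_Aut Winv_Aut) simp_all
    ultimately show ?thesis
      using z0 by (intro exI[of _ "(Bn \<times> BQ) \<inter> ?N"]) (auto intro: openin_open_Int)
  qed
  then have "openin (top_of_set (Bn \<times> BQ)) ?S" using openin_subopen by meson
  then show "openin (top_of_set (Bn \<times> BQ)) {z \<in> topspace (top_of_set (Bn \<times> BQ)). \<sigma> A z \<in> Y}" by simp
qed

text \<open>Write \<open>A1 = A * \<Psi> ?z0 * R\<close> with \<open>R\<close> fixing
  \<open>X\<close>. Then \<open>A1 * a\<close> and \<open>A * \<Psi> ?z0 * (R * a * Ri)\<close>
  agree on \<open>X\<close>, and \<open>r_open\<close> writes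
  \<open>\<Psi> ?z0 * (R * a * Ri)\<close> as some \<open>\<Psi> z\<close>; the factor of
  \<open>h\<close> in it disappears on \<open>X\<close>.\<close>

lemma \<sigma>_open:
  assumes A: "A \<in> AdG" and S: "openin (top_of_set (Bn \<times> BQ)) S"
  shows "openin T (\<sigma> A ` S)"
proof (rule openin_orbitI)
  show "\<sigma> A ` S \<subseteq> Ad_orbit G (U, \<phi>) X" using \<sigma>_orbit[OF A] by blast
  fix A1 assume A1: "A1 \<in> AdG" "app A1 X \<in> \<sigma> A ` S"
  obtain S' where S': "open S'" "S = (Bn \<times> BQ) \<inter> S'" using S by (auto simp: openin_open)
  obtain p0 q0 where pq0: "app A1 X = \<sigma> A (p0, q0)" "(p0, q0) \<in> S" using A1(2) by auto
  have in_ball: "p0 \<in> Bn" "q0 \<in> BQ" using pq0(2) S'(2) by auto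
  then have in_nQ: "p0 \<in> n" "q0 \<in> Q" by (auto simp: Bn_def BQ_def)
  let ?z0 = "p0 + q0"
  have AG: "A * \<Psi> ?z0 \<in> AdG" by (intro AdG_mult A \<Psi>_AdG)
  have "app (A * \<Psi> ?z0) X = app A1 X"
    using \<sigma>_eq[OF in_nQ, of A] by (simp add: pq0(1) orbit_map_\<Psi>)
  then obtain R where R: "R \<in> AdG" "app R X = X" "A1 = A * \<Psi> ?z0 * R"
    using AdG_transporter[OF AG A1(1)] by metis
  obtain Ri where Ri: "Ri \<in> AdG" "R * Ri = 1" "Ri * R = 1" using AdG_inverse[OF R(1)] by blast
  have "app Ri (app R X) = X" unfolding app_mult[symmetric] Ri(3) by simp
  then have RiX: "app Ri X = X" by (simp add: R(2))
  let ?N = "{z. (pn z, pq z) \<in> (ball 0 r \<times> ball 0 r) \<inter> S'}"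
  have "open ?N"
  proof -
    have "continuous_on UNIV (\<lambda>z. (pn z, pq z))" by (intro continuous_intros)
    moreover have "open ((ball 0 r \<times> ball 0 r) \<inter> S')" by (intro open_Int open_Times open_ball S'(1))
    ultimately show ?thesis using open_vimage unfolding vimage_def by blast
  qed
  moreover have "?z0 \<in> ?N"
    using p_eq(1)[OF in_nQ(2,1)] pq0(2) S'(2) by (auto simp: Bn_def BQ_def)
  ultimately obtain \<delta> where \<delta>: "\<delta> > 0"
    "\<And>a. a \<in> Aut \<Longrightarrow> norm (a - 1) < \<delta> \<Longrightarrow> \<exists>z\<in>?N. \<Psi> z = \<Psi> ?z0 * a"
    using r_open[OF sum_in_ball[OF in_ball], of ?N] by auto
  \<comment> \<open>Conjugation by \<open>R\<close> stretches the distance from 1 by at most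
    \<open>norm R * norm Ri\<close>; the summand 1 makes \<open>c\<close> positive.\<close>
  define c where "c = norm R * norm Ri + 1"
  have c: "c > 0" by (simp add: c_def add_nonneg_pos)
  have "app A1 (app a X) \<in> \<sigma> A ` S" if a: "a \<in> Aut" "norm (a - 1) < \<delta> / c" for a
  proof -
    have "R * a * Ri - 1 = R * (a - 1) * Ri" by (simp add: algebra_simps Ri)
    then have "norm (R * a * Ri - 1) \<le> norm R * norm (a - 1) * norm Ri"
      using norm_mult_ineq[of "R * (a - 1)" Ri] norm_mult_ineq[of R "a - 1"]
      by (metis (no_types) mult_right_mono norm_ge_zero order_trans)
    also have "\<dots> \<le> c * norm (a - 1)" by (simp add: c_def algebra_simps)
    also have "\<dots> < \<delta>" using a(2) c by (simp add: pos_less_divide_eq mult.commute)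
    finally have "norm (R * a * Ri - 1) < \<delta>" .
    moreover have "R * a * Ri \<in> Aut" by (intro Aut_mult AdG_Aut R(1) Ri(1) a(1))
    ultimately obtain z where z: "z \<in> ?N" "\<Psi> z = \<Psi> ?z0 * (R * a * Ri)" using \<delta>(2) by auto
    have "app A1 (app a X) = app A (app (\<Psi> ?z0 * (R * a * Ri)) X)"
      by (simp add: R(3) RiX)
    also have "\<dots> = \<sigma> A (pn z, pq z)"
      unfolding z(2)[symmetric] by (simp add: orbit_map_\<Psi>[symmetric] \<sigma>_def orbit_map_def)
    also have "\<dots> \<in> \<sigma> A ` S"
      using z(1) p_in S'(2) by (intro imageI) (auto simp: Bn_def BQ_def)
    finally show ?thesis .
  qed
  then show "\<exists>\<delta>>0. \<forall>a\<in>Aut. norm (a - 1) < \<delta> \<longrightarrow> app A1 (app a X) \<in> \<sigma> A ` S"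
    using \<delta>(1) c by (intro exI[of _ "\<delta> / c"]) simp
qed

lemma foliated_chart_\<sigma>:
  assumes A: "A \<in> AdG" shows "foliated_chart T n Q (Bn, BQ, \<sigma> A)"
proof -
  let ?D = "Bn \<times> BQ"
  have 1: "openin (top_of_set n) Bn" "openin (top_of_set Q) BQ"
    unfolding Bn_def BQ_def by (auto simp: openin_open)
  have 2: "connected Bn"
    unfolding Bn_def by (intro convex_connected convex_Int convex_ball subspace_imp_convex subspace_n)
  have 3: "\<exists>U. open U \<and> U \<inter> (n \<times> Q) = ?D \<and> smooth_on U (\<sigma> A)"
    by (rule exI[of _ "ball 0 r \<times> ball 0 r"])
      (auto simp: open_Times Bn_def BQ_def intro: expfun_smooth[OF expfun_\<sigma>])
  have open_D: "openin T (\<sigma> A ` ?D)" by (rule \<sigma>_open[OF A openin_subtopology_self])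
  have "homeomorphic_map (top_of_set ?D) (subtopology T (\<sigma> A ` ?D)) (\<sigma> A)"
  proof (rule bijective_open_imp_homeomorphic_map)
    show "continuous_map (top_of_set ?D) (subtopology T (\<sigma> A ` ?D)) (\<sigma> A)"
      using \<sigma>_continuous[OF A] by (auto simp: continuous_map_in_subtopology)
    show "open_map (top_of_set ?D) (subtopology T (\<sigma> A ` ?D)) (\<sigma> A)"
    proof (unfold open_map_def, intro allI impI)
      fix S assume S: "openin (top_of_set ?D) S"
      then have "S \<subseteq> ?D" using openin_imp_subset by blast
      then have "\<sigma> A ` S = \<sigma> A ` S \<inter> \<sigma> A ` ?D" by blast
      then show "openin (subtopology T (\<sigma> A ` ?D)) (\<sigma> A ` S)"
        unfolding openin_subtopology using \<sigma>_open[OF A S] by blast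
    qed
    show "\<sigma> A ` topspace (top_of_set ?D) = topspace (subtopology T (\<sigma> A ` ?D))"
      using openin_subset[OF open_D] by (simp add: topspace_subtopology) blast
    show "inj_on (\<sigma> A) (topspace (top_of_set ?D))" using \<sigma>_inj[OF A] by simp
  qed
  then show ?thesis
    unfolding foliated_chart_def case_prod_conv
    using 1 2 3 open_D \<sigma>_derivative_injective[OF A] by (intro conjI ballI)
qed

lemma \<sigma>_b_image:
  assumes "A \<in> AdG" "B' \<in> AdG" "app B' X = \<sigma> A (p, q)"
  shows "app B' ` b = app (A * W qs q) ` b"
proof -
  have "app B' ` b = app (A * W qs q * W ns p) ` b"
    using assms by (intro b_image_well_defined AdG_mult W_AdG) (simp_all add: \<sigma>_def)
  also have "\<dots> = app (A * W qs q) ` (app (W ns p) ` b)" by (simp add: image_image)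
  finally show ?thesis by (simp only: W_ns_image)
qed

text \<open>Both points lie on one plaque of the first chart, so the group elements over them carry
  \<open>b\<close> to the same subspace. In the second chart this subspace determines the transverse
  coordinate by \<open>r_b\<close>.\<close>

lemma same_plaque:
  assumes A: "A \<in> AdG" "A' \<in> AdG" and q: "q0' \<in> BQ" "q1 \<in> BQ"
    and y0: "\<sigma> A (p0, q0) = \<sigma> A' (p0', q0')" and y1: "\<sigma> A (p1, q0) = \<sigma> A' (p1', q1)"
  shows "q1 = q0'"
proof -
  let ?B = "\<lambda>p. A * (W qs q0 * W ns p)"
  have B: "?B p \<in> AdG" "app (?B p) X = \<sigma> A (p, q0)" for p
    by (intro AdG_mult A(1) W_AdG) (simp add: \<sigma>_def)
  have "app (A' * W qs q0') ` b = app (?B p0) ` b"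
    by (rule \<sigma>_b_image[OF A(2) B(1), symmetric]) (simp only: B(2) y0)
  also have "\<dots> = app (A * W qs q0) ` b" by (rule \<sigma>_b_image[OF A(1) B])
  also have "\<dots> = app (?B p1) ` b" by (rule \<sigma>_b_image[OF A(1) B, symmetric])
  also have "\<dots> = app (A' * W qs q1) ` b"
    by (rule \<sigma>_b_image[OF A(2) B(1)]) (simp only: B(2) y1)
  finally have eq: "app A' ` (app (W qs q0') ` b) = app A' ` (app (W qs q1) ` b)" by (simp add: image_image)
  moreover have "inj (app A')" using inj_AdG[OF A(2)] by (rule injI)
  ultimately have "app (W qs q0') ` b = app (W qs q1) ` b" by (simp only: inj_image_eq_iff)
  then show ?thesis using q r_b[of q0' q1] by (auto simp: BQ_def)
qed

text \<open>Once the plaques meet, \<open>same_plaque\<close> keeps \<open>p\<close> inside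
  \<open>p'\<close> throughout the second chart. So \<open>p \<inter> p'\<close> is \<open>p\<close>
  intersected with the open image of that chart.\<close>

lemma coherent:
  assumes A: "A \<in> AdG" "A' \<in> AdG" and p: "p \<in> plaques (Bn, BQ, \<sigma> A)" "p' \<in> plaques (Bn, BQ, \<sigma> A')"
  shows "openin (subtopology T p) (p \<inter> p')"
proof (cases "p \<inter> p' = {}")
  case False
  obtain q0 where q0: "q0 \<in> BQ" "p = \<sigma> A ` (Bn \<times> {q0})" using p(1) by (auto simp: plaques_def)
  obtain q0' where q0': "q0' \<in> BQ" "p' = \<sigma> A' ` (Bn \<times> {q0'})" using p(2) by (auto simp: plaques_def)
  obtain y where y: "y \<in> p" "y \<in> p'" using False by blast
  obtain p0 where p0: "y = \<sigma> A (p0, q0)" using y(1) q0(2) by auto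
  obtain p0' where p0': "y = \<sigma> A' (p0', q0')" using y(2) q0'(2) by auto
  have "p \<inter> \<sigma> A' ` (Bn \<times> BQ) \<subseteq> p'"
  proof
    fix y1 assume y1: "y1 \<in> p \<inter> \<sigma> A' ` (Bn \<times> BQ)"
    obtain p1 where p1: "y1 = \<sigma> A (p1, q0)" using y1 q0(2) by auto
    obtain p1' q1 where p1': "y1 = \<sigma> A' (p1', q1)" "p1' \<in> Bn" "q1 \<in> BQ" using y1 by auto
    have "q1 = q0'"
      by (rule same_plaque[OF A q0'(1) p1'(3) trans[OF p0[symmetric] p0'] trans[OF p1[symmetric] p1'(1)]])
    then show "y1 \<in> p'" using p1' q0'(2) by auto
  qed
  moreover have "p' \<subseteq> \<sigma> A' ` (Bn \<times> BQ)" using q0' by auto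
  ultimately have "p \<inter> p' = \<sigma> A' ` (Bn \<times> BQ) \<inter> p" by blast
  moreover have "openin T (\<sigma> A' ` (Bn \<times> BQ))" by (rule \<sigma>_open[OF A(2) openin_subtopology_self])
  ultimately show ?thesis unfolding openin_subtopology by blast
qed simp

lemma foliation_F: "foliation T n Q F"
  unfolding foliation_def
proof (intro conjI ballI)
  show "subspace n" "subspace Q" by (rule subspace_n subspace_Q)+
  show "foliated_chart T n Q c" if "c \<in> F" for c
    using that foliated_chart_\<sigma> by (auto simp: F_def)
  have zero: "0 \<in> Bn" "0 \<in> BQ"
    using r_pos subspace_0[OF subspace_n] subspace_0[OF subspace_Q] by (simp_all add: Bn_def BQ_def)
  show "(\<Union>c\<in>F. \<Union> (plaques c)) = topspace T"
  proof
    show "(\<Union>c\<in>F. \<Union> (plaques c)) \<subseteq> topspace T"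
      using \<sigma>_orbit by (auto simp: F_def plaques_def topspace_orbit)
    show "topspace T \<subseteq> (\<Union>c\<in>F. \<Union> (plaques c))"
    proof
      fix y assume "y \<in> topspace T"
      then obtain A where A: "A \<in> AdG" "y = app A X" by (auto simp: topspace_orbit Ad_orbit_eq)
      then have "y = \<sigma> A (0, 0)" by (simp add: \<sigma>_def)
      then have "y \<in> \<sigma> A ` (Bn \<times> {0})" using zero by auto
      moreover have "\<sigma> A ` (Bn \<times> {0}) \<in> plaques (Bn, BQ, \<sigma> A)" using zero by (auto simp: plaques_def)
      moreover have "(Bn, BQ, \<sigma> A) \<in> F" using A by (auto simp: F_def)
      ultimately show "y \<in> (\<Union>c\<in>F. \<Union> (plaques c))" by blast
    qed
  qed
  fix c c' p p' assume c: "c \<in> F" "c' \<in> F" and p: "p \<in> plaques c" "p' \<in> plaques c'"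
  obtain A A' where A: "A \<in> AdG" "A' \<in> AdG" "c = (Bn, BQ, \<sigma> A)" "c' = (Bn, BQ, \<sigma> A')"
    using c by (auto simp: F_def)
  show "openin (subtopology T p) (p \<inter> p')"
    using p by (intro coherent[OF A(1,2)]) (simp_all add: A)
  show "openin (subtopology T p') (p \<inter> p')"
    unfolding Int_commute[of p] using p by (intro coherent[OF A(2,1)]) (simp_all add: A)
qed

lemma dim_\<D>_le: "dim (\<D> A) \<le> dim n" and subspace_\<D>: "subspace (\<D> A)"
proof -
  have "linear (\<lambda>u. app A (br u X))"
    using linear_compose[OF linear_br(2) linear_app] by (simp add: o_def)
  then show "dim (\<D> A) \<le> dim n" "subspace (\<D> A)"
    unfolding \<D>_def by (auto intro: dim_image_le linear_subspace_image subspace_n)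
qed

text \<open>\<open>W_orbit_tangent\<close> gives one inclusion. The derivative is injective on
  \<open>n\<close> and the right side has dimension at most \<open>dim n\<close>, so equality
  follows.\<close>

lemma chart_tangent:
  assumes A: "A \<in> AdG" and p: "p \<in> Bn" "q \<in> BQ"
  shows "(\<lambda>u. frechet_derivative (\<sigma> A) (at (p, q)) (u, 0)) ` n = \<D> (A * (W qs q * W ns p))"
proof -
  let ?s = "\<lambda>u. frechet_derivative (\<sigma> A) (at (p, q)) (u, 0)"
  let ?C = "A * (W qs q * W ns p)"
  have "((\<lambda>y. (y, q)) has_derivative (\<lambda>u. (u, 0))) (at p)" by (intro derivative_intros)
  from diff_chain_at[OF this \<sigma>_has_derivative]
  have 1: "((\<lambda>y. \<sigma> A (y, q)) has_derivative ?s) (at p)" by (simp add: o_def)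
  have "(W ns has_derivative dW ns p) (at p)" unfolding W_def by (rule expprod_derivative)
  then have "((\<lambda>y. app A (app (W qs q) (app (W ns y) X))) has_derivative
      (\<lambda>u. app A (app (W qs q) (app (dW ns p u) X)))) (at p)"
    by (intro bounded_linear.has_derivative[OF app.bounded_linear_right]
        bounded_linear.has_derivative[OF app.bounded_linear_left])
  then have "((\<lambda>y. \<sigma> A (y, q)) has_derivative (\<lambda>u. app A (app (W qs q) (app (dW ns p u) X)))) (at p)"
    by (simp add: \<sigma>_def)
  with 1 have s: "?s = (\<lambda>u. app A (app (W qs q) (app (dW ns p u) X)))" by (rule has_derivative_unique)
  have lin: "linear ?s" using 1 by (rule has_derivative_linear)
  have "?s ` n \<subseteq> \<D> ?C"
  proof clarify
    fix u assume "u \<in> n"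
    obtain w where w: "w \<in> n" "app (dW ns p u) X = br w (app (W ns p) X)"
      using W_orbit_tangent[OF subspace_n n_closed, of ns p u X] coords(2) by (auto simp: coordinates_def)
    have "w \<in> app (W ns p) ` n" using w(1) by (simp only: W_ns_image)
    then obtain w' where w': "w = app (W ns p) w'" "w' \<in> n" by (rule imageE)
    have "?s u = app ?C (br w' X)"
      using fun_cong[OF s, of u] by (simp add: w(2) w'(1) Aut_br[OF W_Aut])
    then show "?s u \<in> \<D> ?C" using w'(2) by (auto simp: \<D>_def)
  qed
  moreover have "dim (?s ` n) = dim n"
  proof (rule dim_image_eq[OF lin])
    have "inj_on ?s n"
    proof (rule inj_onI)
      fix u u' assume u: "u \<in> n" "u' \<in> n" "?s u = ?s u'"
      have "(u, 0) \<in> n \<times> Q" "(u', 0) \<in> n \<times> Q" using u subspace_0[OF subspace_Q] by auto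
      then have "(u, 0::real^'n) = (u', 0)"
        using inj_onD[OF \<sigma>_derivative_injective[OF A] u(3)] p by blast
      then show "u = u'" by simp
    qed
    then show "inj_on ?s (span n)" using subspace_n by (simp add: span_eq_iff[THEN iffD2])
  qed
  ultimately show ?thesis
    using dim_\<D>_le[of ?C] by (intro subspace_dim_equal linear_subspace_image[OF lin] subspace_n subspace_\<D>) auto
qed

lemma leaf_tangent_F:
  assumes B': "B' \<in> AdG" shows "leaf_tangent n F (app B' X) = \<D> B'"
proof -
  have chart: "(\<lambda>u. frechet_derivative (\<sigma> A) (at (p, q)) (u, 0)) ` n = \<D> B'"
    if A: "A \<in> AdG" and p: "p \<in> Bn" "q \<in> BQ" and y: "\<sigma> A (p, q) = app B' X" for A p q
    unfolding chart_tangent[OF A p]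
    using y by (intro distribution_well_defined AdG_mult A W_AdG B') (simp add: \<sigma>_def)
  have zero: "0 \<in> Bn" "0 \<in> BQ"
    using r_pos subspace_0[OF subspace_n] subspace_0[OF subspace_Q] by (simp_all add: Bn_def BQ_def)
  show ?thesis
  proof
    show "leaf_tangent n F (app B' X) \<subseteq> \<D> B'"
    proof
      fix v assume "v \<in> leaf_tangent n F (app B' X)"
      then obtain A p q u where *: "A \<in> AdG" "p \<in> Bn" "q \<in> BQ" "\<sigma> A (p, q) = app B' X" "u \<in> n"
        "v = frechet_derivative (\<sigma> A) (at (p, q)) (u, 0)"
        unfolding leaf_tangent_def F_def by auto
      show "v \<in> \<D> B'" unfolding chart[OF *(1-4), symmetric] *(6) using *(5) by (rule imageI)
    qed
    show "\<D> B' \<subseteq> leaf_tangent n F (app B' X)"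
    proof
      fix v assume v: "v \<in> \<D> B'"
      have \<sigma>0: "\<sigma> B' (0, 0) = app B' X" by (simp add: \<sigma>_def)
      have "v \<in> (\<lambda>u. frechet_derivative (\<sigma> B') (at (0, 0)) (u, 0)) ` n"
        unfolding chart[OF B' zero \<sigma>0] by (rule v)
      then obtain u where u: "v = frechet_derivative (\<sigma> B') (at (0, 0)) (u, 0)" "u \<in> n" by (rule imageE)
      have "(Bn, BQ, \<sigma> B') \<in> F" using B' by (auto simp: F_def)
      then show "v \<in> leaf_tangent n F (app B' X)"
        unfolding leaf_tangent_def using u zero \<sigma>0 by blast
    qed
  qed
qed

lemma left_invariant_F: "left_invariant G (U, \<phi>) (Ad_orbit G (U, \<phi>) X) (leaf_tangent n F)"
  unfolding left_invariant_def
proof (intro allI ballI)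
  fix g y assume "y \<in> Ad_orbit G (U, \<phi>) X"
  then obtain B' where B': "B' \<in> AdG" "y = app B' X" by (auto simp: Ad_orbit_eq)
  have g: "AdE g * B' \<in> AdG" using B'(1) by (intro AdG_mult) (auto simp: AdG_def)
  have "Ad G (U, \<phi>) g ` leaf_tangent n F y = \<D> (AdE g * B')"
    unfolding B'(2) leaf_tangent_F[OF B'(1)] \<D>_def app_AdE[symmetric] by (simp add: image_image)
  also have "\<dots> = leaf_tangent n F (Ad G (U, \<phi>) g y)"
    unfolding leaf_tangent_F[OF g, symmetric] B'(2) by (simp add: app_AdE)
  finally show "Ad G (U, \<phi>) g ` leaf_tangent n F y = leaf_tangent n F (Ad G (U, \<phi>) g y)" .
qed

text \<open>Invariance of the Killing form moves the point back to \<open>X\<close>. There all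
  representatives of tangent vectors of the leaf lie in \<open>b\<close>, and [b, b] is contained in
  \<open>n\<close>, which is orthogonal to \<open>X\<close>.\<close>

lemma isotropic_F: "isotropic_distribution br (Ad_orbit G (U, \<phi>) X) (leaf_tangent n F)"
  unfolding isotropic_distribution_def isotropic_at_def
proof (intro ballI)
  fix y u v
  assume "y \<in> Ad_orbit G (U, \<phi>) X" and u: "u \<in> {u. br u y \<in> leaf_tangent n F y}"
    and v: "v \<in> {u. br u y \<in> leaf_tangent n F y}"
  then obtain B' where B': "B' \<in> AdG" "y = app B' X" by (auto simp: Ad_orbit_eq)
  obtain Bi where Bi: "Bi \<in> AdG" "B' * Bi = 1" "Bi * B' = 1" using AdG_inverse[OF B'(1)] by blast
  have cancel: "app B' (app Bi x) = x" "app Bi (app B' x) = x" for x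
    unfolding app_mult[symmetric] Bi by simp_all
  have in_b: "app Bi u \<in> b" if "u \<in> {u. br u y \<in> leaf_tangent n F y}" for u
  proof -
    have "br u y \<in> \<D> B'" using that leaf_tangent_F[OF B'(1)] by (simp add: B'(2))
    then obtain w where w: "w \<in> n" "br u y = app B' (br w X)" by (auto simp: \<D>_def)
    have "br (app Bi u) X = app Bi (br u y)"
      by (simp add: Aut_br[OF AdG_Aut[OF Bi(1)]] B'(2) cancel)
    then have "br (app Bi u) X = br w X" by (simp add: w(2) cancel)
    then have "br (app Bi u) X \<in> b" using w(1) br_b[OF n_b[OF w(1)] h_b[OF X_in_h]] n_b by simp
    then show ?thesis by (rule in_b_if_br_X)
  qed
  have "kirillov_form br y u v = B (app B' X) (app B' (br (app Bi u) (app Bi v)))"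
    unfolding kirillov_form_def killing_B B'(2) by (simp add: Aut_br[OF AdG_Aut[OF B'(1)]] cancel)
  also have "\<dots> = B X (br (app Bi u) (app Bi v))" by (rule Aut_B[OF AdG_Aut[OF B'(1)]])
  also have "\<dots> = 0" by (rule B_X_n[OF br_b[OF in_b[OF u] in_b[OF v]]])
  finally show "kirillov_form br y u v = 0" .
qed

lemma leaf_tangent_X: "leaf_tangent n F X = (\<lambda>u. br u X) ` n"
  using leaf_tangent_F[OF AdG_one] by (simp add: \<D>_def)

end

context foliated_orbit
begin

lemma isotropic_n: "isotropic_at br X n"
  unfolding isotropic_at_def kirillov_form_def killing_B
  using B_X_n n_closed by blast

theorem left_invariant_isotropic_foliation:
  "\<exists>(P :: (real^'n) set) Q F. foliation (orbit_topology G (U, \<phi>) X) P Q F \<and>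
    left_invariant G (U, \<phi>) (Ad_orbit G (U, \<phi>) X) (leaf_tangent P F) \<and>
    isotropic_distribution br (Ad_orbit G (U, \<phi>) X) (leaf_tangent P F) \<and>
    leaf_tangent P F X = (\<lambda>u. br u X) ` n"
proof -
  define Q where "Q = {y. \<forall>x\<in>b. orthogonal x y}"
  have Q: "subspace Q" unfolding Q_def using subspace_orthogonal_to_vectors[of b] by simp
  have Qb: "Q \<inter> b \<subseteq> {0}" by (auto simp: Q_def orthogonal_def)
  have "dim Q + dim b = DIM(real^'n)"
    using dim_subspace_orthogonal_to_vectors[OF subspace_b subspace_UNIV] by (simp add: Q_def)
  note sum = sum_eq_UNIV[OF Q subspace_b Qb this]
  obtain pq where pq: "linear pq" "\<And>z. pq z \<in> Q" "\<And>z. z - pq z \<in> b" "\<And>z. z \<in> Q \<Longrightarrow> pq z = z"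
    "\<And>z. z \<in> b \<Longrightarrow> pq z = 0"
    using projection_exists[OF Q subspace_b Qb sum] by metis
  obtain p where p: "linear p" "\<And>z. p z \<in> h" "\<And>z. z - p z \<in> V" "\<And>z. z \<in> h \<Longrightarrow> p z = z"
    "\<And>z. z \<in> V \<Longrightarrow> p z = 0"
    using projection_exists[OF subspace_h subspace_V h_Int_V sum_h_V] by metis
  \<comment> \<open>\<open>pq\<close> removes the part in \<open>Q\<close> and leaves a vector of
    \<open>b\<close>. There the projection to \<open>h\<close> along \<open>V\<close> separates
    \<open>n\<close> from \<open>h\<close>, because \<open>n\<close> lies in
    \<open>V\<close>.\<close>
  define ph where "ph z = p (z - pq z)" for z
  define pn where "pn z = z - pq z - ph z" for z
  have lin: "linear ph" "linear pn"
  proof -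
    have "linear (\<lambda>z. z - pq z)" by (intro linear_compose_sub linear_ident pq(1))
    from linear_compose[OF this p(1)] show "linear ph" by (simp add: ph_def[abs_def] o_def)
    then show "linear pn" unfolding pn_def[abs_def] by (intro linear_compose_sub linear_ident pq(1))
  qed
  have p_b: "x - p x \<in> n" if x: "x \<in> b" for x
  proof -
    obtain u H where uH: "u \<in> n" "H \<in> h" "x = u + H" using x by (rule bE)
    then have "p x = H" using p(4,5) n_V by (simp add: linear_add[OF p(1)])
    then show ?thesis using uH by simp
  qed
  obtain qs where qs: "coordinates Q qs" by (rule coordinates_exist[OF Q])
  obtain ns where ns: "coordinates n ns" by (rule coordinates_exist[OF subspace_n])
  obtain hs where hs: "coordinates h hs" by (rule coordinates_exist[OF subspace_h])
  interpret foliated_orbit_charts br \<theta> G C U \<phi> h X n Q pq pn ph qs ns hs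
  proof (intro foliated_orbit_charts.intro foliated_orbit_charts_axioms.intro)
    show "foliated_orbit br \<theta> G C U \<phi> h X n" by (rule foliated_orbit_axioms)
    show "subspace Q" "Q \<inter> b \<subseteq> {0}" "linear pq" "linear pn" "linear ph" by (fact Q Qb pq(1) lin)+
    show "pq z \<in> Q" "pn z \<in> n" "ph z \<in> h" for z
      using pq(2) p(2) p_b[OF pq(3)] by (simp_all add: ph_def pn_def)
    show "pq z + pn z + ph z = z" for z by (simp add: pn_def)
    show "pq (u + q) = q \<and> pn (u + q) = u \<and> ph (u + q) = 0" if "q \<in> Q" "u \<in> n" for q u
    proof -
      have "pq (u + q) = q" using pq(4)[OF that(1)] pq(5)[OF n_b[OF that(2)]] by (simp add: linear_add[OF pq(1)])
      then show ?thesis using p(5)[OF n_V[OF that(2)]] by (simp add: pn_def ph_def)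
    qed
    show "pq x = 0" if "x \<in> b" for x using pq(5)[OF that] .
    show "coordinates Q qs" "coordinates n ns" "coordinates h hs" by (fact qs ns hs)+
  qed
  obtain r where r: "r > 0 \<and> inj_on (\<lambda>z. orbit_map z + ph z) (ball 0 (2 * r)) \<and>
    (\<forall>z\<in>ball 0 (2 * r). \<forall>D'. ((\<lambda>z. orbit_map z + ph z) has_derivative D') (at z) \<longrightarrow> inj D') \<and>
    (\<forall>q\<in>Q \<inter> ball 0 r. \<forall>q'\<in>Q \<inter> ball 0 r. app (W qs q) ` b = app (W qs q') ` b \<longrightarrow> q = q') \<and>
    (\<forall>z0\<in>ball 0 (2 * r). \<forall>N. open N \<longrightarrow> z0 \<in> N \<longrightarrow>
      (\<exists>\<delta>>0. \<forall>a\<in>Aut. norm (a - 1) < \<delta> \<longrightarrow> (\<exists>z\<in>N. \<Psi> z = \<Psi> z0 * a)))"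
    using chart_radius_exists ..
  interpret foliated_orbit_radius br \<theta> G C U \<phi> h X n Q pq pn ph qs ns hs r
    by unfold_locales (use r in \<open>simp_all\<close>)
  show ?thesis
    by (intro exI[of _ n] exI[of _ Q] exI[of _ F] conjI foliation_F left_invariant_F isotropic_F leaf_tangent_X)
qed

end

section \<open>Restricted roots\<close>

context cartan_lie_algebra
begin

text \<open>The factor \<open>c\<close> covers symmetric and skew operators alike. The squared norm
  of K^(k+1) y is \<open>c\<close> times the product of K^k y with K^(k+2) y, so the order of
  nilpotency can be lowered down to 1.\<close>

lemma nilpotent_symmetric_eq_0:
  assumes sym: "\<And>x y. ip (K x) y = c * ip x (K y)" and nil: "(K ^^ Suc k) y = 0"
  shows "K y = 0"
  using nil
proof (induction k)
  case (Suc k)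
  have "ip ((K ^^ Suc k) y) ((K ^^ Suc k) y) = c * ip ((K ^^ k) y) ((K ^^ Suc (Suc k)) y)"
    using sym[of "(K ^^ k) y"] by simp
  also have "\<dots> = 0" unfolding Suc.prems by (simp add: ip_linear)
  finally have "(K ^^ Suc k) y = 0" by (simp only: ip_eq_0)
  then show ?case by (rule Suc.IH)
qed simp

text \<open>The definition of a Cartan subalgebra gives nilpotency only. For an eigenvector
  \<open>z\<close> of \<theta> in \<open>h0\<close>, \<open>br z\<close> is symmetric or skew for
  \<open>ip\<close>, and its powers descend the lower central series; so it vanishes on
  \<open>h0\<close>.\<close>

lemma theta_stable_cartan_abelian:
  assumes h0: "cartan_subalgebra br h0" and theta: "\<And>x. x \<in> h0 \<Longrightarrow> \<theta> x \<in> h0"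
    and x: "x \<in> h0" and y: "y \<in> h0"
  shows "br x y = 0"
proof -
  have sub: "subspace h0" using h0 by (simp add: cartan_subalgebra_def subalgebra_def)
  obtain k where k: "lower_central br h0 k = {0}" using h0 by (auto simp: cartan_subalgebra_def)
  have mem: "(br z ^^ i) y \<in> lower_central br h0 i" if "z \<in> h0" for z i
  proof (induction i)
    case (Suc i)
    then show ?case using that by (auto intro!: span_base)
  qed (simp add: y)
  have zero: "br z y = 0" if z: "z \<in> h0" "\<theta> z = c *\<^sub>R z" for z c
  proof (rule nilpotent_symmetric_eq_0[where K = "br z" and c = "- c" and k = k])
    show "ip (br z x) y = - c * ip x (br z y)" for x y
      by (simp add: ip_adjoint z(2) br.scaleR_left ip_linear)
    have "(br z ^^ k) y = 0" using mem[OF z(1), of k] by (simp add: k)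
    then show "(br z ^^ Suc k) y = 0" by (simp add: br.zero_right)
  qed
  have "br (x + \<theta> x) y = 0" "br (x - \<theta> x) y = 0"
    using zero[of "x + \<theta> x" 1] zero[of "x - \<theta> x" "- 1"] sub x theta[OF x]
    by (simp_all add: subspace_add subspace_diff theta_linear)
  then have "br (x + \<theta> x) y + br (x - \<theta> x) y = 0" by simp
  then have "br (2 *\<^sub>R x) y = 0" by (simp only: br.add_left[symmetric]) (simp add: scaleR_2)
  then show ?thesis by (simp add: br.scaleR_left)
qed

lemma bilinear_span_eq_0:
  assumes "bilinear f" and "\<And>x y. x \<in> S \<Longrightarrow> y \<in> T \<Longrightarrow> f x y = 0" and x: "x \<in> span S" and y: "y \<in> span T"
  shows "f x y = 0"
proof -
  have lin: "linear (f x)" "linear (\<lambda>x. f x y)" for x y using assms(1) by (auto simp: bilinear_def)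
  have *: "f x y = 0" if "x \<in> S" for x
    by (rule linear_eq_0_on_span[OF lin(1) assms(2)[OF that] y])
  show ?thesis by (rule linear_eq_0_on_span[OF lin(2) * x])
qed

lemma bilinear_br: "bilinear br"
  using linear_br by (simp add: bilinear_def)

lemma bilinear_B: "bilinear B"
  unfolding bilinear_def by (auto intro!: linearI simp: B_linear)

lemma br_span:
  assumes "\<And>x y. x \<in> S \<Longrightarrow> y \<in> T \<Longrightarrow> br x y \<in> span R" "x \<in> span S" "y \<in> span T"
  shows "br x y \<in> span R"
proof -
  have "subspace {y. \<forall>x\<in>S. br x y \<in> span R}"
    by (auto intro!: subspaceI simp: br.zero_right br.add_right br.scaleR_right span_zero span_add span_scale)
  then have 1: "br x y \<in> span R" if "x \<in> S" for x
    using span_induct[OF assms(3), of "\<lambda>y. \<forall>x\<in>S. br x y \<in> span R"] assms(1) that by auto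
  have "subspace {x. br x y \<in> span R}"
    by (auto intro!: subspaceI simp: br.zero_left br.add_left br.scaleR_left span_zero span_add span_scale)
  then show ?thesis
    using span_induct[OF assms(2), of "\<lambda>x. br x y \<in> span R"] 1 by auto
qed

lemma root_space_iff: "x \<in> root_space br a \<mu> \<longleftrightarrow> (\<forall>y\<in>a. br y x = \<mu> y *\<^sub>R x)"
  by (simp add: root_space_def scalar_mult_eq_scaleR)

lemma root_space_br:
  assumes "x \<in> root_space br a \<mu>" "y \<in> root_space br a \<nu>"
  shows "br x y \<in> root_space br a (\<mu> + \<nu>)"
  using assms unfolding root_space_iff
  by (auto simp: jacobi[of _ x] br.scaleR_left br.scaleR_right scaleR_add_left)

lemma root_space_trivial: "functional_on a f \<Longrightarrow> f \<noteq> 0 \<Longrightarrow> f \<notin> roots br a \<Longrightarrow> root_space br a f = {0}"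
  by (simp add: roots_def)

end

lemma functional_on_add: "functional_on a f \<Longrightarrow> functional_on a g \<Longrightarrow> functional_on a (f + g)"
  and functional_on_diff: "functional_on a f \<Longrightarrow> functional_on a g \<Longrightarrow> functional_on a (f - g)"
  by (auto simp: functional_on_def algebra_simps)

text \<open>The real data to which the hypotheses about complex roots reduce: \<open>r m\<close> is
  the m-th real root on \<open>h0\<close>, \<open>\<beta> m\<close> its restriction to
  \<open>a\<close>, and \<open>S\<close> stands for \<Sigma>_n.\<close>

locale admissible_roots = cartan_lie_algebra br \<theta>
  for br :: "real^'n \<Rightarrow> real^'n \<Rightarrow> real^'n" and \<theta> +
  fixes h0 a :: "(real^'n) set" and r :: "nat \<Rightarrow> real^'n \<Rightarrow> real" and E :: "nat \<Rightarrow> real^'n" and N :: nat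
    and \<beta> :: "nat \<Rightarrow> real^'n \<Rightarrow> real" and S :: "(real^'n \<Rightarrow> real) set"
  assumes subspace_h0: "subspace h0"
    and h0_abelian: "\<And>x y. x \<in> h0 \<Longrightarrow> y \<in> h0 \<Longrightarrow> br x y = 0"
    and h0_theta: "\<And>x. x \<in> h0 \<Longrightarrow> \<theta> x \<in> h0"
    and a_h0: "a \<subseteq> h0"
    and r_linear: "\<And>m x y c. m \<in> {1..N} \<Longrightarrow> x \<in> h0 \<Longrightarrow> y \<in> h0 \<Longrightarrow> r m (x + y) = r m x + r m y \<and> r m (c *\<^sub>R x) = c * r m x"
    and r_theta: "\<And>m x. m \<in> {1..N} \<Longrightarrow> x \<in> h0 \<Longrightarrow> r m (\<theta> x) = - r m x"
    and br_E: "\<And>m x. m \<in> {1..N} \<Longrightarrow> x \<in> h0 \<Longrightarrow> br x (E m) = r m x *\<^sub>R E m"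
    and E_commute: "\<And>m k. m \<in> {1..N} \<Longrightarrow> k \<in> {1..N} \<Longrightarrow> m \<noteq> k \<Longrightarrow> br (E m) (E k) = 0 \<and> br (E m) (\<theta> (E k)) = 0"
    and \<beta>_r: "\<And>m x. m \<in> {1..N} \<Longrightarrow> x \<in> a \<Longrightarrow> \<beta> m x = r m x"
    and \<beta>_functional: "\<And>m. m \<in> {1..N} \<Longrightarrow> functional_on a (\<beta> m)"
    and S_roots: "S \<subseteq> roots br a"
    and S_neg: "\<And>\<mu>. \<mu> \<in> S \<Longrightarrow> - \<mu> \<notin> S"
    and S_cond: "sigma_conditions (roots br a) \<beta> N S"
begin

definition h0_ker :: "(real^'n) set" where "h0_ker = {x \<in> h0. \<forall>m\<in>{1..N}. r m x = 0}"
definition gens :: "(real^'n) set" where "gens = h0_ker \<union> (\<lambda>m. E m + \<theta> (E m)) ` {1..N}"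
definition h :: "(real^'n) set" where "h = h0_ker + span ((\<lambda>m. E m + \<theta> (E m)) ` {1..N})"
abbreviation n :: "(real^'n) set" where "n \<equiv> root_sum br a S"

lemma br_\<theta>E: "m \<in> {1..N} \<Longrightarrow> x \<in> h0 \<Longrightarrow> br x (\<theta> (E m)) = - (r m x *\<^sub>R \<theta> (E m))"
proof -
  assume m: "m \<in> {1..N}" and x: "x \<in> h0"
  have "br x (\<theta> (E m)) = \<theta> (br (\<theta> x) (E m))" by (simp add: theta_br)
  then show ?thesis using br_E[OF m h0_theta[OF x]] r_theta[OF m x] by (simp add: theta_linear)
qed

lemma subspace_h0_ker: "subspace h0_ker"
  using subspace_h0 r_linear[of _ 0 0 0] r_linear unfolding h0_ker_def
  by (auto intro!: subspaceI simp: subspace_0 subspace_add subspace_scale)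

lemma h_span: "h = span gens"
proof -
  have eq: "span h0_ker = h0_ker" using subspace_h0_ker by (rule span_eq_iff[THEN iffD2])
  show ?thesis
    unfolding h_def gens_def span_Un set_plus_def eq by blast
qed

lemma h_theta: "x \<in> h \<Longrightarrow> \<theta> x \<in> h"
proof -
  assume x: "x \<in> h"
  have "\<theta> ` gens \<subseteq> gens"
    unfolding gens_def h0_ker_def using h0_theta r_theta
    by (auto simp: theta_linear add.commute)
  then have "span (\<theta> ` gens) \<subseteq> span gens" by (rule span_mono)
  moreover have "\<theta> x \<in> span (\<theta> ` gens)"
    using x linear_span_image[OF linear_theta, of gens] by (simp add: h_span)
  ultimately show ?thesis unfolding h_span by blast
qed

lemma h_abelian: "x \<in> h \<Longrightarrow> y \<in> h \<Longrightarrow> br x y = 0"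
proof -
  assume x: "x \<in> h" and y: "y \<in> h"
  have 1: "br z (E m + \<theta> (E m)) = 0" if "z \<in> h0_ker" "m \<in> {1..N}" for z m
    using that br_E[of m z] br_\<theta>E[of m z] by (simp add: h0_ker_def br.add_right)
  have 2: "br (E m + \<theta> (E m)) (E k + \<theta> (E k)) = 0" if mk: "m \<in> {1..N}" "k \<in> {1..N}" for m k
  proof (cases "m = k")
    case False
    have "br (\<theta> (E m)) (\<theta> (E k)) = \<theta> (br (E m) (E k))" "br (\<theta> (E m)) (E k) = \<theta> (br (E m) (\<theta> (E k)))"
      by (simp_all add: theta_br)
    then show ?thesis using E_commute[OF mk False] by (simp add: br.add_left br.add_right theta_linear)
  qed simp
  have gens: "br z w = 0" if z: "z \<in> gens" and w: "w \<in> gens" for z w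
  proof -
    consider "z \<in> h0_ker" "w \<in> h0_ker"
      | m where "z \<in> h0_ker" "m \<in> {1..N}" "w = E m + \<theta> (E m)"
      | m where "w \<in> h0_ker" "m \<in> {1..N}" "z = E m + \<theta> (E m)"
      | m k where "m \<in> {1..N}" "k \<in> {1..N}" "z = E m + \<theta> (E m)" "w = E k + \<theta> (E k)"
      using z w unfolding gens_def by blast
    then show ?thesis
    proof cases
      case 1 then show ?thesis by (simp add: h0_ker_def h0_abelian)
    next
      case (2 m) then show ?thesis using 1 by simp
    next
      case (3 m) then show ?thesis using 1[of w m] br_anti[of z w] by simp
    next
      case (4 m k) then show ?thesis using 2 by simp
    qed
  qed
  show ?thesis
    by (rule bilinear_span_eq_0[OF bilinear_br gens]) (use x y in \<open>simp_all add: h_span\<close>)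
qed

lemma S_functional: "\<mu> \<in> S \<Longrightarrow> functional_on a \<mu>" and S_nonzero: "0 \<notin> S"
  using S_roots by (auto simp: roots_def)

lemma root_space_n: "\<mu> \<in> S \<Longrightarrow> x \<in> root_space br a \<mu> \<Longrightarrow> x \<in> n"
  unfolding root_sum_def by (rule span_base) blast

lemma subspace_n: "subspace n"
  by (simp add: root_sum_def)

text \<open>A functional that is neither a root nor 0 has trivial root space. The weight 0 belongs
  in the premise, as its root space is the centralizer of \<open>a\<close>; this is why
  \<open>sigma_conditions\<close> treats 0 as a weight.\<close>

lemma root_space_shift:
  assumes f: "functional_on a f" and x: "x \<in> root_space br a f" and S: "f \<in> roots br a \<union> {0} \<Longrightarrow> f \<in> S"
  shows "x \<in> n"
proof (cases "f \<in> roots br a \<union> {0}")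
  case True
  then show ?thesis using root_space_n[OF S x] by blast
next
  case False
  then have "x = 0" using root_space_trivial[OF f] x by auto
  then show ?thesis using subspace_n by (simp add: subspace_0)
qed

lemma n_closed: "x \<in> n \<Longrightarrow> y \<in> n \<Longrightarrow> br x y \<in> n"
  unfolding root_sum_def
proof (rule br_span)
  fix x y assume "x \<in> (\<Union>\<mu>\<in>S. root_space br a \<mu>)" "y \<in> (\<Union>\<mu>\<in>S. root_space br a \<mu>)"
  then obtain \<mu> \<nu> where \<mu>: "\<mu> \<in> S" "x \<in> root_space br a \<mu>" and \<nu>: "\<nu> \<in> S" "y \<in> root_space br a \<nu>" by blast
  have "br x y \<in> n"
  proof (rule root_space_shift[OF functional_on_add[OF S_functional[OF \<mu>(1)] S_functional[OF \<nu>(1)]]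
        root_space_br[OF \<mu>(2) \<nu>(2)]])
    assume "\<mu> + \<nu> \<in> roots br a \<union> {0}"
    \<comment> \<open>\<open>S\<close> is contained in a positive system and so has no opposite
      elements, which is the content of \<open>S_neg\<close>.\<close>
    moreover have "\<mu> + \<nu> \<noteq> 0"
    proof
      assume "\<mu> + \<nu> = 0"
      then have "\<nu> = - \<mu>" by (simp add: eq_neg_iff_add_eq_0 add.commute)
      then show False using S_neg[OF \<mu>(1)] \<nu>(1) by simp
    qed
    ultimately have "\<mu> + \<nu> \<in> (S + S) \<inter> roots br a" using \<mu>(1) \<nu>(1) by auto
    then show "\<mu> + \<nu> \<in> S" using S_cond unfolding sigma_conditions_def by blast
  qed
  then show "br x y \<in> span (\<Union>\<mu>\<in>S. root_space br a \<mu>)" by (simp add: root_sum_def)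
qed

lemma S_shift:
  assumes "m \<in> {1..N}" "\<mu> \<in> S"
  shows "\<beta> m + \<mu> \<in> roots br a \<union> {0} \<Longrightarrow> \<beta> m + \<mu> \<in> S" "- \<beta> m + \<mu> \<in> roots br a \<union> {0} \<Longrightarrow> - \<beta> m + \<mu> \<in> S"
proof -
  have "\<mu> + \<beta> m \<in> roots br a \<union> {0} \<longrightarrow> \<mu> + \<beta> m \<in> S" "\<mu> - \<beta> m \<in> roots br a \<union> {0} \<longrightarrow> \<mu> - \<beta> m \<in> S"
    using S_cond assms unfolding sigma_conditions_def by blast+
  then show "\<beta> m + \<mu> \<in> roots br a \<union> {0} \<Longrightarrow> \<beta> m + \<mu> \<in> S"
    "- \<beta> m + \<mu> \<in> roots br a \<union> {0} \<Longrightarrow> - \<beta> m + \<mu> \<in> S"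
    unfolding add.commute[of "\<beta> m"] uminus_add_conv_diff by blast+
qed

lemma E_root_space:
  assumes "m \<in> {1..N}"
  shows "E m \<in> root_space br a (\<beta> m)" "\<theta> (E m) \<in> root_space br a (- \<beta> m)"
  using a_h0 br_E[OF assms] br_\<theta>E[OF assms] \<beta>_r[OF assms] by (auto simp: root_space_iff)

text \<open>Elements of \<open>h0_ker\<close> commute with \<open>a\<close> and preserve each root
  space, while \<open>E m + \<theta> (E m)\<close> shifts weights by \<open>\<beta> m\<close> and
  \<open>- \<beta> m\<close>, under which \<open>S\<close> is closed.\<close>

lemma h_stable_n: "x \<in> h \<Longrightarrow> y \<in> n \<Longrightarrow> br x y \<in> n"
  unfolding h_span root_sum_def
proof (rule br_span)
  fix x y assume x: "x \<in> gens" and "y \<in> (\<Union>\<mu>\<in>S. root_space br a \<mu>)"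
  then obtain \<mu> where \<mu>: "\<mu> \<in> S" "y \<in> root_space br a \<mu>" by blast
  have "br x y \<in> n"
  proof (cases "x \<in> h0_ker")
    case True
    have "br x y \<in> root_space br a \<mu>"
      unfolding root_space_iff
    proof
      fix z assume z: "z \<in> a"
      have "br z x = 0" using True z a_h0 h0_abelian by (auto simp: h0_ker_def)
      then show "br z (br x y) = \<mu> z *\<^sub>R br x y"
        using \<mu>(2) z by (simp add: jacobi[of z x] root_space_iff br.zero_left br.scaleR_right)
    qed
    then show ?thesis by (rule root_space_n[OF \<mu>(1)])
  next
    case False
    then obtain m where m: "m \<in> {1..N}" "x = E m + \<theta> (E m)" using x by (auto simp: gens_def)
    have f: "functional_on a (\<beta> m + \<mu>)" "functional_on a (- \<beta> m + \<mu>)"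
      using functional_on_add[OF \<beta>_functional[OF m(1)] S_functional[OF \<mu>(1)]]
        functional_on_diff[OF S_functional[OF \<mu>(1)] \<beta>_functional[OF m(1)]] by simp_all
    have "br (E m) y \<in> n"
      by (rule root_space_shift[OF f(1) root_space_br[OF E_root_space(1)[OF m(1)] \<mu>(2)]])
        (rule S_shift(1)[OF m(1) \<mu>(1)])
    moreover have "br (\<theta> (E m)) y \<in> n"
      by (rule root_space_shift[OF f(2) root_space_br[OF E_root_space(2)[OF m(1)] \<mu>(2)]])
        (rule S_shift(2)[OF m(1) \<mu>(1)])
    ultimately show ?thesis using subspace_n by (simp add: m(2) br.add_left subspace_add)
  qed
  then show "br x y \<in> span (\<Union>\<mu>\<in>S. root_space br a \<mu>)" by (simp add: root_sum_def)
qed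

lemma B_root_spaces:
  assumes x: "x \<in> root_space br a \<mu>" and y: "y \<in> root_space br a \<nu>"
    and "functional_on a \<mu>" "functional_on a \<nu>" "\<nu> + \<mu> \<noteq> 0"
  shows "B x y = 0"
proof -
  obtain H where H: "(\<nu> + \<mu>) H \<noteq> 0" using assms(5) by (auto simp: fun_eq_iff)
  have "\<mu> H = 0 \<and> \<nu> H = 0" if "H \<notin> a" using assms(3,4) that by (simp add: functional_on_def)
  with H have "H \<in> a" by (cases "H \<in> a") simp_all
  then have "br H x = \<mu> H *\<^sub>R x" "br H y = \<nu> H *\<^sub>R y" using x y by (simp_all add: root_space_iff)
  moreover have "B (br H x) y = - B x (br H y)"
    using B_invariant[of x H y] br_anti[of x H] by (simp add: B_linear)
  ultimately have "(\<nu> + \<mu>) H * B x y = 0" by (simp add: B_linear algebra_simps)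
  then show ?thesis using H by simp
qed

text \<open>Root spaces are orthogonal for the Killing form unless their weights are opposite. The
  generators of \<open>h\<close> are made of vectors of weight 0, \<open>\<beta> m\<close> and
  \<open>- \<beta> m\<close>, and none of these is opposite to an element of
  \<open>S\<close>.\<close>

lemma B_n_h: "x \<in> n \<Longrightarrow> y \<in> h \<Longrightarrow> B x y = 0"
  unfolding h_span root_sum_def
proof (rule bilinear_span_eq_0[OF bilinear_B])
  fix x y assume "x \<in> (\<Union>\<mu>\<in>S. root_space br a \<mu>)" and y: "y \<in> gens"
  then obtain \<mu> where \<mu>: "\<mu> \<in> S" "x \<in> root_space br a \<mu>" by blast
  note fm = S_functional[OF \<mu>(1)]
  show "B x y = 0"
  proof (cases "y \<in> h0_ker")
    case True
    have "y \<in> root_space br a 0"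
      using True a_h0 h0_abelian by (auto simp: root_space_iff h0_ker_def)
    moreover have "functional_on a (0 :: real^'n \<Rightarrow> real)" by (simp add: functional_on_def)
    moreover have "0 + \<mu> \<noteq> 0" using \<mu>(1) S_nonzero by auto
    ultimately show ?thesis using B_root_spaces[OF \<mu>(2) _ fm] by blast
  next
    case False
    then obtain m where m: "m \<in> {1..N}" "y = E m + \<theta> (E m)" using y by (auto simp: gens_def)
    have "functional_on a (- \<beta> m)" using \<beta>_functional[OF m(1)] by (auto simp: functional_on_def)
    \<comment> \<open>If one of these sums were 0, closure of \<open>S\<close> under the shift would
      put 0 into \<open>S\<close>.\<close>
    moreover have "\<beta> m + \<mu> \<noteq> 0" "- \<beta> m + \<mu> \<noteq> 0" using S_shift[OF m(1) \<mu>(1)] S_nonzero by auto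
    ultimately have "B x (E m) = 0" "B x (\<theta> (E m)) = 0"
      using B_root_spaces[OF \<mu>(2) E_root_space(1)[OF m(1)] fm \<beta>_functional[OF m(1)]]
        B_root_spaces[OF \<mu>(2) E_root_space(2)[OF m(1)] fm] by blast+
    then show ?thesis by (simp add: m(2) B_linear)
  qed
qed

lemma n_Int_h: "n \<inter> h \<subseteq> {0}"
proof
  fix x assume x: "x \<in> n \<inter> h"
  then have "B x (\<theta> x) = 0" using B_n_h h_theta by simp
  then have "ip x x = 0" by (simp add: ip_def)
  then show "x \<in> {0}" by simp
qed

end

section \<open>Real roots of the complexification\<close>

lemma re_vec_cvec [simp]: "re_vec (cvec x) = x" and im_vec_cvec [simp]: "im_vec (cvec x) = 0"
  by (simp_all add: re_vec_def im_vec_def cvec_def vec_eq_iff)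

lemma re_im_vec_eq_iff: "z = w \<longleftrightarrow> re_vec z = re_vec w \<and> im_vec z = im_vec w"
  by (auto simp: re_vec_def im_vec_def vec_eq_iff complex_eq_iff)

lemma re_im_vec_simps [simp]:
  "re_vec (z + w) = re_vec z + re_vec w" "im_vec (z + w) = im_vec z + im_vec w"
  "re_vec (\<i> *s z) = - im_vec z" "im_vec (\<i> *s z) = re_vec z"
  "re_vec (complex_of_real c *s z) = c *\<^sub>R re_vec z" "im_vec (complex_of_real c *s z) = c *\<^sub>R im_vec z"
  "re_vec ((\<i> * complex_of_real c) *s z) = - (c *\<^sub>R im_vec z)" "im_vec ((\<i> * complex_of_real c) *s z) = c *\<^sub>R re_vec z"
  by (simp_all add: re_vec_def im_vec_def vec_eq_iff)

lemma cvec_re_im: "z = cvec (re_vec z) + \<i> *s cvec (im_vec z)"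
  by (simp add: re_im_vec_eq_iff)

lemma cvec_linear: "cvec (x + y) = cvec x + cvec y" "cvec (c *\<^sub>R x) = of_real c *s cvec x" "cvec 0 = 0"
  by (simp_all add: cvec_def vec_eq_iff)

context cartan_lie_algebra
begin

lemma complexify_bracket_simps:
  "re_vec (complexify_bracket br z w) = br (re_vec z) (re_vec w) - br (im_vec z) (im_vec w)"
  "im_vec (complexify_bracket br z w) = br (re_vec z) (im_vec w) + br (im_vec z) (re_vec w)"
  by (simp_all add: complexify_bracket_def)

end

locale complexified_cartan = cartan_lie_algebra br \<theta>
  for br :: "real^'n \<Rightarrow> real^'n \<Rightarrow> real^'n" and \<theta> +
  fixes h0 :: "(real^'n) set"
  assumes subspace_h0: "subspace h0" and h0_theta: "\<And>x. x \<in> h0 \<Longrightarrow> \<theta> x \<in> h0"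
begin

abbreviation rootsp :: "(complex^'n \<Rightarrow> complex) \<Rightarrow> (complex^'n) set" where
  "rootsp \<equiv> root_space (complexify_bracket br) (complexify_space h0)"

lemma cvec_in: "x \<in> h0 \<Longrightarrow> cvec x \<in> complexify_space h0" "x \<in> h0 \<Longrightarrow> \<i> *s cvec x \<in> complexify_space h0"
  using subspace_0[OF subspace_h0] subspace_neg[OF subspace_h0, of 0] by (simp_all add: complexify_space_def)

lemma functional_cvec:
  assumes f: "functional_on (complexify_space h0) f" and x: "x \<in> h0" and y: "y \<in> h0"
  shows "f (cvec (x + y)) = f (cvec x) + f (cvec y)" "f (cvec (c *\<^sub>R x)) = of_real c * f (cvec x)"
    "f (cvec x + \<i> *s cvec y) = f (cvec x) + \<i> * f (cvec y)"
  using f cvec_in[OF x] cvec_in[OF y] by (simp_all add: functional_on_def cvec_linear)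

lemma real_root_space:
  assumes real: "real_root h0 f" and z: "z \<in> rootsp f" and x: "x \<in> h0"
  shows "br x (re_vec z) = Re (f (cvec x)) *\<^sub>R re_vec z" "br x (im_vec z) = Re (f (cvec x)) *\<^sub>R im_vec z"
proof -
  have "complexify_bracket br (cvec x) z = of_real (Re (f (cvec x))) *s z"
    using z cvec_in(1)[OF x] real x unfolding root_space_def real_root_def
    by (simp add: of_real_Re)
  then have "re_vec (complexify_bracket br (cvec x) z) = Re (f (cvec x)) *\<^sub>R re_vec z"
    "im_vec (complexify_bracket br (cvec x) z) = Re (f (cvec x)) *\<^sub>R im_vec z" by simp_all
  then show "br x (re_vec z) = Re (f (cvec x)) *\<^sub>R re_vec z" "br x (im_vec z) = Re (f (cvec x)) *\<^sub>R im_vec z"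
    by (simp_all add: complexify_bracket_simps br.zero_left)
qed

lemma cvec_root_space:
  assumes f: "functional_on (complexify_space h0) f" "real_root h0 f"
    and e: "\<And>x. x \<in> h0 \<Longrightarrow> br x e = Re (f (cvec x)) *\<^sub>R e"
  shows "cvec e \<in> rootsp f"
  unfolding root_space_def
proof clarify
  fix y assume "y \<in> complexify_space h0"
  then have y: "re_vec y \<in> h0" "im_vec y \<in> h0" by (simp_all add: complexify_space_def)
  have real: "f (cvec x) = of_real (Re (f (cvec x)))" if "x \<in> h0" for x
    using f(2) that by (simp add: real_root_def of_real_Re)
  have "f y = f (cvec (re_vec y)) + \<i> * f (cvec (im_vec y))"
    using functional_cvec(3)[OF f(1) y] cvec_re_im[of y] by simp
  then have "f y *s cvec e = of_real (Re (f (cvec (re_vec y)))) *s cvec e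
      + \<i> *s (of_real (Re (f (cvec (im_vec y)))) *s cvec e)"
    using real[OF y(1)] real[OF y(2)] by (simp add: vector_sadd_rdistrib vector_smult_assoc)
  then show "complexify_bracket br y (cvec e) = f y *s cvec e"
    unfolding re_im_vec_eq_iff by (simp add: complexify_bracket_simps e[OF y(1)] e[OF y(2)] br.zero_right)
qed

text \<open>The weight is real on \<open>h0\<close>, so the real and imaginary parts of a root
  vector are eigenvectors separately, and one of them is nonzero.\<close>

lemma real_root_vector:
  assumes f: "f \<in> complex_roots br h0" "real_root h0 f"
  obtains e where "e \<noteq> 0" "\<And>x. x \<in> h0 \<Longrightarrow> br x e = Re (f (cvec x)) *\<^sub>R e"
proof -
  have z0: "0 \<in> rootsp f"
  proof -
    have "re_vec (0 :: complex^'n) = 0" "im_vec (0 :: complex^'n) = 0"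
      by (simp_all add: re_vec_def im_vec_def vec_eq_iff)
    then have "complexify_bracket br y 0 = 0" for y
      unfolding re_im_vec_eq_iff complexify_bracket_simps by (simp add: br.zero_right)
    then show ?thesis by (simp add: root_space_def)
  qed
  have "rootsp f \<noteq> {0}" using f(1) by (simp add: complex_roots_def roots_def)
  then obtain z where z: "z \<in> rootsp f" "z \<noteq> 0" using z0 by blast
  then have "re_vec z \<noteq> 0 \<or> im_vec z \<noteq> 0"
    using cvec_re_im[of z] by (auto simp: cvec_linear)
  then show ?thesis
  proof
    assume "re_vec z \<noteq> 0"
    then show ?thesis by (rule that) (rule real_root_space(1)[OF f(2) z(1)])
  next
    assume "im_vec z \<noteq> 0"
    then show ?thesis by (rule that) (rule real_root_space(2)[OF f(2) z(1)])
  qed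
qed

text \<open>A real root vanishes on the compact part of the Cartan subalgebra, whose elements act by
  skew-symmetric operators.\<close>

lemma real_root_theta:
  assumes f: "f \<in> complex_roots br h0" "real_root h0 f" and x: "x \<in> h0"
  shows "Re (f (cvec (\<theta> x))) = - Re (f (cvec x))"
proof -
  obtain e where e: "e \<noteq> 0" "\<And>x. x \<in> h0 \<Longrightarrow> br x e = Re (f (cvec x)) *\<^sub>R e"
    by (rule real_root_vector[OF f]) blast
  have "ip (br x e) e = - ip e (br (\<theta> x) e)" by (rule ip_adjoint)
  then have "(Re (f (cvec (\<theta> x))) + Re (f (cvec x))) * ip e e = 0"
    unfolding e(2)[OF x] e(2)[OF h0_theta[OF x]] by (simp add: ip_linear algebra_simps)
  then show ?thesis using e(1) by simp
qed

lemma non_root_vector_eq_0: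
  assumes f: "functional_on (complexify_space h0) f" "real_root h0 f" "f \<noteq> 0" "f \<notin> complex_roots br h0"
    and e: "\<And>x. x \<in> h0 \<Longrightarrow> br x e = Re (f (cvec x)) *\<^sub>R e"
  shows "e = 0"
proof -
  have "rootsp f = {0}" using f by (simp add: complex_roots_def roots_def)
  then have "cvec e = 0" using cvec_root_space[OF f(1,2) e] by blast
  then have "re_vec (cvec e) = re_vec (cvec (0 :: real^'n))" by (simp only: cvec_linear)
  then show ?thesis by simp
qed

end

section \<open>Passage from the complex root data to the real setting\<close>

theorem theorem3p5:
  fixes G :: "('p::{t2_space, second_countable_topology}) monoid"
    and C :: "('p, real^'n) chart set"
    and c :: "('p, real^'n) chart"
    and br :: "real^'n \<Rightarrow> real^'n \<Rightarrow> real^'n"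
    and \<theta> :: "real^'n \<Rightarrow> real^'n"
    and h0 a :: "(real^'n) set"
    and \<Delta>p :: "(complex^'n \<Rightarrow> complex) set"
    and \<Sigma> \<Sigma>p :: "(real^'n \<Rightarrow> real) set"
    and j :: nat
    and \<alpha> :: "nat \<Rightarrow> complex^'n \<Rightarrow> complex"
    and \<beta> :: "nat \<Rightarrow> real^'n \<Rightarrow> real"
    and E :: "nat \<Rightarrow> real^'n"
    and Sig :: "nat \<Rightarrow> (real^'n \<Rightarrow> real) set"
  assumes "lie_group G C" and "connected (UNIV :: 'p set)" and "lie_algebra_of G C c br"
    and "simple_lie_algebra br" and "\<not> compact_lie_algebra br" and "\<not> complex_lie_algebra br"
    and "cartan_involution br \<theta>"
    and "max_noncompact_cartan br \<theta> h0" and "a = h0 \<inter> cartan_p \<theta>"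
    and "\<Sigma> = roots br a"
    and "positive_system (complex_roots br h0) \<Delta>p" and "positive_system \<Sigma> \<Sigma>p"
    and "compatible_positive_systems a \<Delta>p \<Sigma>p"
    and "inj_on \<alpha> {1..j}" and "real_admissible br h0 \<Delta>p (\<alpha> ` {1..j})"
    and "\<forall>n\<in>{1..j}. normalized_root_vector br \<theta> h0 (\<alpha> n) (E n)"
    and "\<forall>n\<in>{1..j}. \<beta> n = restrict_root a (\<alpha> n)"
    and "Sig 0 = \<Sigma>p"
    and "\<forall>n\<in>{1..j}. largest_with (\<lambda>S. S \<subseteq> Sig (n - 1) \<and> sigma_conditions \<Sigma> \<beta> n S) (Sig n)"
    and "n \<in> {1..j}"
    and "\<nn> = root_sum br a (Sig n)"
    and "\<hh> = cartan_transform \<theta> h0 \<alpha> E n"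
  shows "subalgebra br \<nn> \<and> (\<forall>x\<in>\<hh>. \<forall>u\<in>\<nn>. br x u \<in> \<nn>) \<and>
    (\<forall>X. regular_element br X \<and> stabilizer_algebra br X = \<hh> \<longrightarrow>
       \<nn> \<inter> stabilizer_algebra br X = {0} \<and> isotropic_at br X \<nn> \<and>
       (\<exists>(P :: (real^'n) set) Q F.
          foliation (orbit_topology G c X) P Q F \<and>
          left_invariant G c (Ad_orbit G c X) (leaf_tangent P F) \<and>
          isotropic_distribution br (Ad_orbit G c X) (leaf_tangent P F) \<and>
          leaf_tangent P F X = (\<lambda>u. br u X) ` \<nn>))"
proof -
  obtain U \<phi> where c: "c = (U, \<phi>)" by force
  have cla: "cartan_lie_algebra br \<theta>"
    using assms(4,7) by (intro cartan_lie_algebra.intro) (simp_all add: simple_lie_algebra_def)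
  interpret cartan_lie_algebra br \<theta> by (rule cla)
  have cartan_h0: "cartan_subalgebra br h0" and theta_h0: "\<theta> ` h0 = h0"
    using assms(8) by (simp_all add: max_noncompact_cartan_def)
  have h0_theta: "\<theta> x \<in> h0" if "x \<in> h0" for x using theta_h0 that by blast
  have subspace_h0: "subspace h0" using cartan_h0 by (simp add: cartan_subalgebra_def subalgebra_def)
  interpret cc: complexified_cartan br \<theta> h0
    by (intro complexified_cartan.intro cla complexified_cartan_axioms.intro subspace_h0 h0_theta)
  define r where "r m x = Re (\<alpha> m (cvec x))" for m x
  have in_j: "m \<in> {1..j}" if "m \<in> {1..n}" for m using that assms(20) by auto
  have adm: "\<alpha> m \<in> \<Delta>p" "real_root h0 (\<alpha> m)" if "m \<in> {1..n}" for m
    using assms(15) in_j[OF that] by (auto simp: real_admissible_def)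
  have root: "\<alpha> m \<in> complex_roots br h0" if "m \<in> {1..n}" for m
    using assms(11) adm(1)[OF that] by (auto simp: positive_system_def)
  have functional: "functional_on (complexify_space h0) (\<alpha> m)" if "m \<in> {1..n}" for m
    using root[OF that] by (simp add: complex_roots_def roots_def)
  have \<alpha>_r: "\<alpha> m (cvec x) = of_real (r m x)" if "m \<in> {1..n}" "x \<in> h0" for m x
    using adm(2)[OF that(1)] that(2) by (simp add: real_root_def r_def of_real_Re)
  have r_theta: "r m (\<theta> x) = - r m x" if "m \<in> {1..n}" "x \<in> h0" for m x
    unfolding r_def by (rule cc.real_root_theta[OF root[OF that(1)] adm(2)[OF that(1)] that(2)])
  have br_E: "br x (E m) = r m x *\<^sub>R E m" if "m \<in> {1..n}" "x \<in> h0" for m x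
  proof -
    have "cvec (E m) \<in> root_space (complexify_bracket br) (complexify_space h0) (\<alpha> m)"
      using assms(16) in_j[OF that(1)] by (simp add: normalized_root_vector_def)
    from cc.real_root_space(1)[OF adm(2)[OF that(1)] this that(2)] show ?thesis by (simp add: r_def)
  qed
  have br_\<theta>E: "br x (\<theta> (E m)) = - (r m x *\<^sub>R \<theta> (E m))" if "m \<in> {1..n}" "x \<in> h0" for m x
  proof -
    have "br x (\<theta> (E m)) = \<theta> (br (\<theta> x) (E m))" by (simp add: theta_br)
    then show ?thesis using br_E[OF that(1) h0_theta[OF that(2)]] r_theta[OF that] by (simp add: theta_linear)
  qed
  \<comment> \<open>The brackets have the weights \<open>\<alpha> m + \<alpha> k\<close> and
    \<open>\<alpha> m - \<alpha> k\<close>, since \<theta> negates real roots. Neither is a root by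
    admissibility, and neither is 0: both roots are positive, and they are distinct.\<close>
  have E_commute: "br (E m) (E k) = 0 \<and> br (E m) (\<theta> (E k)) = 0"
    if mk: "m \<in> {1..n}" "k \<in> {1..n}" "m \<noteq> k" for m k
  proof
    have not_root: "\<alpha> m + \<alpha> k \<notin> complex_roots br h0" "\<alpha> m - \<alpha> k \<notin> complex_roots br h0"
      using assms(15) in_j[OF mk(1)] in_j[OF mk(2)] by (auto simp: real_admissible_def)
    have real: "real_root h0 (\<alpha> m + \<alpha> k)" "real_root h0 (\<alpha> m - \<alpha> k)"
      using adm(2)[OF mk(1)] adm(2)[OF mk(2)] by (auto simp: real_root_def)
    show "br (E m) (E k) = 0"
    proof (rule cc.non_root_vector_eq_0[OF functional_on_add[OF functional[OF mk(1)] functional[OF mk(2)]]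
          real(1) _ not_root(1)])
      show "\<alpha> m + \<alpha> k \<noteq> 0"
      proof
        assume "\<alpha> m + \<alpha> k = 0"
        then have "\<alpha> k = - \<alpha> m" by (simp add: eq_neg_iff_add_eq_0 add.commute)
        then show False
          using assms(11) root[OF mk(1)] adm(1)[OF mk(1)] adm(1)[OF mk(2)] by (auto simp: positive_system_def)
      qed
      show "br x (br (E m) (E k)) = Re ((\<alpha> m + \<alpha> k) (cvec x)) *\<^sub>R br (E m) (E k)" if "x \<in> h0" for x
        using br_E[OF mk(1) that] br_E[OF mk(2) that]
        by (simp add: jacobi[of x] br.scaleR_left br.scaleR_right r_def scaleR_add_left)
    qed
    show "br (E m) (\<theta> (E k)) = 0"
    proof (rule cc.non_root_vector_eq_0[OF functional_on_diff[OF functional[OF mk(1)] functional[OF mk(2)]]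
          real(2) _ not_root(2)])
      have "\<alpha> m \<noteq> \<alpha> k" using inj_onD[OF assms(14) _ in_j[OF mk(1)] in_j[OF mk(2)]] mk(3) by blast
      then show "\<alpha> m - \<alpha> k \<noteq> 0" by simp
      show "br x (br (E m) (\<theta> (E k))) = Re ((\<alpha> m - \<alpha> k) (cvec x)) *\<^sub>R br (E m) (\<theta> (E k))" if "x \<in> h0" for x
        using br_E[OF mk(1) that] br_\<theta>E[OF mk(2) that]
        by (simp add: jacobi[of x] br.scaleR_left br.scaleR_right br.minus_right r_def scaleR_diff_left)
    qed
  qed
  have r_linear: "r m (x + y) = r m x + r m y \<and> r m (c *\<^sub>R x) = c * r m x"
    if "m \<in> {1..n}" "x \<in> h0" "y \<in> h0" for m x y c
    using cc.functional_cvec(1,2)[OF functional[OF that(1)] that(2,3)] by (simp add: r_def)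
  have a_h0: "a \<subseteq> h0" using assms(9) by blast
  have subspace_a: "subspace a"
    unfolding assms(9) cartan_p_def using subspace_h0
    by (auto intro!: subspaceI simp: theta_linear subspace_0 subspace_add subspace_scale)
  have \<beta>: "\<beta> m = (\<lambda>x. if x \<in> a then r m x else 0)" if "m \<in> {1..n}" for m
    using bspec[OF assms(17) in_j[OF that]] unfolding restrict_root_def r_def .
  have \<beta>_functional: "functional_on a (\<beta> m)" if "m \<in> {1..n}" for m
    unfolding functional_on_def \<beta>[OF that] scalar_mult_eq_scaleR
    using r_linear[OF that] a_h0 subspace_a by (auto simp: subspace_add subspace_scale)
  \<comment> \<open>Each set lies in its predecessor, down to the positive system. This is what
    excludes opposite elements in \<open>Sig n\<close>.\<close>
  have Sig_sub: "Sig k \<subseteq> \<Sigma>p" if "k \<le> j" for k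
    using that
  proof (induction k)
    case (Suc k)
    then have "Suc k \<in> {1..j}" by simp
    then have "Sig (Suc k) \<subseteq> Sig (Suc k - 1)" using assms(19) unfolding largest_with_def by blast
    then show ?case using Suc by auto
  qed (simp add: assms(18))
  have Sig_n: "Sig n \<subseteq> \<Sigma>p" using Sig_sub assms(20) by simp
  have ar: "admissible_roots br \<theta> h0 a r E n \<beta> (Sig n)"
  proof (intro admissible_roots.intro cla admissible_roots_axioms.intro)
    show "br x y = 0" if "x \<in> h0" "y \<in> h0" for x y
      by (rule theta_stable_cartan_abelian[OF cartan_h0 h0_theta that])
    show "\<beta> m x = r m x" if "m \<in> {1..n}" "x \<in> a" for m x using \<beta>[OF that(1)] that(2) by simp
    show "Sig n \<subseteq> roots br a" using Sig_n assms(10,12) by (auto simp: positive_system_def)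
    show "- \<mu> \<notin> Sig n" if "\<mu> \<in> Sig n" for \<mu>
      using Sig_n that assms(12) unfolding positive_system_def by blast
    show "sigma_conditions (roots br a) \<beta> n (Sig n)"
      using assms(19,20) by (auto simp: largest_with_def assms(10))
  qed (fact subspace_h0 h0_theta a_h0 r_linear r_theta br_E E_commute \<beta>_functional)+
  interpret ar: admissible_roots br \<theta> h0 a r E n \<beta> "Sig n" by (rule ar)
  have hh: "\<hh> = ar.h"
  proof -
    have "{x \<in> h0. \<forall>m\<in>{1..n}. \<alpha> m (cvec x) = 0} = ar.h0_ker"
      using \<alpha>_r by (auto simp: ar.h0_ker_def)
    then show ?thesis unfolding assms(22) cartan_transform_def ar.h_def by simp
  qed
  have sub: "subalgebra br \<nn>"
    unfolding subalgebra_def assms(21) using ar.n_closed ar.subspace_n by blast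
  have stable: "\<forall>x\<in>\<hh>. \<forall>u\<in>\<nn>. br x u \<in> \<nn>"
    unfolding hh assms(21) using ar.h_stable_n by blast
  have main: "\<nn> \<inter> stabilizer_algebra br X = {0} \<and> isotropic_at br X \<nn> \<and>
      (\<exists>(P :: (real^'n) set) Q F.
          foliation (orbit_topology G c X) P Q F \<and>
          left_invariant G c (Ad_orbit G c X) (leaf_tangent P F) \<and>
          isotropic_distribution br (Ad_orbit G c X) (leaf_tangent P F) \<and>
          leaf_tangent P F X = (\<lambda>u. br u X) ` \<nn>)"
    if X: "stabilizer_algebra br X = \<hh>" for X
  proof -
    have rc: "regular_cartan br \<theta> ar.h X"
    proof (intro regular_cartan.intro cla regular_cartan_axioms.intro)
      show "ar.h = {y. br X y = 0}" using X by (simp add: hh stabilizer_algebra_def)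
    qed (fact ar.h_abelian ar.h_theta)+
    have lg: "lie_group_algebra br \<theta> G C U \<phi>"
      using assms(1,3) by (intro lie_group_algebra.intro cla lie_group_algebra_axioms.intro) (simp_all add: c)
    interpret rc: regular_cartan br \<theta> ar.h X by (rule rc)
    interpret fo: foliated_orbit br \<theta> G C U \<phi> ar.h X \<nn>
    proof (intro foliated_orbit.intro lg rc foliated_orbit_axioms.intro assms(2))
      show "rc.h_stable \<nn>"
        unfolding rc.h_stable_def assms(21) using ar.subspace_n ar.h_stable_n by blast
    qed (unfold assms(21), (fact ar.n_closed ar.n_Int_h)+)
    have "0 \<in> \<nn>" "0 \<in> ar.h" using subspace_0[OF fo.subspace_n] subspace_0[OF rc.subspace_h] by auto
    then have "\<nn> \<inter> stabilizer_algebra br X = {0}" using fo.n_h unfolding X hh by blast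
    then show ?thesis unfolding c using fo.isotropic_n fo.left_invariant_isotropic_foliation by (intro conjI)
  qed
  show ?thesis using main by (intro conjI[OF sub conjI[OF stable]] allI impI) (elim conjE)
qed

end
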